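(* For all integers $n\geq 0$, \[ M_{\omega}(2,5,5n+1)-M_{\omega}(3,5,5n+1)=NT(2,5,5n+1)-NT(3,5,5n+1). \]
   Context: For a partition $\pi$ of a positive integer $n$ (written $\pi\vdash n$), let $\#(\pi)$ be the number of parts, $\lambda(\pi)$ the largest part, $\omega(\pi)$ the number of parts equal to $1$, and $\mu(\pi)$ the number of parts larger than $\omega(\pi)$. The rank is $\mathrm{rank}(\pi)=\lambda(\pi)-\#(\pi)$. The crank is $\mathrm{crank}(\pi)=\lambda(\pi)$ if $\omega(\pi)=0$ and $\mathrm{crank}(\pi)=\mu(\pi)-\omega(\pi)$ otherwise. For integers $m$, $j\ge1$, $n\ge0$: $NT(m,j,n)=\sum_{\pi\vdash n,\ \mathrm{rank}(\pi)\equiv m \ (\mathrm{mod}\ j)}\#(\pi)$ and $M_{\omega}(m,j,n)=\sum_{\pi\vdash n,\ \mathrm{crank}(\pi)\equiv m\ (\mathrm{mod}\ j)}\omega(\pi)$. *)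

theory Defs
  imports "HOL-Library.Multiset" "HOL-Number_Theory.Cong"
begin

definition partitions :: "nat \<Rightarrow> nat multiset set" where
  "partitions n = {p. 0 \<notin># p \<and> \<Sum>\<^sub># p = n}"

text \<open>The empty partition (the only partition of \<open>0\<close>) is given largest part \<open>0\<close>.\<close>

definition largest_part :: "nat multiset \<Rightarrow> nat" where
  "largest_part p = (if p = {#} then 0 else Max (set_mset p))"

definition ones :: "nat multiset \<Rightarrow> nat" where
  "ones p = count p 1"

definition mu :: "nat multiset \<Rightarrow> nat" where
  "mu p = size {#i \<in># p. i > ones p#}"

definition rank :: "nat multiset \<Rightarrow> int" where
  "rank p = int (largest_part p) - int (size p)"

definition crank :: "nat multiset \<Rightarrow> int" where
  "crank p = (if ones p = 0 then int (largest_part p) else int (mu p) - int (ones p))"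

definition NT :: "int \<Rightarrow> int \<Rightarrow> nat \<Rightarrow> int" where
  "NT m j n = (\<Sum>p | p \<in> partitions n \<and> [rank p = m] (mod j). int (size p))"

definition M_omega :: "int \<Rightarrow> int \<Rightarrow> nat \<Rightarrow> int" where
  "M_omega m j n = (\<Sum>p | p \<in> partitions n \<and> [crank p = m] (mod j). int (ones p))"

text \<open>Finiteness ensures that the sums above are genuine sums, not the default value \<open>0\<close>.\<close>

lemma finite_partitions: "finite (partitions n)"
proof -
  have sz: "size p \<le> \<Sum>\<^sub># p" if "0 \<notin># p" for p :: "nat multiset"
    using that by (induction p) auto
  have "partitions n \<subseteq> mset ` {xs. set xs \<subseteq> {..n} \<and> length xs \<le> n}"
  proof
    fix p assume p: "p \<in> partitions n"
    obtain xs where xs: "mset xs = p" using ex_mset by blast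
    have "set xs \<subseteq> {..n}"
      using p xs by (auto simp: partitions_def sum_mset_sum_list intro: member_le_sum_list)
    moreover have "length xs \<le> n"
      using p xs sz[of p] by (auto simp: partitions_def)
    ultimately show "p \<in> mset ` {xs. set xs \<subseteq> {..n} \<and> length xs \<le> n}"
      using xs by blast
  qed
  then show ?thesis
    using finite_lists_length_le[of "{..n}" n] finite_surj by blast
qed

end

theory Submission
  imports "HOL-Analysis.Analysis" "HOL-Computational_Algebra.Formal_Power_Series" "HOL-Computational_Algebra.Polynomial" Defs
begin

text \<open>Let \<open>chi\<close> be the difference of the indicators of \<open>2\<close> and \<open>3\<close> modulo \<open>5\<close>. As \<open>chi\<close> is odd, both sides
  are first moments \<open>- \<Sum>m\<ge>1. m chi(m) N(m, n)\<close>, where \<open>N(m, n)\<close> counts partitions of rank \<open>m\<close> (for \<open>NT\<close>, by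
  conjugation) or crank \<open>m\<close> (for \<open>M_omega\<close>). Dyson's recursion for the rank and its analogue for the crank
  express \<open>N(m, n)\<close> through partition numbers \<open>p(n - t(\<plusminus>k) - m k)\<close> with \<open>t\<close> the pentagonal, respectively the
  triangular numbers. For \<open>n \<equiv> 1 (mod 5)\<close> the moments then have generating functions that are bilateral sums
  \<open>\<Sum>k. (-1)^k Psi(1 - t(k) - e k) f(y^k)\<close> with \<open>Psi z = \<Sum>n. p(5n + z) y^n\<close> and \<open>f\<close> a rational function with its
  pole at \<open>1\<close>. Splitting \<open>k\<close> modulo \<open>5\<close>, these sums are evaluated by identities for quotients of theta
  products: limits of finite partial fraction expansions, compared at \<open>x = 1\<close> to first and second order.
  The triple and quintuple product identities give the linear relations between the five series
  \<open>Psi 0, \<dots>, Psi 4\<close> that make the two evaluations agree for all small \<open>y\<close>.\<close>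

section \<open>Conjugation and the rank moment\<close>

text \<open>Rank and crank run in parallel because both exponents satisfy t(-k) = t(k) - k, which
  folds two one-sided sums into a bilateral one, and are quadratic, so k = 5l + b shifts the
  argument of \<open>Psi\<close> by a multiple of 5. In l the exponents grow like 15 l^2/2 and 5
  l^2/2; a theta quotient produces this when per period it has three poles, respectively one pole,
  more than zeros. The obstacle is the term k = 0, missing from the sums because f has its pole
  there. An expansion must be read at x = 1 with the pole at 1 removed, and the values are
  logarithmic derivatives of theta products (\<open>rho\<close>, \<open>PP\<close>) instead of
  products. Evaluating the same sums with two different pole sets gives the relations that eliminate
  them. The sums over single residues b are in general not evaluated alone: only combinations over
  suitable sets of b belong to an expansion, and the relations between the \<open>Psi\<close>
  regroup the coefficients into these combinations.\<close>

definition drop_column :: "nat multiset \<Rightarrow> nat multiset" where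
  "drop_column p = filter_mset (\<lambda>i. 0 < i) (image_mset (\<lambda>i. i - 1) p)"

text \<open>The padding zeros become parts 1. The subtraction is truncated: for
  \<open>k < size p\<close> nothing is padded and the added column has height \<open>size p\<close>,
  whence the hypotheses \<open>size p \<le> k\<close> below.\<close>

definition add_column :: "nat \<Rightarrow> nat multiset \<Rightarrow> nat multiset" where
  "add_column k p = image_mset Suc (p + replicate_mset (k - size p) 0)"

lemma drop_column_simps:
  "drop_column {#} = {#}"
  "drop_column (add_mset i p) = (if i \<le> 1 then drop_column p else add_mset (i - 1) (drop_column p))"
  by (auto simp: drop_column_def)

lemma drop_column_union [simp]: "drop_column (p + r) = drop_column p + drop_column r"
  by (simp add: drop_column_def)

lemma zero_notin_drop_column: "0 \<notin># drop_column p"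
  by (simp add: drop_column_def)

lemma size_drop_column_le: "size (drop_column p) \<le> size p"
  unfolding drop_column_def by (metis size_filter_mset_lesseq size_image_mset)

lemma sum_drop_column: "0 \<notin># p \<Longrightarrow> \<Sum>\<^sub># p = \<Sum>\<^sub># (drop_column p) + size p"
  by (induction p) (auto simp: drop_column_simps)

lemma drop_column_replicate_one: "drop_column (replicate_mset k (Suc 0)) = {#}"
  by (induction k) (auto simp: drop_column_simps)

lemma drop_column_image_Suc: "0 \<notin># p \<Longrightarrow> drop_column (image_mset Suc p) = p"
  by (induction p) (auto simp: drop_column_simps)

lemma drop_column_add_column: "0 \<notin># p \<Longrightarrow> drop_column (add_column k p) = p"
  by (simp add: add_column_def drop_column_image_Suc drop_column_replicate_one)

lemma size_add_column: "size p \<le> k \<Longrightarrow> size (add_column k p) = k"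
  by (simp add: add_column_def)

lemma zero_notin_add_column: "0 \<notin># add_column k p"
  by (auto simp: add_column_def)

lemma sum_add_column:
  assumes "0 \<notin># p" "size p \<le> k"
  shows "\<Sum>\<^sub># (add_column k p) = \<Sum>\<^sub># p + k"
  using sum_drop_column[OF zero_notin_add_column, of k p] assms
  by (simp add: drop_column_add_column size_add_column)

lemma replicate_Suc_size_diff:
  "k \<ge> size p \<Longrightarrow> replicate_mset (Suc k - size p) x = add_mset x (replicate_mset (k - size p) x)"
  by (simp add: Suc_diff_le)

lemma add_column_Suc:
  assumes "size p \<le> k" shows "add_column (Suc k) p = add_mset 1 (add_column k p)"
  using assms unfolding add_column_def by (simp add: replicate_Suc_size_diff)

text \<open>Only parts equal to 1 disappear under \<open>drop_column\<close>, and
  \<open>size p - size (drop_column p)\<close>, the number of padding zeros, is exactly their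
  number.\<close>

lemma add_column_drop_column: "0 \<notin># p \<Longrightarrow> add_column (size p) (drop_column p) = p"
proof (induction p)
  case empty
  then show ?case by (simp add: add_column_def drop_column_simps)
next
  case (add i p)
  then have IH: "add_column (size p) (drop_column p) = p" and i: "i > 0"
    by auto
  show ?case
  proof (cases "i = 1")
    case True
    then show ?thesis
      using IH by (simp add: drop_column_simps add_column_Suc[OF size_drop_column_le])
  next
    case False
    then show ?thesis using i IH by (simp add: drop_column_simps add_column_def)
  qed
qed

lemma largest_part_le_iff: "largest_part p \<le> l \<longleftrightarrow> (\<forall>i\<in>#p. i \<le> l)"
  by (auto simp: largest_part_def)

lemma largest_part_ge: "i \<in># p \<Longrightarrow> i \<le> largest_part p"
  using largest_part_le_iff by blast

lemma largest_part_in: "p \<noteq> {#} \<Longrightarrow> largest_part p \<in># p"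
  by (simp add: largest_part_def)

lemma largest_part_eqI: "i \<in># p \<Longrightarrow> (\<And>j. j \<in># p \<Longrightarrow> j \<le> i) \<Longrightarrow> largest_part p = i"
  by (metis antisym largest_part_ge largest_part_in empty_iff set_mset_empty)

lemma largest_part_le_SucD: "largest_part p \<le> Suc l \<Longrightarrow> Suc l \<notin># p \<Longrightarrow> largest_part p \<le> l"
  by (metis largest_part_in largest_part_def le_Suc_eq zero_le)

lemma largest_drop_column_le_iff: "largest_part (drop_column p) \<le> l \<longleftrightarrow> largest_part p \<le> Suc l"
  by (auto simp: largest_part_le_iff drop_column_def)

lemma size_le_sum: "0 \<notin># p \<Longrightarrow> size p \<le> \<Sum>\<^sub># (p::nat multiset)"
  using sum_drop_column[of p] by simp

lemma size_le_partition: "p \<in> partitions n \<Longrightarrow> size p \<le> n"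
  using size_le_sum by (auto simp: partitions_def)

lemma part_le_partition: "p \<in> partitions n \<Longrightarrow> i \<in># p \<Longrightarrow> i \<le> n"
  unfolding partitions_def by (auto dest!: multi_member_split)

lemma largest_part_le_partition: "p \<in> partitions n \<Longrightarrow> largest_part p \<le> n"
  by (simp add: largest_part_le_iff part_le_partition)

lemma partitions_0: "partitions 0 = {{#}}"
  using size_le_partition[of _ 0] by (auto simp: partitions_def)

section \<open>Partitions in a box and their symmetry under conjugation\<close>

definition box :: "nat \<Rightarrow> nat \<Rightarrow> nat \<Rightarrow> nat multiset set" where
  "box k l n = {p \<in> partitions n. size p \<le> k \<and> largest_part p \<le> l}"

lemma finite_box: "finite (box k l n)"
  unfolding box_def using finite_partitions by simp

lemma card_box_0: "card (box 0 l n) = (if n = 0 then 1 else 0)"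
proof -
  have "box 0 l n = (if n = 0 then {{#}} else {})"
    by (auto simp: box_def partitions_def largest_part_def)
  then show ?thesis by simp
qed

lemma card_box_0': "card (box k 0 n) = (if n = 0 then 1 else 0)"
proof -
  have "p = {#}" if "0 \<notin># p" "largest_part p \<le> 0" for p
    using that by (metis largest_part_in le_zero_eq)
  then have "p = {#}" if "p \<in> box k 0 n" for p
    using that by (simp add: box_def partitions_def)
  moreover have "{#} \<in> box k 0 n \<longleftrightarrow> n = 0"
    by (auto simp: box_def partitions_def largest_part_def)
  ultimately have "box k 0 n = (if n = 0 then {{#}} else {})"
    by (auto split: if_splits)
  then show ?thesis by simp
qed

text \<open>One of the two Pascal rules of the Gaussian binomials: a partition either has all parts
  at most \<open>l\<close> or can lose one part \<open>Suc l\<close>.\<close>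

lemma card_box_largest:
  "card (box (Suc k) (Suc l) n) = card (box (Suc k) l n) +
     (if n \<ge> Suc l then card (box k (Suc l) (n - Suc l)) else 0)"
proof -
  let ?X = "{p \<in> box (Suc k) (Suc l) n. Suc l \<in># p}"
  have "box (Suc k) (Suc l) n = box (Suc k) l n \<union> ?X"
    by (auto simp: box_def dest: largest_part_le_SucD)
  moreover have "box (Suc k) l n \<inter> ?X = {}"
    by (auto simp: box_def largest_part_le_iff)
  moreover have "finite ?X"
    using finite_box by simp
  ultimately have "card (box (Suc k) (Suc l) n) = card (box (Suc k) l n) + card ?X"
    by (metis card_Un_disjoint finite_box)
  moreover have "card ?X = (if n \<ge> Suc l then card (box k (Suc l) (n - Suc l)) else 0)"
  proof (cases "n \<ge> Suc l")
    case True
    have "bij_betw (add_mset (Suc l)) (box k (Suc l) (n - Suc l)) ?X"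
      by (rule bij_betw_byWitness[where f' = "\<lambda>p. p - {#Suc l#}"])
        (use True in \<open>auto simp: box_def partitions_def largest_part_le_iff size_Diff_singleton
           sum_mset.remove dest: in_diffD\<close>)
    then show ?thesis using True by (simp add: bij_betw_same_card)
  next
    case False
    then have "?X = {}" by (auto simp: box_def dest: part_le_partition)
    then show ?thesis using False by (metis card.empty)
  qed
  ultimately show ?thesis by simp
qed

text \<open>The conjugate Pascal rule: if there are exactly \<open>Suc k\<close> parts, the first
  column of the diagram is deleted.\<close>

lemma card_box_size:
  "card (box (Suc k) (Suc l) n) = card (box k (Suc l) n) +
     (if n \<ge> Suc k then card (box (Suc k) l (n - Suc k)) else 0)"
proof -
  let ?X = "{p \<in> box (Suc k) (Suc l) n. size p = Suc k}"
  have "box (Suc k) (Suc l) n = box k (Suc l) n \<union> ?X"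
    by (auto simp: box_def)
  moreover have "box k (Suc l) n \<inter> ?X = {}"
    by (auto simp: box_def)
  moreover have "finite ?X"
    using finite_box by simp
  ultimately have "card (box (Suc k) (Suc l) n) = card (box k (Suc l) n) + card ?X"
    by (metis card_Un_disjoint finite_box)
  moreover have "card ?X = (if n \<ge> Suc k then card (box (Suc k) l (n - Suc k)) else 0)"
  proof (cases "n \<ge> Suc k")
    case True
    have "bij_betw (add_column (Suc k)) (box (Suc k) l (n - Suc k)) ?X"
    proof (rule bij_betw_byWitness[where f' = drop_column])
      show "\<forall>p\<in>box (Suc k) l (n - Suc k). drop_column (add_column (Suc k) p) = p"
        by (simp add: box_def partitions_def drop_column_add_column)
      show "\<forall>p\<in>?X. add_column (Suc k) (drop_column p) = p"
        by (metis (mono_tags, lifting) CollectD add_column_drop_column box_def partitions_def)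
      show "add_column (Suc k) ` box (Suc k) l (n - Suc k) \<subseteq> ?X"
        using True by (auto simp: box_def partitions_def zero_notin_add_column sum_add_column
            size_add_column simp flip: largest_drop_column_le_iff simp: drop_column_add_column)
      show "drop_column ` ?X \<subseteq> box (Suc k) l (n - Suc k)"
      proof safe
        fix p assume "p \<in> box (Suc k) (Suc l) n" "size p = Suc k"
        then show "drop_column p \<in> box (Suc k) l (n - Suc k)"
          using size_drop_column_le[of p] sum_drop_column[of p]
          by (simp add: box_def partitions_def zero_notin_drop_column largest_drop_column_le_iff)
      qed
    qed
    then show ?thesis using True by (simp add: bij_betw_same_card)
  next
    case False
    then have "?X = {}" by (auto simp: box_def dest: size_le_partition)
    then show ?thesis using False by (metis card.empty)
  qed
  ultimately show ?thesis by simp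
qed

text \<open>The two Pascal rules are exchanged by swapping \<open>k\<close> and \<open>l\<close>, so
  the symmetry follows by induction on \<open>k + l\<close>, without building a conjugation map on
  multisets.\<close>

lemma card_box_commute: "card (box k l n) = card (box l k n)"
proof (induction "k + l" arbitrary: k l n rule: less_induct)
  case less
  show ?case
  proof (cases "k = 0 \<or> l = 0")
    case True
    then show ?thesis by (auto simp: card_box_0 card_box_0')
  next
    case False
    then obtain k' l' where kl: "k = Suc k'" "l = Suc l'"
      by (metis not0_implies_Suc)
    show ?thesis
      unfolding kl card_box_largest[of k' l'] card_box_size[of l' k']
      using less[of k l'] less[of k' l] by (simp add: kl)
  qed
qed

definition exact_box :: "nat \<Rightarrow> nat \<Rightarrow> nat \<Rightarrow> nat multiset set" where
  "exact_box k l n = {p \<in> partitions n. size p = k \<and> largest_part p = l}"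

lemma finite_exact_box: "finite (exact_box k l n)"
  unfolding exact_box_def using finite_partitions by simp

text \<open>Inclusion-exclusion. The right side is symmetric in the two bounds, so
  \<open>card_box_commute\<close> carries over to exact values of both statistics.\<close>

lemma card_exact_box:
  "int (card (exact_box (Suc k) (Suc l) n)) = int (card (box (Suc k) (Suc l) n))
     - int (card (box k (Suc l) n)) - int (card (box (Suc k) l n)) + int (card (box k l n))"
proof -
  have 1: "box (Suc k) (Suc l) n = exact_box (Suc k) (Suc l) n \<union> (box k (Suc l) n \<union> box (Suc k) l n)"
    by (auto simp: box_def exact_box_def)
  have 2: "box k (Suc l) n \<inter> box (Suc k) l n = box k l n"
    by (auto simp: box_def)
  have 3: "exact_box (Suc k) (Suc l) n \<inter> (box k (Suc l) n \<union> box (Suc k) l n) = {}"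
    by (auto simp: box_def exact_box_def)
  have "card (box k (Suc l) n) + card (box (Suc k) l n) =
      card (box k (Suc l) n \<union> box (Suc k) l n) + card (box k l n)"
    using card_Un_Int[OF finite_box finite_box, of k "Suc l" n "Suc k" l n] by (simp add: 2)
  moreover have "card (box (Suc k) (Suc l) n) =
      card (exact_box (Suc k) (Suc l) n) + card (box k (Suc l) n \<union> box (Suc k) l n)"
    by (subst 1, rule card_Un_disjoint) (auto simp: finite_box finite_exact_box 3)
  ultimately show ?thesis by simp
qed

lemma card_exact_box_commute: "card (exact_box k l n) = card (exact_box l k n)"
proof -
  have empty: "exact_box 0 (Suc k) n = {}" for k
    by (auto simp: exact_box_def largest_part_def)
  have "p = {#}" if "p \<in> partitions n" "largest_part p = 0" for p
    using that largest_part_in[of p] by (auto simp: partitions_def)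
  then have empty': "exact_box (Suc k) 0 n = {}" for k
    by (fastforce simp: exact_box_def)
  show ?thesis
  proof (cases k; cases l)
    fix k' l' assume "k = Suc k'" "l = Suc l'"
    then have "int (card (exact_box k l n)) = int (card (exact_box l k n))"
      using card_exact_box[of k' l' n] card_exact_box[of l' k' n]
      by (simp add: card_box_commute[of "Suc k'"] card_box_commute[of "k'"])
    then show ?thesis by simp
  qed (auto simp: empty empty')
qed

lemma sum_partitions_exact_box:
  fixes f :: "nat \<Rightarrow> nat \<Rightarrow> int"
  shows "(\<Sum>p\<in>partitions n. f (size p) (largest_part p)) =
    (\<Sum>(k,l)\<in>{..n}\<times>{..n}. int (card (exact_box k l n)) * f k l)"
proof -
  have "(\<Sum>p\<in>partitions n. f (size p) (largest_part p)) =
      (\<Sum>kl\<in>{..n}\<times>{..n}. \<Sum>p\<in>{p\<in>partitions n. (size p, largest_part p) = kl}. f (size p) (largest_part p))"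
    by (rule sum.group[symmetric])
      (auto simp: finite_partitions size_le_partition largest_part_le_partition)
  also have "\<dots> = (\<Sum>(k,l)\<in>{..n}\<times>{..n}. int (card (exact_box k l n)) * f k l)"
    by (rule sum.cong) (auto simp: exact_box_def)
  finally show ?thesis .
qed

lemma sum_partitions_conjugate:
  fixes f :: "nat \<Rightarrow> nat \<Rightarrow> int"
  shows "(\<Sum>p\<in>partitions n. f (size p) (largest_part p)) =
         (\<Sum>p\<in>partitions n. f (largest_part p) (size p))"
proof -
  have "(\<Sum>(k,l)\<in>{..n}\<times>{..n}. int (card (exact_box k l n)) * f k l) =
        (\<Sum>(k,l)\<in>{..n}\<times>{..n}. int (card (exact_box k l n)) * f l k)"
    by (rule sum.reindex_bij_witness[where i = prod.swap and j = prod.swap])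
      (auto simp: card_exact_box_commute)
  then show ?thesis
    by (simp only: sum_partitions_exact_box[of f] sum_partitions_exact_box[of "\<lambda>k l. f l k"])
qed

section \<open>Rank counts and the first moment of the rank\<close>

definition chi :: "int \<Rightarrow> int" where
  "chi m = (if m mod 5 = 2 then 1 else if m mod 5 = 3 then -1 else 0)"

lemma chi_uminus: "chi (- m) = - chi m"
proof -
  have "m mod 5 \<in> {0, 1, 2, 3, 4}" by auto
  then show ?thesis by (auto simp: chi_def zmod_zminus1_eq_if)
qed

text \<open>The empty partition is left out: it has rank 0 but no row that Dyson's adjoint could
  have added. It reappears as the separate term for \<open>n = 0\<close> in
  \<open>npart_eq_ranks\<close>.\<close>

definition rank_ge :: "int \<Rightarrow> nat \<Rightarrow> nat multiset set" where
  "rank_ge m n = {p \<in> partitions n. p \<noteq> {#} \<and> rank p \<ge> m}"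

definition num_rank_ge :: "int \<Rightarrow> nat \<Rightarrow> int" where
  "num_rank_ge m n = int (card (rank_ge m n))"

lemma finite_rank_ge: "finite (rank_ge m n)"
  unfolding rank_ge_def using finite_partitions by simp

definition npart :: "int \<Rightarrow> int" where
  "npart n = (if n < 0 then 0 else int (card (partitions (nat n))))"

lemma rank_bound: "p \<in> partitions n \<Longrightarrow> \<bar>rank p\<bar> \<le> int n"
  using largest_part_le_partition size_le_partition unfolding rank_def by force

lemma num_rank_eq:
  "int (card {p \<in> partitions n. p \<noteq> {#} \<and> rank p = m}) = num_rank_ge m n - num_rank_ge (m + 1) n"
proof -
  have "rank_ge m n = {p \<in> partitions n. p \<noteq> {#} \<and> rank p = m} \<union> rank_ge (m + 1) n"
    by (auto simp: rank_ge_def)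
  moreover have "{p \<in> partitions n. p \<noteq> {#} \<and> rank p = m} \<inter> rank_ge (m + 1) n = {}"
    by (auto simp: rank_ge_def)
  moreover have "finite {p \<in> partitions n. p \<noteq> {#} \<and> rank p = m}"
    using finite_partitions by simp
  ultimately have "card (rank_ge m n) = card {p \<in> partitions n. p \<noteq> {#} \<and> rank p = m} + card (rank_ge (m + 1) n)"
    by (metis card_Un_disjoint finite_rank_ge)
  then show ?thesis
    unfolding num_rank_ge_def by simp
qed

text \<open>Conjugation turns the number of parts into the largest part and reverses the sign of the rank,
  so the two residue classes combine into minus a first moment of the rank.\<close>

lemma NT_diff_eq_moment:
  "NT 2 5 n - NT 3 5 n = - (\<Sum>m=1..int n. m * chi m * (num_rank_ge m n - num_rank_ge (m + 1) n))"
proof -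
  let ?P = "partitions n"
  have fin: "finite ?P" by (rule finite_partitions)
  have "NT 2 5 n - NT 3 5 n = (\<Sum>p\<in>?P. chi (rank p) * int (size p))"
  proof -
    have "NT c 5 n = (\<Sum>p\<in>?P. if rank p mod 5 = c then int (size p) else 0)" if "c \<in> {2,3}" for c
      unfolding NT_def using that fin by (subst sum.inter_filter[symmetric]) (auto simp: cong_def intro!: sum.cong)
    then show ?thesis
      by (simp add: sum_subtractf[symmetric] chi_def) (rule sum.cong, auto)
  qed
  moreover have "(\<Sum>p\<in>?P. chi (rank p) * int (size p)) = - (\<Sum>p\<in>?P. chi (rank p) * int (largest_part p))"
  proof -
    have "(\<Sum>p\<in>?P. chi (rank p) * int (size p)) = (\<Sum>p\<in>?P. chi (- rank p) * int (largest_part p))"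
      using sum_partitions_conjugate[of "\<lambda>k l. chi (int l - int k) * int k" n]
      by (simp add: rank_def)
    then show ?thesis by (simp only: chi_uminus mult_minus_left sum_negf)
  qed
  \<comment> \<open>Average of the two expressions: the weights \<open>size p\<close> and
    \<open>- largest_part p\<close> add up to \<open>- rank p\<close>.\<close>
  ultimately have "2 * (NT 2 5 n - NT 3 5 n) = - (\<Sum>p\<in>?P. chi (rank p) * rank p)"
    by (simp add: rank_def algebra_simps sum_subtractf)
  also have "(\<Sum>p\<in>?P. chi (rank p) * rank p) = 2 * (\<Sum>p\<in>?P. if rank p > 0 then chi (rank p) * rank p else 0)"
  proof -
    let ?f = "\<lambda>m::int. if m > 0 then chi m * m else 0"
    have "(\<Sum>p\<in>?P. chi (rank p) * rank p) = (\<Sum>p\<in>?P. ?f (rank p)) + (\<Sum>p\<in>?P. ?f (- rank p))"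
      by (subst sum.distrib[symmetric], rule sum.cong) (auto simp: chi_uminus)
    also have "(\<Sum>p\<in>?P. ?f (- rank p)) = (\<Sum>p\<in>?P. ?f (rank p))"
      using sum_partitions_conjugate[of "\<lambda>k l. ?f (int k - int l)" n]
      unfolding rank_def minus_diff_eq by simp
    finally show ?thesis by simp
  qed
  finally have "NT 2 5 n - NT 3 5 n = - (\<Sum>p\<in>?P. if rank p > 0 then chi (rank p) * rank p else 0)"
    by simp
  also have "(\<Sum>p\<in>?P. if rank p > 0 then chi (rank p) * rank p else 0)
      = (\<Sum>p\<in>{p\<in>?P. p \<noteq> {#} \<and> rank p > 0}. chi (rank p) * rank p)"
  proof -
    have "(\<Sum>p\<in>?P. if rank p > 0 then chi (rank p) * rank p else 0)
        = (\<Sum>p\<in>?P. if p \<noteq> {#} \<and> rank p > 0 then chi (rank p) * rank p else 0)"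
      by (rule sum.cong) (auto simp: rank_def largest_part_def)
    then show ?thesis
      by (simp only: sum.inter_filter[OF fin, of "\<lambda>p. chi (rank p) * rank p" "\<lambda>p. p \<noteq> {#} \<and> rank p > 0"])
  qed
  also have "\<dots> = (\<Sum>m=1..int n. \<Sum>p\<in>{p\<in>{p\<in>?P. p \<noteq> {#} \<and> rank p > 0}. rank p = m}. chi (rank p) * rank p)"
  proof (rule sum.group[symmetric])
    show "rank ` {p \<in> ?P. p \<noteq> {#} \<and> rank p > 0} \<subseteq> {1..int n}"
      using rank_bound[THEN abs_le_D1] by auto
  qed (use fin in auto)
  also have "\<dots> = (\<Sum>m=1..int n. m * chi m * (num_rank_ge m n - num_rank_ge (m + 1) n))"
  proof (rule sum.cong[OF refl])
    fix m assume "m \<in> {1..int n}"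
    then have "{p\<in>{p\<in>?P. p \<noteq> {#} \<and> rank p > 0}. rank p = m} = {p \<in> ?P. p \<noteq> {#} \<and> rank p = m}"
      by auto
    then show "(\<Sum>p\<in>{p\<in>{p\<in>?P. p \<noteq> {#} \<and> rank p > 0}. rank p = m}. chi (rank p) * rank p)
        = m * chi m * (num_rank_ge m n - num_rank_ge (m + 1) n)"
      by (simp add: num_rank_eq[symmetric])
  qed
  finally show ?thesis .
qed

text \<open>Conjugation matches negative with positive ranks, so the ranks at least 0 and the ranks
  at least 1 together count every nonempty partition once.\<close>

lemma npart_eq_ranks:
  "npart (int n) = (if n = 0 then 1 else 0) + num_rank_ge 0 n + num_rank_ge 1 n"
proof (cases "n = 0")
  case True
  have "rank_ge m 0 = {}" for m
    by (auto simp: rank_ge_def partitions_0)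
  then show ?thesis
    using True by (simp add: npart_def partitions_0 num_rank_ge_def)
next
  case False
  have fin: "finite (partitions n)" by (rule finite_partitions)
  have ne: "p \<noteq> {#}" if "p \<in> partitions n" for p
    using that False by (auto simp: partitions_def)
  have A: "num_rank_ge 0 n = (\<Sum>p\<in>partitions n. if rank p \<ge> 0 then 1 else 0)"
    unfolding num_rank_ge_def rank_ge_def using fin ne
    by (subst sum.inter_filter[symmetric]) (auto intro!: arg_cong[where f = card])
  have "num_rank_ge 1 n = (\<Sum>p\<in>partitions n. if rank p > 0 then 1 else 0)"
    unfolding num_rank_ge_def rank_ge_def using fin ne
    by (subst sum.inter_filter[symmetric]) (auto intro!: arg_cong[where f = card])
  also have "\<dots> = (\<Sum>p\<in>partitions n. if rank p < 0 then 1 else 0)"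
    using sum_partitions_conjugate[of "\<lambda>k l. if int l - int k > 0 then 1 else 0" n]
    unfolding rank_def by simp
  finally have B: "num_rank_ge 1 n = (\<Sum>p\<in>partitions n. if rank p < 0 then 1 else 0)" .
  have "num_rank_ge 0 n + num_rank_ge 1 n = (\<Sum>p\<in>partitions n. 1)"
    unfolding A B sum.distrib[symmetric] by (rule sum.cong) auto
  then show ?thesis using False by (simp add: npart_def)
qed

section \<open>Dyson's recursion for ranks\<close>

text \<open>The sign of \<open>k\<close> is chosen so that \<open>pentagonal (- k)\<close> runs
  through 1, 5, 12, ... for k = 1, 2, 3, ... and, as for \<open>triangular\<close>, t(-k) = t(k) - k
  holds.\<close>

definition pentagonal :: "int \<Rightarrow> int" where "pentagonal k = k * (3 * k + 1) div 2"

definition triangular :: "int \<Rightarrow> int" where "triangular k = k * (k + 1) div 2"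

lemma two_pentagonal: "2 * pentagonal k = k * (3 * k + 1)"
proof -
  have "even (k * (3 * k + 1))" by simp
  then show ?thesis by (simp add: pentagonal_def)
qed

lemma two_triangular: "2 * triangular k = k * (k + 1)"
proof -
  have "even (k * (k + 1))" by simp
  then show ?thesis by (simp add: triangular_def)
qed

lemma pentagonal_uminus: "pentagonal (- k) = pentagonal k - k"
  using two_pentagonal[of k] two_pentagonal[of "- k"] by (simp add: algebra_simps)

lemma triangular_uminus: "triangular (- k) = triangular k - k"
  using two_triangular[of k] two_triangular[of "- k"] by (simp add: algebra_simps)

lemma triangular_nonneg: "triangular k \<ge> 0"
proof -
  have "k * (k + 1) \<ge> 0" by (cases "k \<ge> 0") (auto intro: mult_nonpos_nonpos)
  then show ?thesis using two_triangular[of k] by simp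
qed

text \<open>Dyson's adjoint: delete the first column, of height \<open>k\<close>, and add a row of length \<open>k + m + 1\<close>.\<close>

lemma bij_betw_dyson_adjoint:
  assumes "n \<ge> m + 1"
  shows "bij_betw (\<lambda>p. add_mset (size p + m + 1) (drop_column p))
           {p \<in> partitions (n - m - 1). rank p < int m + 3} (rank_ge (int m) n)"
proof (rule bij_betw_byWitness)
  let ?F = "\<lambda>p. add_mset (size p + m + 1) (drop_column p)"
  let ?G = "\<lambda>r. add_column (largest_part r - m - 1) (r - {#largest_part r#})"
  let ?S = "{p \<in> partitions (n - m - 1). rank p < int m + 3}"
  have largest: "largest_part (?F p) = size p + m + 1" if "p \<in> ?S" for p
  proof -
    \<comment> \<open>Origin of the 3: \<open>rank p < int m + 3\<close> allows a largest part up to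
      \<open>size p + m + 2\<close>, one more than the new row, since deleting the column lowers the
      largest part by one.\<close>
    have "largest_part p \<le> Suc (size p + m + 1)"
      using that by (simp add: rank_def)
    then have "largest_part (drop_column p) \<le> size p + m + 1"
      by (simp add: largest_drop_column_le_iff)
    then show ?thesis
      by (intro largest_part_eqI) (auto simp: largest_part_le_iff)
  qed
  show "\<forall>p\<in>?S. ?G (?F p) = p"
  proof
    fix p assume p: "p \<in> ?S"
    then show "?G (?F p) = p"
      unfolding largest[OF p] by (simp add: partitions_def add_column_drop_column)
  qed
  show "?F ` ?S \<subseteq> rank_ge (int m) n"
  proof safe
    fix p assume p: "p \<in> partitions (n - m - 1)" "rank p < int m + 3"
    then have "\<Sum>\<^sub># p = n - m - 1" "0 \<notin># p" by (auto simp: partitions_def)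
    moreover have "rank (?F p) \<ge> int m"
      using largest[of p] p size_drop_column_le[of p] by (simp add: rank_def)
    ultimately show "?F p \<in> rank_ge (int m) n"
      using assms sum_drop_column[of p]
      by (simp add: rank_ge_def partitions_def zero_notin_drop_column)
  qed
  have inv: "?F (?G r) = r \<and> ?G r \<in> ?S" if r: "r \<in> rank_ge (int m) n" for r
  proof -
    define l where "l = largest_part r"
    define s where "s = r - {#l#}"
    have l: "l \<in># r" using r by (simp add: rank_ge_def l_def largest_part_in)
    then have r_eq: "r = add_mset l s" by (simp add: s_def)
    have sz: "int (size r) + int m \<le> int l" and r0: "0 \<notin># r" and sum: "\<Sum>\<^sub># r = n"
      using r by (auto simp: rank_ge_def rank_def l_def partitions_def)
    have s0: "0 \<notin># s" using r0 r_eq by auto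
    have szs: "size s \<le> l - m - 1" using sz r_eq by simp
    have lm: "l \<ge> m + 1" using sz r_eq by simp
    have drop: "drop_column (add_column (l - m - 1) s) = s"
      using s0 by (rule drop_column_add_column)
    have size: "size (add_column (l - m - 1) s) = l - m - 1"
      using szs by (rule size_add_column)
    have "i \<le> l" if "i \<in># s" for i
      using largest_part_ge[of i r] that unfolding s_def l_def by (blast dest: in_diffD)
    then have "largest_part s \<le> l"
      by (simp add: largest_part_le_iff)
    then have "largest_part (add_column (l - m - 1) s) \<le> Suc l"
      using drop largest_drop_column_le_iff[of "add_column (l - m - 1) s" l] by simp
    moreover have "\<Sum>\<^sub># (add_column (l - m - 1) s) = n - m - 1"
      using sum_add_column[OF s0 szs] sum lm r_eq by simp
    ultimately have "add_column (l - m - 1) s \<in> ?S"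
      using size lm zero_notin_add_column by (simp add: partitions_def rank_def)
    moreover have "?F (add_column (l - m - 1) s) = r"
      using drop size lm r_eq by simp
    ultimately show ?thesis
      unfolding l_def[symmetric] s_def[symmetric] by simp
  qed
  show "\<forall>r\<in>rank_ge (int m) n. ?F (?G r) = r" "?G ` rank_ge (int m) n \<subseteq> ?S"
    using inv by auto
qed

text \<open>The partitions of \<open>n - m - 1\<close> outside the domain of the adjoint are those
  of rank at least \<open>m + 3\<close>. The empty partition has rank 0 and lies in the domain,
  consistently with its exclusion from \<open>rank_ge\<close>.\<close>

lemma num_rank_ge_rec:
  assumes "n \<ge> m + 1"
  shows "num_rank_ge (int m) n = npart (int (n - m - 1)) - num_rank_ge (int m + 3) (n - m - 1)"
proof -
  let ?N = "n - m - 1"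
  have split: "partitions ?N = {p \<in> partitions ?N. rank p < int m + 3} \<union> rank_ge (int m + 3) ?N"
    by (auto simp: rank_ge_def rank_def largest_part_def)
  moreover have "{p \<in> partitions ?N. rank p < int m + 3} \<inter> rank_ge (int m + 3) ?N = {}"
    by (auto simp: rank_ge_def)
  moreover have "finite {p \<in> partitions ?N. rank p < int m + 3}"
    using finite_partitions by simp
  ultimately have "card (partitions ?N) =
      card {p \<in> partitions ?N. rank p < int m + 3} + card (rank_ge (int m + 3) ?N)"
    by (metis card_Un_disjoint finite_rank_ge)
  then show ?thesis
    using bij_betw_same_card[OF bij_betw_dyson_adjoint[OF assms]]
    by (simp add: num_rank_ge_def npart_def)
qed

lemma num_rank_ge_eq_0: "n \<le> m \<Longrightarrow> num_rank_ge (int m) n = 0"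
proof -
  assume "n \<le> m"
  have "rank p < int m" if "p \<in> partitions n" "p \<noteq> {#}" for p
  proof -
    have "size p \<ge> 1"
      using that(2) by (simp add: Suc_leI nonempty_has_size)
    then show ?thesis
      using largest_part_le_partition[OF that(1)] \<open>n \<le> m\<close> unfolding rank_def by linarith
  qed
  then have "rank_ge (int m) n = {}"
    by (fastforce simp: rank_ge_def)
  then show ?thesis by (simp add: num_rank_ge_def)
qed

lemma npart_neg [simp]: "n < 0 \<Longrightarrow> npart n = 0"
  by (simp add: npart_def)

lemma pentagonal_minus_Suc: "pentagonal (- 1 - k) = pentagonal (- k) + 3 * k + 1"
  using two_pentagonal[of "- 1 - k"] two_pentagonal[of "- k"] by (simp add: algebra_simps)

lemma pentagonal_minus_ge: "k \<ge> 1 \<Longrightarrow> pentagonal (- k) \<ge> 1"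
proof -
  assume "k \<ge> 1"
  then have "k * (3 * k - 1) \<ge> 1 * 2" by (intro mult_mono) auto
  moreover have "2 * pentagonal (- k) = k * (3 * k - 1)"
    using two_pentagonal[of "- k"] by (simp add: algebra_simps)
  ultimately show ?thesis by linarith
qed

text \<open>Unrolling \<open>num_rank_ge_rec\<close> raises \<open>m\<close> by 3 in each step; the
  removed amounts m + 1, m + 4, ... add up to j m + j (3j - 1)/2 after j steps. Terms with
  \<open>j > n\<close> vanish, so any \<open>J \<ge> n\<close> may serve as cut-off.\<close>

lemma num_rank_ge_closed:
  "n \<le> J \<Longrightarrow> num_rank_ge (int m) n =
     (\<Sum>j=1..J. (-1) ^ (j - 1) * npart (int n - pentagonal (- int j) - int m * int j))"
proof (induction n arbitrary: m J rule: less_induct)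
  case (less n)
  show ?case
  proof (cases "n \<le> m")
    case True
    have "npart (int n - pentagonal (- int j) - int m * int j) = 0" if "j \<in> {1..J}" for j
    proof -
      have "int m * 1 \<le> int m * int j" using that by (intro mult_left_mono) auto
      then show ?thesis using pentagonal_minus_ge[of "int j"] that True by simp
    qed
    then show ?thesis using True by (simp add: num_rank_ge_eq_0)
  next
    case False
    then obtain K where K: "J = Suc K" using less.prems by (cases J) auto
    let ?f = "\<lambda>j. (-1) ^ (j - 1) * npart (int n - pentagonal (- int j) - int m * int j)"
    have "(\<Sum>j=1..J. ?f j) = ?f 1 + (\<Sum>j=1..K. ?f (Suc j))"
      unfolding K using sum.atLeast_Suc_atMost[of 1 "Suc K" ?f] sum.shift_bounds_cl_Suc_ivl[of ?f 1 K]
      by (simp del: sum.cl_ivl_Suc)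
    also have "?f 1 = npart (int (n - m - 1))"
      using False by (simp add: pentagonal_def of_nat_diff algebra_simps)
    also have "(\<Sum>j=1..K. ?f (Suc j)) = - num_rank_ge (int (m + 3)) (n - m - 1)"
    proof -
      have "num_rank_ge (int (m + 3)) (n - m - 1) =
          (\<Sum>j=1..K. (-1) ^ (j - 1) * npart (int (n - m - 1) - pentagonal (- int j) - int (m + 3) * int j))"
        using False less.prems K by (intro less.IH) auto
      also have "\<dots> = - (\<Sum>j=1..K. ?f (Suc j))"
        unfolding sum_negf[symmetric]
      proof (rule sum.cong[OF refl])
        fix j assume j: "j \<in> {1..K}"
        have "int (n - m - 1) - pentagonal (- int j) - int (m + 3) * int j =
            int n - pentagonal (- int (Suc j)) - int m * int (Suc j)"
          using pentagonal_minus_Suc[of "int j"] False by (simp add: of_nat_diff algebra_simps)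
        moreover have "(-1 :: int) ^ (j - 1) = - ((-1) ^ (Suc j - 1))"
          using j by (cases j) auto
        ultimately show "(-1) ^ (j - 1) * npart (int (n - m - 1) - pentagonal (- int j) - int (m + 3) * int j) = - ?f (Suc j)"
          by simp
      qed
      finally show ?thesis by simp
    qed
    finally show ?thesis using num_rank_ge_rec[of m n] False by simp
  qed
qed

text \<open>Discarding the subtracted rank counts in Dyson's recursion for ranks at least 0 and at
  least 1 leaves the Fibonacci-type bound p(n) \<le> p(n-1) + p(n-2).\<close>

lemma npart_le_power: "npart (int n) \<le> 2 ^ n"
proof (induction n rule: less_induct)
  case (less n)
  have nonneg: "num_rank_ge m k \<ge> 0" for m k by (simp add: num_rank_ge_def)
  consider "n = 0" | "n = 1" | k where "n = Suc (Suc k)"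
    by (metis One_nat_def nat.exhaust)
  then show ?case
  proof cases
    case 1
    then show ?thesis by (simp add: npart_def partitions_0)
  next
    case 2
    then show ?thesis
      using npart_eq_ranks[of 1] num_rank_ge_rec[of 0 1] num_rank_ge_eq_0[of 1 1] nonneg[of 3 0]
      by (simp add: npart_def partitions_0)
  next
    case 3
    have "npart (int n) \<le> npart (int (Suc k)) + npart (int k)"
      using npart_eq_ranks[of n] num_rank_ge_rec[of 0 n] num_rank_ge_rec[of 1 n] 3
        nonneg[of 3 "Suc k"] nonneg[of 4 k] by simp
    also have "\<dots> \<le> 2 ^ Suc k + 2 ^ k"
      using 3 by (intro add_mono less) auto
    also have "\<dots> \<le> 2 ^ n" using 3 by simp
    finally show ?thesis .
  qed
qed

lemma npart_nonneg: "npart n \<ge> 0"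
  by (simp add: npart_def)

text \<open>Euler's pentagonal number theorem, read off from Dyson's recursion at ranks \<open>\<ge> 0\<close> and \<open>\<ge> 1\<close>.\<close>

lemma pentagonal_recursion:
  assumes "n \<le> J"
  shows "npart (int n) + (\<Sum>j=1..J. (-1) ^ j * (npart (int n - pentagonal (- int j)) + npart (int n - pentagonal (int j))))
    = (if n = 0 then 1 else 0)"
proof -
  have "pentagonal (- int j) + int j = pentagonal (int j)" for j
    using two_pentagonal[of "- int j"] two_pentagonal[of "int j"] by (simp add: algebra_simps)
  then have eq: "int n - pentagonal (- int j) - int j = int n - pentagonal (int j)" for j
    by (metis diff_diff_eq)
  have "num_rank_ge 0 n + num_rank_ge 1 n =
    - (\<Sum>j=1..J. (-1) ^ j * (npart (int n - pentagonal (- int j)) + npart (int n - pentagonal (int j))))"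
    using num_rank_ge_closed[OF assms, of 0] num_rank_ge_closed[OF assms, of 1]
    by (simp add: eq sum.distrib[symmetric] sum_negf[symmetric])
      (rule sum.cong[OF refl], auto simp: power_eq_if algebra_simps)
  then show ?thesis using npart_eq_ranks[of n] by simp
qed

section \<open>Generating function of the crank\<close>

unbundle fps_syntax

definition part_fps :: "nat multiset set \<Rightarrow> real fps" where
  "part_fps \<A> = Abs_fps (\<lambda>n. real (card {p \<in> \<A>. p \<in> partitions n}))"

text \<open>The q-Pochhammer symbol (q; q)_w with q = \<open>fps_X\<close>.\<close>

definition qpoch :: "nat \<Rightarrow> real fps" where
  "qpoch w = (\<Prod>i=1..w. 1 - fps_X ^ i)"

lemma finite_part: "finite {p \<in> \<A>. p \<in> partitions n}"
  using finite_partitions by simp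

lemma qpoch_nth_0 [simp]: "qpoch w $ 0 = 1"
  unfolding qpoch_def by (induction w) (auto simp: fps_X_power_nth)

lemma qpoch_nonzero [simp]: "qpoch w \<noteq> 0"
  by (metis fps_zero_nth qpoch_nth_0 zero_neq_one)

lemma qpoch_0 [simp]: "qpoch 0 = 1" by (simp add: qpoch_def)

lemma qpoch_Suc: "qpoch (Suc w) = qpoch w * (1 - fps_X ^ Suc w)"
  by (simp add: qpoch_def)

lemma inverse_qpoch: "inverse (qpoch w) * qpoch w = 1"
  by (simp add: inverse_mult_eq_1)

lemma inverse_qpoch_Suc: "inverse (qpoch (Suc w)) * (1 - fps_X ^ Suc w) = inverse (qpoch w)"
proof -
  have "inverse (qpoch (Suc w)) * (1 - fps_X ^ Suc w) * qpoch w = inverse (qpoch w) * qpoch w"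
    unfolding inverse_qpoch using inverse_qpoch[of "Suc w"] by (simp add: qpoch_Suc mult_ac)
  then show ?thesis by simp
qed

lemma card_remove_part:
  assumes "i > 0" and A: "\<And>p. p \<in> \<A> \<and> i \<in># p \<longleftrightarrow> i \<in># p \<and> p - {#i#} \<in> \<B>"
  shows "card {p \<in> \<A>. i \<in># p \<and> p \<in> partitions n} =
    (if n < i then 0 else card {p \<in> \<B>. p \<in> partitions (n - i)})"
proof (cases "n < i")
  case True
  then have "{p \<in> \<A>. i \<in># p \<and> p \<in> partitions n} = {}"
    using part_le_partition by fastforce
  then show ?thesis using True by (metis card.empty)
next
  case False
  have A': "add_mset i r \<in> \<A> \<longleftrightarrow> r \<in> \<B>" for r
    using A[of "add_mset i r"] by simp
  have "bij_betw (add_mset i) {p \<in> \<B>. p \<in> partitions (n - i)} {p \<in> \<A>. i \<in># p \<and> p \<in> partitions n}"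
  proof (rule bij_betw_byWitness[where f' = "\<lambda>p. p - {#i#}"])
    show "(\<lambda>p. p - {#i#}) ` {p \<in> \<A>. i \<in># p \<and> p \<in> partitions n} \<subseteq> {p \<in> \<B>. p \<in> partitions (n - i)}"
      using A by (auto simp: partitions_def sum_mset.remove dest: in_diffD)
    show "add_mset i ` {p \<in> \<B>. p \<in> partitions (n - i)} \<subseteq> {p \<in> \<A>. i \<in># p \<and> p \<in> partitions n}"
      using False \<open>i > 0\<close> by (auto simp: partitions_def A')
  qed auto
  then show ?thesis using False by (simp add: bij_betw_same_card)
qed

lemma part_fps_remove_part:
  assumes "i > 0" and "\<And>p. p \<in> \<A> \<and> i \<in># p \<longleftrightarrow> i \<in># p \<and> p - {#i#} \<in> \<B>"
  shows "part_fps \<A> = part_fps {p \<in> \<A>. i \<notin># p} + fps_X ^ i * part_fps \<B>"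
proof (rule fps_ext)
  fix n
  let ?X = "{p \<in> {p \<in> \<A>. i \<notin># p}. p \<in> partitions n}" and ?Y = "{p \<in> \<A>. i \<in># p \<and> p \<in> partitions n}"
  have "{p \<in> \<A>. p \<in> partitions n} = ?X \<union> ?Y"
    by auto
  moreover have "card (?X \<union> ?Y) = card ?X + card ?Y"
    by (rule card_Un_disjoint) (auto simp: finite_partitions)
  ultimately have "card {p \<in> \<A>. p \<in> partitions n} = card ?X + card ?Y"
    by simp
  then show "part_fps \<A> $ n = (part_fps {p \<in> \<A>. i \<notin># p} + fps_X ^ i * part_fps \<B>) $ n"
    using card_remove_part[OF assms, of n] by (simp add: part_fps_def fps_X_power_mult_nth)
qed

lemma part_fps_singleton_empty: "part_fps {{#}} = 1"
proof (rule fps_ext)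
  fix n
  have "{p \<in> {{#}}. p \<in> partitions n} = (if n = 0 then {{#}} else {})"
    by (auto simp: partitions_def)
  then show "part_fps {{#}} $ n = (1 :: real fps) $ n"
    by (simp add: part_fps_def)
qed

text \<open>The part \<open>i\<close> may occur any number of times, so removing one copy stays in
  the same class; solving for the series gives the geometric factor 1/(1 - X^i).\<close>

lemma part_fps_subset:
  assumes "finite S" "0 \<notin> S"
  shows "part_fps {p. set_mset p \<subseteq> S} * (\<Prod>i\<in>S. 1 - fps_X ^ i) = 1"
  using assms
proof (induction S rule: finite_induct)
  case empty
  have "{p. set_mset p \<subseteq> {}} = {{#}}" by auto
  then show ?case by (simp add: part_fps_singleton_empty)
next
  case (insert i S)
  let ?A = "{p. set_mset p \<subseteq> insert i S}"
  have "part_fps ?A = part_fps {p \<in> ?A. i \<notin># p} + fps_X ^ i * part_fps ?A"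
  proof (rule part_fps_remove_part)
    show "p \<in> ?A \<and> i \<in># p \<longleftrightarrow> i \<in># p \<and> p - {#i#} \<in> ?A" for p
      by (cases "i \<in># p") (auto dest!: multi_member_split[of i p])
  qed (use insert in auto)
  moreover have "{p \<in> ?A. i \<notin># p} = {p. set_mset p \<subseteq> S}"
    using insert.hyps by auto
  ultimately have "part_fps ?A * (1 - fps_X ^ i) = part_fps {p. set_mset p \<subseteq> S}"
    by (simp add: algebra_simps)
  then show ?case using insert by (simp flip: mult.assoc)
qed

lemma part_fps_UNIV_nth: "n \<le> w \<Longrightarrow> part_fps UNIV $ n = inverse (qpoch w) $ n"
proof -
  assume "n \<le> w"
  have "part_fps {p. set_mset p \<subseteq> {1..w}} * qpoch w = 1"
    unfolding qpoch_def by (rule part_fps_subset) auto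
  then have "inverse (qpoch w) = part_fps {p. set_mset p \<subseteq> {1..w}}"
    by (metis fps_inverse_unique mult.commute)
  moreover have "{p \<in> UNIV. p \<in> partitions n} = {p \<in> {p. set_mset p \<subseteq> {1..w}}. p \<in> partitions n}"
    using \<open>n \<le> w\<close> part_le_partition by (fastforce simp: partitions_def Suc_le_eq intro: gr0I)
  ultimately show ?thesis by (simp add: part_fps_def)
qed

lemma part_fps_ge_2:
  assumes "w \<ge> 1"
  shows "part_fps {p. set_mset p \<subseteq> {2..w}} = (1 - fps_X) * inverse (qpoch w)"
proof -
  have "part_fps {p. set_mset p \<subseteq> {2..w}} * (\<Prod>i=2..w. 1 - fps_X ^ i) = 1"
    by (rule part_fps_subset) auto
  moreover have "qpoch w = (1 - fps_X) * (\<Prod>i=2..w. 1 - fps_X ^ i)"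
    unfolding qpoch_def using assms by (simp add: prod.atLeast_Suc_atMost numeral_2_eq_2)
  ultimately have "part_fps {p. set_mset p \<subseteq> {2..w}} * qpoch w = 1 - fps_X"
    by (simp add: mult_ac)
  then have "part_fps {p. set_mset p \<subseteq> {2..w}} * (inverse (qpoch w) * qpoch w) = (1 - fps_X) * inverse (qpoch w)"
    by (simp add: mult_ac)
  then show ?thesis by (simp add: inverse_qpoch)
qed

lemma part_fps_shift:
  assumes "\<And>p. p \<in> \<A> \<Longrightarrow> size p = j"
  shows "part_fps {image_mset (\<lambda>i. i + w) p |p. p \<in> \<A> \<and> 0 \<notin># p} = fps_X ^ (w * j) * part_fps \<A>"
proof (rule fps_ext)
  fix n
  let ?f = "image_mset (\<lambda>i::nat. i + w)"
  have sum: "\<Sum>\<^sub># (?f p) = \<Sum>\<^sub># p + w * size p" for p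
    by (induction p) auto
  have inv: "image_mset (\<lambda>i. i - w) (?f p) = p" for p
    by (simp add: image_mset.compositionality comp_def)
  have card: "card {q \<in> {?f p |p. p \<in> \<A> \<and> 0 \<notin># p}. q \<in> partitions n} = (if n < w * j then 0 else card {p \<in> \<A>. p \<in> partitions (n - w * j)})"
  proof (cases "n < w * j")
    case True
    then have "{q \<in> {?f p |p. p \<in> \<A> \<and> 0 \<notin># p}. q \<in> partitions n} = {}"
      using assms by (auto simp: partitions_def sum)
    then show ?thesis using True by (metis card.empty)
  next
    case False
    have "bij_betw ?f {p \<in> \<A>. p \<in> partitions (n - w * j)} {q \<in> {?f p |p. p \<in> \<A> \<and> 0 \<notin># p}. q \<in> partitions n}"
      by (rule bij_betw_byWitness[where f' = "image_mset (\<lambda>i. i - w)"])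
        (use False assms in \<open>auto simp: inv sum partitions_def\<close>)
    then show ?thesis using False by (simp add: bij_betw_same_card)
  qed
  show "part_fps {?f p |p. p \<in> \<A> \<and> 0 \<notin># p} $ n = (fps_X ^ (w * j) * part_fps \<A>) $ n"
    unfolding fps_X_power_mult_nth part_fps_def fps_nth_Abs_fps card by simp
qed

text \<open>A partition with a part 1 loses it; otherwise all \<open>Suc j\<close> parts are lowered
  by 1. Solving for the series yields the factor \<open>1 - fps_X ^ Suc j\<close>.\<close>

lemma part_fps_size: "part_fps {p. size p = j \<and> 0 \<notin># p} * qpoch j = fps_X ^ j"
proof (induction j)
  case 0
  have "{p. size p = 0 \<and> 0 \<notin># (p::nat multiset)} = {{#}}" by auto
  then show ?case by (simp add: part_fps_singleton_empty)
next
  case (Suc j)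
  let ?A = "\<lambda>j. {p::nat multiset. size p = j \<and> 0 \<notin># p}"
  have "part_fps (?A (Suc j)) = part_fps {p \<in> ?A (Suc j). 1 \<notin># p} + fps_X ^ 1 * part_fps (?A j)"
    by (rule part_fps_remove_part) (auto simp: size_Diff_singleton dest: in_diffD dest!: multi_member_split)
  also have "{p \<in> ?A (Suc j). 1 \<notin># p} = {image_mset (\<lambda>i. i + 1) p |p. p \<in> ?A (Suc j) \<and> 0 \<notin># p}" (is "?L = ?R")
  proof
    show "?L \<subseteq> ?R"
    proof
      fix p assume p: "p \<in> ?L"
      have "image_mset (\<lambda>i. i + 1) (image_mset (\<lambda>i. i - 1) p) = image_mset (\<lambda>i. i) p"
        unfolding image_mset.compositionality comp_def
        by (rule image_mset_cong) (use p in \<open>auto intro!: Suc_pred gr0I\<close>)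
      moreover have "0 \<notin># image_mset (\<lambda>i. i - 1) p"
        using p by (auto simp: le_Suc_eq)
      ultimately show "p \<in> ?R"
        using p by (auto intro!: exI[of _ "image_mset (\<lambda>i. i - 1) p"])
    qed
  qed auto
  also have "part_fps ?R = fps_X ^ (1 * Suc j) * part_fps (?A (Suc j))"
    by (rule part_fps_shift) auto
  finally have "part_fps (?A (Suc j)) * (1 - fps_X ^ Suc j) = fps_X * part_fps (?A j)"
    by (simp add: algebra_simps)
  then have "part_fps (?A (Suc j)) * (1 - fps_X ^ Suc j) * qpoch j = fps_X * (part_fps (?A j) * qpoch j)"
    by (simp add: mult_ac)
  then show ?case unfolding Suc by (simp add: qpoch_Suc mult_ac)
qed

lemma part_fps_size_gt:
  "part_fps {p. size p = j \<and> (\<forall>i\<in>#p. i > w)} = fps_X ^ ((w + 1) * j) * inverse (qpoch j)"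
proof -
  let ?A = "{p::nat multiset. size p = j \<and> 0 \<notin># p}"
  have "{p. size p = j \<and> (\<forall>i\<in>#p. i > w)} = {image_mset (\<lambda>i. i + w) p |p. p \<in> ?A \<and> 0 \<notin># p}" (is "?L = ?R")
  proof
    show "?L \<subseteq> ?R"
    proof
      fix p assume p: "p \<in> ?L"
      have "image_mset (\<lambda>i. i + w) (image_mset (\<lambda>i. i - w) p) = image_mset (\<lambda>i. i) p"
        unfolding image_mset.compositionality comp_def
        by (rule image_mset_cong) (use p in \<open>auto dest: less_imp_le\<close>)
      moreover have "0 \<notin># image_mset (\<lambda>i. i - w) p"
        using p by fastforce
      ultimately show "p \<in> ?R"
        using p by (auto intro!: exI[of _ "image_mset (\<lambda>i. i - w) p"])
    qed
    show "?R \<subseteq> ?L"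
    proof
      fix q assume "q \<in> ?R"
      then obtain p where q: "q = image_mset (\<lambda>i. i + w) p" "size p = j" "0 \<notin># p" by auto
      then have "0 < i" if "i \<in># p" for i
        using that by (metis gr0I)
      then show "q \<in> ?L" using q by auto
    qed
  qed
  also have "part_fps ?R = fps_X ^ (w * j) * part_fps ?A"
    by (rule part_fps_shift) auto
  also have "part_fps ?A = fps_X ^ j * inverse (qpoch j)"
  proof -
    have "part_fps ?A * (inverse (qpoch j) * qpoch j) = fps_X ^ j * inverse (qpoch j)"
      by (simp add: part_fps_size[symmetric] mult_ac)
    then show ?thesis by (simp add: inverse_qpoch)
  qed
  finally show ?thesis by (simp add: power_add algebra_simps)
qed

lemma part_fps_mult:
  assumes "\<And>a b. a \<in> \<A> \<Longrightarrow> b \<in> \<B> \<Longrightarrow> g (a + b) = a \<and> h (a + b) = b"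
    and "\<C> = {a + b |a b. a \<in> \<A> \<and> b \<in> \<B>}"
  shows "part_fps \<C> = part_fps \<A> * part_fps \<B>"
proof (rule fps_ext)
  fix n
  let ?a = "\<lambda>i. {p \<in> \<A>. p \<in> partitions i}" and ?b = "\<lambda>i. {p \<in> \<B>. p \<in> partitions i}"
  have "card {p \<in> \<C>. p \<in> partitions n} = card (\<Union>i\<in>{0..n}. ?a i \<times> ?b (n - i))"
  proof (rule bij_betw_same_card[symmetric], rule bij_betw_byWitness[where f' = "\<lambda>p. (g p, h p)"])
    show "\<forall>x\<in>\<Union>i\<in>{0..n}. ?a i \<times> ?b (n - i). (\<lambda>p. (g p, h p)) (case x of (a, b) \<Rightarrow> a + b) = x"
      using assms(1) by auto
    show "\<forall>p\<in>{p \<in> \<C>. p \<in> partitions n}. (case (g p, h p) of (a, b) \<Rightarrow> a + b) = p"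
      using assms by auto
    show "(\<lambda>(a, b). a + b) ` (\<Union>i\<in>{0..n}. ?a i \<times> ?b (n - i)) \<subseteq> {p \<in> \<C>. p \<in> partitions n}"
      using assms(2) by (auto simp: partitions_def)
    show "(\<lambda>p. (g p, h p)) ` {p \<in> \<C>. p \<in> partitions n} \<subseteq> (\<Union>i\<in>{0..n}. ?a i \<times> ?b (n - i))"
      using assms by (auto simp: partitions_def)
  qed
  also have "\<dots> = (\<Sum>i=0..n. card (?a i) * card (?b (n - i)))"
  proof (subst card_UN_disjoint)
    show "\<forall>i\<in>{0..n}. \<forall>j\<in>{0..n}. i \<noteq> j \<longrightarrow> (?a i \<times> ?b (n - i)) \<inter> (?a j \<times> ?b (n - j)) = {}"
      by (auto simp: partitions_def)
  qed (auto simp: finite_part card_cartesian_product)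
  finally show "part_fps \<C> $ n = (part_fps \<A> * part_fps \<B>) $ n"
    by (simp add: part_fps_def fps_mult_nth)
qed

text \<open>The closed form is symmetric in \<open>w\<close> and \<open>j\<close>, although ones and
  large parts play different roles. It counts partitions for \<open>w \<ge> 1\<close>; at
  \<open>w = 0\<close> it is just the formula, reached later through the symmetry.\<close>

definition crank_fps :: "nat \<Rightarrow> nat \<Rightarrow> real fps" where
  "crank_fps w j = (1 - fps_X) * fps_X ^ (w + j + w * j) * inverse (qpoch w) * inverse (qpoch j)"

lemma crank_fps_commute: "crank_fps w j = crank_fps j w"
  by (simp add: crank_fps_def mult_ac add_ac)

text \<open>A partition splits into its \<open>w\<close> ones, the parts between 2 and
  \<open>w\<close>, and the \<open>j\<close> parts above \<open>w\<close>. The three factors are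
  X^w, (1 - X)/(q; q)_w and X^((w+1) j)/(q; q)_j.\<close>

lemma part_fps_ones_mu:
  assumes "w \<ge> 1"
  shows "part_fps {p. 0 \<notin># p \<and> ones p = w \<and> mu p = j} = crank_fps w j"
proof -
  let ?A = "{p::nat multiset. set_mset p \<subseteq> {2..w}}"
  let ?B = "{p::nat multiset. size p = j \<and> (\<forall>i\<in>#p. i > w)}"
  let ?AB = "{a + b |a b. a \<in> ?A \<and> b \<in> ?B}"
  have AB: "part_fps ?AB = part_fps ?A * part_fps ?B"
  proof (rule part_fps_mult[where g = "filter_mset (\<lambda>i. i \<le> w)" and h = "filter_mset (\<lambda>i. i > w)"])
    fix a b assume "a \<in> ?A" "b \<in> ?B"
    then have "filter_mset (\<lambda>i. i \<le> w) a = a" "filter_mset (\<lambda>i. i \<le> w) b = {#}"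
      "filter_mset (\<lambda>i. i > w) a = {#}" "filter_mset (\<lambda>i. i > w) b = b"
      by (auto simp: filter_mset_eq_conv not_less not_le)
    then show "filter_mset (\<lambda>i. i \<le> w) (a + b) = a \<and> filter_mset (\<lambda>i. i > w) (a + b) = b"
      by simp
  qed simp
  let ?C = "{p. 0 \<notin># p \<and> ones p = w \<and> mu p = j}"
  let ?R = "replicate_mset w (1::nat)"
  have "part_fps ?C = part_fps {?R} * part_fps ?AB"
  proof (rule part_fps_mult[where g = "\<lambda>p. ?R" and h = "\<lambda>p. p - ?R"])
    show "?C = {a + b |a b. a \<in> {?R} \<and> b \<in> ?AB}" (is "_ = ?D")
    proof (rule set_eqI, rule iffI)
      fix p assume "p \<in> ?D"
      then obtain a b where a: "set_mset a \<subseteq> {2..w}" and b: "\<forall>i\<in>#b. w < i" "size b = j"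
        and p: "p = ?R + (a + b)" by auto
      have nb: "1 \<notin># b" "1 \<notin># a" using a b assms by fastforce+
      then have o: "ones p = w"
        by (simp add: ones_def not_in_iff p)
      moreover have "0 \<notin># p"
        using a b by (auto simp: p split: if_splits)
      moreover have "filter_mset (\<lambda>i. i > w) a = {#}" "filter_mset (\<lambda>i. i > w) b = b" "filter_mset (\<lambda>i. i > w) ?R = {#}"
        using a b assms by (auto simp: filter_mset_eq_conv not_less)
      then have "mu p = j"
        unfolding mu_def o using b by (simp add: p)
      ultimately show "p \<in> ?C" by simp
    next
      fix p assume "p \<in> ?C"
      then have p0: "0 \<notin># p" and w: "ones p = w" and j: "mu p = j" by auto
      define a where "a = filter_mset (\<lambda>i. 2 \<le> i \<and> i \<le> w) p"
      define b where "b = filter_mset (\<lambda>i. i > w) p"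
      have eq: "p = ?R + (a + b)"
      proof (rule multiset_eqI)
        fix x :: nat
        consider "x = 0" | "x = 1" | "x \<ge> 2" by linarith
        then show "count p x = count (?R + (a + b)) x"
          by cases (use p0 assms w in \<open>auto simp: a_def b_def ones_def not_in_iff not_less\<close>)
      qed
      have "a \<in> ?A" "b \<in> ?B"
        using j w by (auto simp: a_def b_def mu_def)
      then have ab: "a + b \<in> ?AB"
        by (intro CollectI exI[of _ a] exI[of _ b]) simp
      show "p \<in> ?D"
        by (rule CollectI, rule exI[of _ ?R], rule exI[of _ "a + b"], intro conjI, rule eq, simp, rule ab)
    qed
  qed auto
  also have "part_fps {?R} = fps_X ^ w"
  proof (rule fps_ext)
    fix n
    have "{p \<in> {?R}. p \<in> partitions n} = (if n = w then {?R} else {})"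
      by (auto simp: partitions_def sum_mset_replicate_mset split: if_splits)
    then show "part_fps {?R} $ n = (fps_X ^ w :: real fps) $ n"
      by (simp add: part_fps_def fps_X_power_nth)
  qed
  finally show ?thesis
    unfolding AB part_fps_ge_2[OF assms] part_fps_size_gt crank_fps_def
    by (simp add: power_add algebra_simps)
qed

section \<open>Recursion for cranks\<close>

definition admissible :: "(nat \<Rightarrow> real fps) \<Rightarrow> bool" where
  "admissible f \<longleftrightarrow> (\<forall>w n. n < w \<longrightarrow> f w $ n = 0)"

text \<open>An infinite sum of series without topology: if \<open>f w\<close> is divisible by X^w,
  cutting off at \<open>w \<le> n\<close> loses nothing in the coefficient of X^n.\<close>

definition lsum :: "(nat \<Rightarrow> real fps) \<Rightarrow> real fps" where
  "lsum f = Abs_fps (\<lambda>n. \<Sum>w\<le>n. f w $ n)"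

lemma lsum_nth: "admissible f \<Longrightarrow> n \<le> N \<Longrightarrow> lsum f $ n = (\<Sum>w\<le>N. f w $ n)"
  unfolding lsum_def fps_nth_Abs_fps
  by (rule sum.mono_neutral_left) (auto simp: admissible_def)

lemma lsum_diff: "lsum (\<lambda>w. f w - g w) = lsum f - lsum g"
  by (rule fps_ext) (simp add: lsum_def sum_subtractf)

lemma lsum_mult: "admissible f \<Longrightarrow> lsum (\<lambda>w. c * f w) = c * lsum f"
proof (rule fps_ext)
  fix n assume f: "admissible f"
  have "lsum (\<lambda>w. c * f w) $ n = (\<Sum>w\<le>n. \<Sum>i=0..n. c $ i * f w $ (n - i))"
    by (simp add: lsum_def fps_mult_nth)
  also have "\<dots> = (\<Sum>i=0..n. c $ i * (\<Sum>w\<le>n. f w $ (n - i)))"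
    by (subst sum.swap) (simp add: sum_distrib_left)
  also have "\<dots> = (c * lsum f) $ n"
    unfolding fps_mult_nth using lsum_nth[OF f, of "n - _" n] by simp
  finally show "lsum (\<lambda>w. c * f w) $ n = (c * lsum f) $ n" .
qed

lemma lsum_Suc: "admissible f \<Longrightarrow> lsum f = f 0 + lsum (\<lambda>w. f (Suc w))"
proof (rule fps_ext)
  fix n assume f: "admissible f"
  have "lsum f $ n = (\<Sum>w\<le>Suc n. f w $ n)"
    using f by (rule lsum_nth) simp
  also have "\<dots> = f 0 $ n + (\<Sum>w\<le>n. f (Suc w) $ n)"
    by (rule sum.atMost_Suc_shift)
  finally show "lsum f $ n = (f 0 + lsum (\<lambda>w. f (Suc w))) $ n"
    by (simp add: lsum_def)
qed

lemma admissible_power: "(\<And>w. w \<le> k w) \<Longrightarrow> admissible (\<lambda>w. fps_X ^ k w * g w)"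
  unfolding admissible_def fps_X_power_mult_nth by (auto dest: less_le_trans)

abbreviation iq :: "nat \<Rightarrow> real fps" where "iq w \<equiv> inverse (qpoch w)"

lemma iq_eq: "iq w = (1 - fps_X ^ Suc w) * iq (Suc w)"
  using inverse_qpoch_Suc[of w] by (simp add: mult.commute)

text \<open>For \<open>e = 0\<close> this is the Durfee rectangle expansion: a \<open>w\<close> by
  \<open>w + m\<close> rectangle with one partition below and one beside it. The values 1 and 2 of
  \<open>e\<close> describe cranks.\<close>

definition durfee_sum :: "nat \<Rightarrow> nat \<Rightarrow> real fps" where
  "durfee_sum e m = lsum (\<lambda>w. fps_X ^ (w * (w + m) + e * w) * (iq w * iq (w + m)))"

lemma admissible_durfee: "admissible (\<lambda>w. fps_X ^ (w * (w + m) + e * w) * g w)"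
proof (rule admissible_power)
  show "w \<le> w * (w + m) + e * w" for w
    by (cases w) auto
qed

text \<open>The factor \<open>1 - fps_X ^ w\<close> kills the term \<open>w = 0\<close> and cancels
  the last factor of \<open>iq w\<close>, after which the index can be shifted.
  \<open>durfee_sum_diff\<close> and \<open>durfee_sum_0_Suc\<close> rest on this.\<close>

lemma lsum_shift:
  "lsum (\<lambda>w. fps_X ^ (w * (w + m) + e * w) * ((1 - fps_X ^ w) * iq w * g w)) =
   fps_X ^ (m + e + 1) * lsum (\<lambda>w. fps_X ^ (w * (w + m) + (e + 2) * w) * (iq w * g (Suc w)))"
proof -
  have "lsum (\<lambda>w. fps_X ^ (w * (w + m) + e * w) * ((1 - fps_X ^ w) * iq w * g w)) =
      lsum (\<lambda>w. fps_X ^ (Suc w * (Suc w + m) + e * Suc w) * ((1 - fps_X ^ Suc w) * iq (Suc w) * g (Suc w)))"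
    using lsum_Suc[OF admissible_durfee[of m e "\<lambda>w. (1 - fps_X ^ w) * iq w * g w"]] by simp
  also have "\<dots> = lsum (\<lambda>w. fps_X ^ (m + e + 1) * (fps_X ^ (w * (w + m) + (e + 2) * w) * (iq w * g (Suc w))))"
  proof (rule arg_cong[where f = lsum], rule ext)
    fix w
    have "Suc w * (Suc w + m) + e * Suc w = (m + e + 1) + (w * (w + m) + (e + 2) * w)"
      by (simp add: algebra_simps)
    then show "fps_X ^ (Suc w * (Suc w + m) + e * Suc w) * ((1 - fps_X ^ Suc w) * iq (Suc w) * g (Suc w)) =
        fps_X ^ (m + e + 1) * (fps_X ^ (w * (w + m) + (e + 2) * w) * (iq w * g (Suc w)))"
      unfolding iq_eq[of w] by (simp only: power_add mult_ac)
  qed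
  also have "\<dots> = fps_X ^ (m + e + 1) * lsum (\<lambda>w. fps_X ^ (w * (w + m) + (e + 2) * w) * (iq w * g (Suc w)))"
    by (rule lsum_mult) (rule admissible_durfee)
  finally show ?thesis .
qed

lemma durfee_sum_diff:
  "durfee_sum e m - durfee_sum (e + 1) m = fps_X ^ (m + e + 1) * durfee_sum (e + 1) (m + 1)"
proof -
  have "durfee_sum e m - durfee_sum (e + 1) m =
      lsum (\<lambda>w. fps_X ^ (w * (w + m) + e * w) * ((1 - fps_X ^ w) * iq w * iq (w + m)))"
    unfolding durfee_sum_def lsum_diff[symmetric]
    by (rule arg_cong[where f = lsum]) (auto simp: power_add algebra_simps)
  also have "\<dots> = fps_X ^ (m + e + 1) * durfee_sum (e + 1) (m + 1)"
    unfolding lsum_shift durfee_sum_def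
    by (rule arg_cong[where f = "\<lambda>x. fps_X ^ (m + e + 1) * lsum x"], rule ext) (simp add: algebra_simps)
  finally show ?thesis .
qed

lemma durfee_sum_raise:
  "durfee_sum e m = lsum (\<lambda>w. fps_X ^ (w * (w + m) + e * w) * (iq w * iq (w + m + 1)))
     - fps_X ^ (m + 1) * durfee_sum e (m + 1)"
proof -
  have "durfee_sum e m = lsum (\<lambda>w. fps_X ^ (w * (w + m) + e * w) * (iq w * iq (w + m + 1))
     - fps_X ^ (m + 1) * (fps_X ^ (w * (w + (m + 1)) + e * w) * (iq w * iq (w + (m + 1)))))"
    unfolding durfee_sum_def
  proof (rule arg_cong[where f = lsum], rule ext)
    fix w
    have "iq (w + m) = (1 - fps_X ^ (m + 1) * fps_X ^ w) * iq (w + m + 1)"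
      using iq_eq[of "w + m"] by (simp add: power_add mult_ac)
    moreover have "w * (w + (m + 1)) + e * w = (w * (w + m) + e * w) + w"
      by (simp add: algebra_simps)
    ultimately show "fps_X ^ (w * (w + m) + e * w) * (iq w * iq (w + m)) =
      fps_X ^ (w * (w + m) + e * w) * (iq w * iq (w + m + 1))
     - fps_X ^ (m + 1) * (fps_X ^ (w * (w + (m + 1)) + e * w) * (iq w * iq (w + (m + 1))))"
      by (simp only: power_add add.assoc[symmetric]) (simp add: algebra_simps)
  qed
  then show ?thesis
    unfolding lsum_diff by (simp only: lsum_mult[OF admissible_durfee] durfee_sum_def)
qed

lemma lsum_iq_shift:
  "lsum (\<lambda>w. fps_X ^ (w * (w + m) + (e + 1) * w) * (iq w * iq (w + m + 1))) = durfee_sum e (m + 1)"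
  unfolding durfee_sum_def by (rule arg_cong[where f = lsum], rule ext) (simp add: algebra_simps)

lemma durfee_sum_0_Suc:
  "durfee_sum 0 m - durfee_sum 0 (m + 1) = - (fps_X ^ (m + 1) * (durfee_sum 0 (m + 1) - durfee_sum 0 (m + 2)))"
proof -
  have A: "lsum (\<lambda>w. fps_X ^ (w * (w + m) + 0 * w) * (iq w * iq (w + m + 1))) - durfee_sum 0 (m + 1)
      = fps_X ^ (m + 1) * lsum (\<lambda>w. fps_X ^ (w * (w + m) + 2 * w) * (iq w * iq (w + m + 2)))"
  proof -
    have "lsum (\<lambda>w. fps_X ^ (w * (w + m) + 0 * w) * (iq w * iq (w + m + 1))) - durfee_sum 0 (m + 1)
      = lsum (\<lambda>w. fps_X ^ (w * (w + m) + 0 * w) * ((1 - fps_X ^ w) * iq w * iq (w + m + 1)))"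
      unfolding lsum_iq_shift[of m 0, symmetric] lsum_diff[symmetric]
      by (rule arg_cong[where f = lsum]) (auto simp: power_add algebra_simps)
    also have "\<dots> = fps_X ^ (m + 0 + 1) * lsum (\<lambda>w. fps_X ^ (w * (w + m) + (0 + 2) * w) * (iq w * iq (Suc w + m + 1)))"
      by (rule lsum_shift)
    finally show ?thesis by (simp add: mult_2)
  qed
  have "lsum (\<lambda>w. fps_X ^ (w * (w + m) + 2 * w) * (iq w * iq (w + m + 2))) = durfee_sum 0 (m + 2)"
    unfolding durfee_sum_def by (rule arg_cong[where f = lsum], rule ext) (simp add: algebra_simps)
  then show ?thesis
    using durfee_sum_raise[of 0 m] A by (simp add: algebra_simps)
qed

text \<open>The difference D m of neighbours equals -X^(m+1) D(m+1); by iteration it is divisible by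
  every power of X and vanishes.\<close>

lemma durfee_sum_0_const: "durfee_sum 0 m = durfee_sum 0 (m + 1)"
proof -
  define D where "D m = durfee_sum 0 m - durfee_sum 0 (m + 1)" for m
  have step: "D m = - (fps_X ^ (m + 1) * D (m + 1))" for m
    using durfee_sum_0_Suc[of m] by (simp add: D_def)
  have zero: "\<forall>i<k. D m $ i = 0" for k m
  proof (induction k arbitrary: m)
    case (Suc k)
    have "D m $ i = 0" if "i < Suc k" for i
      unfolding step[of m] using Suc.IH[of "m + 1"] that
      by (auto simp: fps_X_power_mult_nth simp del: power_Suc)
    then show ?case by blast
  qed simp
  have "D m = 0"
  proof (rule fps_ext)
    show "D m $ n = 0 $ n" for n
      using zero[of "Suc n" m] by simp
  qed
  then show ?thesis by (simp add: D_def)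
qed

text \<open>The sum is independent of \<open>m\<close>. For \<open>m\<close> beyond the degree in
  question only \<open>w = 0\<close> contributes, and its value 1/(q; q)_M agrees there with the
  partition series.\<close>

lemma durfee_sum_0: "durfee_sum 0 m = part_fps UNIV"
proof (rule fps_ext)
  fix n
  have const: "durfee_sum 0 m = durfee_sum 0 (m + k)" for k
    by (induction k) (use durfee_sum_0_const in simp_all)
  define M where "M = m + Suc n"
  have "durfee_sum 0 m $ n = durfee_sum 0 M $ n"
    using const[of "Suc n"] by (simp add: M_def)
  also have "\<dots> = (\<Sum>w\<le>n. (fps_X ^ (w * (w + M) + 0 * w) * (iq w * iq (w + M))) $ n)"
    by (simp add: durfee_sum_def lsum_def)
  also have "\<dots> = (\<Sum>w\<in>{0}. (fps_X ^ (w * (w + M) + 0 * w) * (iq w * iq (w + M))) $ n)"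
  proof (rule sum.mono_neutral_right)
    show "\<forall>w\<in>{..n} - {0}. (fps_X ^ (w * (w + M) + 0 * w) * (iq w * iq (w + M))) $ n = 0"
    proof
      fix w assume "w \<in> {..n} - {0}"
      then have "1 * M \<le> w * (w + M)" by (intro mult_le_mono) auto
      then show "(fps_X ^ (w * (w + M) + 0 * w) * (iq w * iq (w + M))) $ n = 0"
        by (simp add: fps_X_power_mult_nth M_def)
    qed
  qed auto
  also have "\<dots> = part_fps UNIV $ n"
    using part_fps_UNIV_nth[of n M] by (simp add: M_def)
  finally show "durfee_sum 0 m $ n = part_fps UNIV $ n" .
qed

text \<open>The crank analogue of \<open>num_rank_ge\<close>: by \<open>lsum_crank_fps\<close> its
  successive differences collect the terms \<open>crank_fps w j\<close> with j - w = m.\<close>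

definition crank_ge_fps :: "nat \<Rightarrow> real fps" where
  "crank_ge_fps m = fps_X ^ m * durfee_sum 1 m"

text \<open>The counterpart of Dyson's recursion, with \<open>m\<close> increasing by 1 instead of
  3; this is why triangular numbers replace pentagonal ones.\<close>

lemma crank_ge_fps_rec: "crank_ge_fps m = fps_X ^ m * (part_fps UNIV - crank_ge_fps (m + 1))"
  using durfee_sum_diff[of 0 m] durfee_sum_0[of m]
  by (simp add: crank_ge_fps_def algebra_simps)

text \<open>The exponent in \<open>crank_fps w (w + m)\<close> is m + w(w + m) + 2w, so the sum is
  essentially \<open>durfee_sum 2 m\<close>. Eliminating \<open>durfee_sum 2 (m + 1)\<close> from
  two contiguous relations expresses it through \<open>e = 1\<close>.\<close>

lemma lsum_crank_fps: "lsum (\<lambda>w. crank_fps w (w + m)) = crank_ge_fps m - crank_ge_fps (m + 1)"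
proof -
  have "lsum (\<lambda>w. crank_fps w (w + m)) =
      lsum (\<lambda>w. ((1 - fps_X) * fps_X ^ m) * (fps_X ^ (w * (w + m) + 2 * w) * (iq w * iq (w + m))))"
    by (rule arg_cong[where f = lsum], rule ext) (simp add: crank_fps_def power_add algebra_simps mult_2 mult_2_right)
  also have "\<dots> = (1 - fps_X) * fps_X ^ m * durfee_sum 2 m"
    unfolding durfee_sum_def by (rule lsum_mult) (rule admissible_durfee)
  also have "\<dots> = crank_ge_fps m - crank_ge_fps (m + 1)"
  proof -
    have r1: "durfee_sum 1 m - durfee_sum 2 m = fps_X ^ (m + 2) * durfee_sum 2 (m + 1)"
      using durfee_sum_diff[of 1 m] by (simp add: numeral_2_eq_2)
    have r2: "durfee_sum 2 m = durfee_sum 1 (m + 1) - fps_X ^ (m + 1) * durfee_sum 2 (m + 1)"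
      using durfee_sum_raise[of 2 m] lsum_iq_shift[of m 1] by (simp add: numeral_2_eq_2)
    have "(1 - fps_X) * durfee_sum 2 m = durfee_sum 1 m - fps_X * durfee_sum 1 (m + 1)"
    proof -
      have "durfee_sum 1 m - durfee_sum 2 m = fps_X * (fps_X ^ (m + 1) * durfee_sum 2 (m + 1))"
        unfolding r1 by (simp add: mult_ac)
      also have "fps_X ^ (m + 1) * durfee_sum 2 (m + 1) = durfee_sum 1 (m + 1) - durfee_sum 2 m"
        unfolding r2 by simp
      finally show ?thesis by (simp add: algebra_simps)
    qed
    then have "fps_X ^ m * ((1 - fps_X) * durfee_sum 2 m) = fps_X ^ m * (durfee_sum 1 m - fps_X * durfee_sum 1 (m + 1))"
      by simp
    then show ?thesis
      by (simp add: crank_ge_fps_def algebra_simps)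
  qed
  finally show ?thesis .
qed

lemma triangular_minus_Suc: "triangular (- 1 - k) = triangular (- k) + k"
  using two_triangular[of "- 1 - k"] two_triangular[of "- k"] by (simp add: algebra_simps)

lemma triangular_minus_nonneg: "k \<ge> 1 \<Longrightarrow> triangular (- k) \<ge> 0"
proof -
  assume "k \<ge> 1"
  then have "k * (k - 1) \<ge> 0" by simp
  moreover have "2 * triangular (- k) = k * (k - 1)"
    using two_triangular[of "- k"] by (simp add: algebra_simps)
  ultimately show ?thesis by linarith
qed

lemma part_fps_UNIV: "part_fps UNIV $ n = npart (int n)"
  by (simp add: part_fps_def npart_def)

text \<open>Iteration of \<open>crank_ge_fps_rec\<close>: the powers m, m + 1, ... taken out add up
  to j m + j (j - 1)/2. With \<open>m \<ge> 1\<close> each step lowers \<open>n\<close>.\<close>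

lemma crank_ge_closed:
  "m \<ge> 1 \<Longrightarrow> n \<le> J \<Longrightarrow> crank_ge_fps m $ n =
     (\<Sum>j=1..J. (-1) ^ (j - 1) * real_of_int (npart (int n - triangular (- int j) - int m * int j)))"
proof (induction n arbitrary: m J rule: less_induct)
  case (less n)
  have rec: "crank_ge_fps m $ n = (if n < m then 0 else npart (int (n - m)) - crank_ge_fps (m + 1) $ (n - m))"
    by (subst crank_ge_fps_rec) (simp add: fps_X_power_mult_nth part_fps_UNIV)
  show ?case
  proof (cases "n < m")
    case True
    have "npart (int n - triangular (- int j) - int m * int j) = 0" if "j \<in> {1..J}" for j
    proof -
      have "int m \<le> int m * int j" using that mult_left_mono[of 1 "int j" "int m"] by simp
      moreover have "triangular (- int j) \<ge> 0"
        using that by (intro triangular_minus_nonneg) simp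
      ultimately have "int n - triangular (- int j) - int m * int j < 0"
        using True by linarith
      then show ?thesis by simp
    qed
    then show ?thesis using True rec by simp
  next
    case False
    then obtain K where K: "J = Suc K" using less.prems by (cases J) auto
    let ?f = "\<lambda>j. (-1) ^ (j - 1) * real_of_int (npart (int n - triangular (- int j) - int m * int j))"
    have "(\<Sum>j=1..J. ?f j) = ?f 1 + (\<Sum>j=1..K. ?f (Suc j))"
      unfolding K using sum.atLeast_Suc_atMost[of 1 "Suc K" ?f] sum.shift_bounds_cl_Suc_ivl[of ?f 1 K]
      by (simp del: sum.cl_ivl_Suc)
    also have "?f 1 = npart (int (n - m))"
      using False by (simp add: triangular_def of_nat_diff algebra_simps)
    also have "(\<Sum>j=1..K. ?f (Suc j)) = - crank_ge_fps (m + 1) $ (n - m)"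
    proof -
      have "crank_ge_fps (m + 1) $ (n - m) =
          (\<Sum>j=1..K. (-1) ^ (j - 1) * real_of_int (npart (int (n - m) - triangular (- int j) - int (m + 1) * int j)))"
        using False less.prems K by (intro less.IH) auto
      also have "\<dots> = - (\<Sum>j=1..K. ?f (Suc j))"
        unfolding sum_negf[symmetric]
      proof (rule sum.cong[OF refl])
        fix j assume j: "j \<in> {1..K}"
        have "int (n - m) - triangular (- int j) - int (m + 1) * int j =
            int n - triangular (- int (Suc j)) - int m * int (Suc j)"
          using triangular_minus_Suc[of "int j"] False by (simp add: of_nat_diff algebra_simps)
        moreover have "(-1 :: real) ^ (j - 1) = - ((-1) ^ (Suc j - 1))"
          using j by (cases j) auto
        ultimately show "(-1) ^ (j - 1) * real_of_int (npart (int (n - m) - triangular (- int j) - int (m + 1) * int j)) = - ?f (Suc j)"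
          by simp
      qed
      finally show ?thesis by simp
    qed
    finally show ?thesis using rec False by simp
  qed
qed

lemma crank_fps_nth_0: "n < w + j \<Longrightarrow> crank_fps w j $ n = 0"
proof -
  assume "n < w + j"
  moreover have "crank_fps w j = fps_X ^ (w + j + w * j) * ((1 - fps_X) * iq w * iq j)"
    by (simp add: crank_fps_def mult_ac)
  ultimately show ?thesis by (simp add: fps_X_power_mult_nth)
qed

lemma mu_le_partition: "p \<in> partitions n \<Longrightarrow> mu p \<le> n"
  unfolding mu_def by (rule le_trans[OF size_filter_mset_lesseq size_le_partition])

lemma ones_le_partition: "p \<in> partitions n \<Longrightarrow> ones p \<le> n"
  unfolding ones_def by (rule le_trans[OF count_le_size size_le_partition])

text \<open>The weights \<open>crank_fps w j\<close> are symmetric in \<open>w\<close> and \<open>j\<close> and \<open>chi\<close> is odd, so only the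
  antisymmetric part \<open>(w - j) / 2\<close> of the weight \<open>w\<close> contributes.\<close>

lemma M_omega_diff_eq_moment:
  "real_of_int (M_omega 2 5 n - M_omega 3 5 n) =
     - (\<Sum>m=1..n. real_of_int (int m * chi (int m)) * (crank_ge_fps m - crank_ge_fps (m + 1)) $ n)"
proof -
  let ?P = "partitions n"
  have fin: "finite ?P" by (rule finite_partitions)
  have "M_omega 2 5 n - M_omega 3 5 n = (\<Sum>p\<in>?P. chi (crank p) * int (ones p))"
  proof -
    have "M_omega c 5 n = (\<Sum>p\<in>?P. if crank p mod 5 = c then int (ones p) else 0)" if "c \<in> {2,3}" for c
      unfolding M_omega_def using that fin by (subst sum.inter_filter[symmetric]) (auto simp: cong_def intro!: sum.cong)
    then show ?thesis
      by (simp add: sum_subtractf[symmetric] chi_def) (rule sum.cong, auto)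
  qed
  \<comment> \<open>The weight \<open>ones p\<close> is zero exactly where \<open>crank\<close>
    takes its first branch.\<close>
  also have "\<dots> = (\<Sum>p\<in>?P. chi (int (mu p) - int (ones p)) * int (ones p))"
    by (rule sum.cong) (auto simp: crank_def)
  also have "\<dots> = (\<Sum>wj\<in>{..n}\<times>{..n}. \<Sum>p\<in>{p\<in>?P. (ones p, mu p) = wj}. chi (int (mu p) - int (ones p)) * int (ones p))"
    by (rule sum.group[symmetric]) (auto simp: fin mu_le_partition ones_le_partition)
  also have "\<dots> = (\<Sum>(w,j)\<in>{..n}\<times>{..n}. chi (int j - int w) * int w * int (card {p\<in>?P. ones p = w \<and> mu p = j}))"
    by (rule sum.cong) auto
  finally have "real_of_int (M_omega 2 5 n - M_omega 3 5 n) =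
      (\<Sum>(w,j)\<in>{..n}\<times>{..n}. of_int (chi (int j - int w)) * real w * real (card {p\<in>?P. ones p = w \<and> mu p = j}))"
    by (simp add: case_prod_unfold)
  also have "\<dots> = (\<Sum>(w,j)\<in>{..n}\<times>{..n}. of_int (chi (int j - int w)) * real w * crank_fps w j $ n)"
  proof (rule sum.cong[OF refl], clarify)
    fix w j
    show "of_int (chi (int j - int w)) * real w * real (card {p\<in>?P. ones p = w \<and> mu p = j}) =
        of_int (chi (int j - int w)) * real w * crank_fps w j $ n"
    proof (cases "w = 0")
      case False
      have "{p \<in> ?P. ones p = w \<and> mu p = j} = {p \<in> {p. 0 \<notin># p \<and> ones p = w \<and> mu p = j}. p \<in> ?P}"
        by (auto simp: partitions_def)
      then show ?thesis
        using part_fps_ones_mu[of w j] False by (auto simp: part_fps_def dest!: arg_cong[where f = "\<lambda>f. f $ n"])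
    qed simp
  qed
  finally have S: "real_of_int (M_omega 2 5 n - M_omega 3 5 n) =
      (\<Sum>(w,j)\<in>{..n}\<times>{..n}. of_int (chi (int j - int w)) * real w * crank_fps w j $ n)" (is "_ = ?S") .
  define g where "g w j = (if w < j then of_int (chi (int j - int w)) * (real j - real w) * crank_fps w j $ n else 0)" for w j
  have swap: "(\<Sum>(w,j)\<in>{..n}\<times>{..n}. f w j) = (\<Sum>(w,j)\<in>{..n}\<times>{..n}. f j w)" for f :: "nat \<Rightarrow> nat \<Rightarrow> real"
    by (rule sum.reindex_bij_witness[where i = prod.swap and j = prod.swap]) auto
  have chi_swap: "chi (int w - int j) = - chi (int j - int w)" for w j
    using chi_uminus[of "int j - int w"] by simp
  have "2 * ?S = (\<Sum>(w,j)\<in>{..n}\<times>{..n}. of_int (chi (int j - int w)) * real w * crank_fps w j $ n) +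
     (\<Sum>(w,j)\<in>{..n}\<times>{..n}. of_int (chi (int w - int j)) * real j * crank_fps j w $ n)"
    using swap[of "\<lambda>w j. of_int (chi (int j - int w)) * real w * crank_fps w j $ n"] by simp
  also have "\<dots> = - (\<Sum>(w,j)\<in>{..n}\<times>{..n}. g w j) - (\<Sum>(w,j)\<in>{..n}\<times>{..n}. g j w)"
    unfolding sum.distrib[symmetric] sum_negf[symmetric] sum_subtractf[symmetric]
  proof (rule sum.cong[OF refl], clarify)
    fix w j
    show "of_int (chi (int j - int w)) * real w * crank_fps w j $ n + of_int (chi (int w - int j)) * real j * crank_fps j w $ n
        = - g w j - g j w"
      using crank_fps_commute[of w j] chi_swap[of w j]
      by (cases w j rule: linorder_cases) (auto simp: g_def algebra_simps)
  qed
  also have "\<dots> = - 2 * (\<Sum>(w,j)\<in>{..n}\<times>{..n}. g w j)"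
    using swap[of g] by simp
  finally have "?S = - (\<Sum>(w,j)\<in>{..n}\<times>{..n}. g w j)" by simp
  \<comment> \<open>Substitution \<open>j = w + m\<close>. Pairs with \<open>w + m > n\<close> leave
    the square, but they contribute nothing by \<open>crank_fps_nth_0\<close>.\<close>
  also have "(\<Sum>(w,j)\<in>{..n}\<times>{..n}. g w j) = (\<Sum>(w,m)\<in>{..n}\<times>{1..n}. g w (w + m))"
  proof (rule sum.reindex_bij_witness_not_neutral[where i = "\<lambda>(w,m). (w, w + m)" and j = "\<lambda>(w,j). (w, j - w)"
      and S' = "{(w,j). (w,j) \<in> {..n}\<times>{..n} \<and> \<not> w < j}" and T' = "{(w,m). (w,m) \<in> {..n}\<times>{1..n} \<and> w + m > n}"])
    show "finite {(w,j). (w,j) \<in> {..n}\<times>{..n} \<and> \<not> w < j}"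
      by (rule finite_subset[of _ "{..n}\<times>{..n}"]) auto
    show "finite {(w,m). (w,m) \<in> {..n}\<times>{1..n} \<and> w + m > n}"
      by (rule finite_subset[of _ "{..n}\<times>{..n}"]) auto
  qed (auto simp: g_def crank_fps_nth_0)
  also have "\<dots> = (\<Sum>m=1..n. real_of_int (int m * chi (int m)) * (\<Sum>w\<le>n. crank_fps w (w + m) $ n))"
  proof -
    have "(\<Sum>(w,m)\<in>{..n}\<times>{1..n}. g w (w + m)) = (\<Sum>w\<le>n. \<Sum>m=1..n. g w (w + m))"
      by (simp add: sum.cartesian_product)
    also have "\<dots> = (\<Sum>m=1..n. \<Sum>w\<le>n. g w (w + m))"
      by (rule sum.swap)
    also have "\<dots> = (\<Sum>m=1..n. real_of_int (int m * chi (int m)) * (\<Sum>w\<le>n. crank_fps w (w + m) $ n))"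
      by (rule sum.cong[OF refl]) (auto simp: g_def sum_distrib_left mult_ac intro!: sum.cong)
    finally show ?thesis .
  qed
  also have "\<dots> = (\<Sum>m=1..n. real_of_int (int m * chi (int m)) * (crank_ge_fps m - crank_ge_fps (m + 1)) $ n)"
    by (simp only: lsum_crank_fps[symmetric] lsum_def fps_nth_Abs_fps)
  finally show ?thesis using S by simp
qed

section \<open>Finite partial fractions\<close>

text \<open>Lagrange interpolation at the reciprocals of the \<open>\<beta> i\<close>: both sides
  have degree below \<open>card I\<close> and agree there. The denominators are multiplied out, so
  the identity also holds at the poles.\<close>

lemma partial_fraction_identity:
  fixes \<beta> :: "'i \<Rightarrow> real" and h :: "real poly"
  assumes I: "finite I" "inj_on \<beta> I" "\<And>i. i \<in> I \<Longrightarrow> \<beta> i \<noteq> 0" and deg: "degree h < card I"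
  defines "c \<equiv> \<lambda>i. poly h (1 / \<beta> i) / (\<Prod>j\<in>I-{i}. 1 - \<beta> j / \<beta> i)"
  shows "poly h x = (\<Sum>i\<in>I. c i * (\<Prod>j\<in>I-{i}. 1 - \<beta> j * x))"
proof -
  define g where "g = (\<Sum>i\<in>I. smult (c i) (\<Prod>j\<in>I-{i}. [:1, - \<beta> j:]))"
  have poly_g: "poly g x = (\<Sum>i\<in>I. c i * (\<Prod>j\<in>I-{i}. 1 - \<beta> j * x))" for x
    by (simp add: g_def poly_sum poly_prod mult.commute)
  have "degree g < card I"
  proof -
    have "degree (smult (c i) (\<Prod>j\<in>I-{i}. [:1, - \<beta> j:])) \<le> card I - 1" if "i \<in> I" for i
    proof -
      have "degree (\<Prod>j\<in>I-{i}. [:1, - \<beta> j:]) \<le> (\<Sum>j\<in>I-{i}. degree [:1, - \<beta> j:])"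
        using degree_prod_sum_le[of "I - {i}" "\<lambda>j. [:1, - \<beta> j:]"] I by (simp add: comp_def)
      also have "\<dots> \<le> (\<Sum>j\<in>I-{i}. 1)"
        by (rule sum_mono) auto
      finally have "degree (\<Prod>j\<in>I-{i}. [:1, - \<beta> j:]) \<le> card I - 1"
        using that I by simp
      then show ?thesis by (meson degree_smult_le order_trans)
    qed
    then have "degree g \<le> card I - 1"
      unfolding g_def by (intro degree_sum_le) (use I in auto)
    then show ?thesis using deg by linarith
  qed
  moreover have "poly h (1 / \<beta> i) = poly g (1 / \<beta> i)" if i: "i \<in> I" for i
  proof -
    have "poly g (1 / \<beta> i) = (\<Sum>k\<in>{i}. c k * (\<Prod>j\<in>I-{k}. 1 - \<beta> j * (1 / \<beta> i)))"
      unfolding poly_g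
      by (rule sum.mono_neutral_right) (use I i in \<open>auto intro!: bexI[of _ i]\<close>)
    moreover have "(\<Prod>j\<in>I-{i}. 1 - \<beta> j / \<beta> i) \<noteq> 0"
      using I i by (auto simp: inj_on_def)
    ultimately show ?thesis by (simp add: c_def)
  qed
  moreover have "card ((\<lambda>i. 1 / \<beta> i) ` I) = card I"
    by (rule card_image) (use I in \<open>auto simp: inj_on_def\<close>)
  ultimately have "h = g"
    using deg by (intro poly_eqI_degree[of "(\<lambda>i. 1 / \<beta> i) ` I"]) auto
  then show ?thesis using poly_g by simp
qed

section \<open>Rational products near x = 1\<close>

lemma DERIV_prod_log:
  fixes f :: "'i \<Rightarrow> real \<Rightarrow> real"
  assumes "finite I" "\<And>i. i \<in> I \<Longrightarrow> (f i has_real_derivative f i x * l i) (at x)"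
  shows "((\<lambda>x. \<Prod>i\<in>I. f i x) has_real_derivative (\<Prod>i\<in>I. f i x) * (\<Sum>i\<in>I. l i)) (at x)"
  using assms
proof (induction I rule: finite_induct)
  case (insert i I)
  then have "((\<lambda>x. f i x * (\<Prod>i\<in>I. f i x)) has_real_derivative
      f i x * l i * (\<Prod>i\<in>I. f i x) + (\<Prod>i\<in>I. f i x) * (\<Sum>i\<in>I. l i) * f i x) (at x)"
    by (intro DERIV_mult) auto
  then show ?case using insert by (simp add: algebra_simps)
qed simp

text \<open>A finite truncation of a theta quotient, with zeros and poles away from 1.
  \<open>L\<close> is its logarithmic derivative and \<open>U\<close> an open set around 1 on which
  no factor vanishes.\<close>

locale rational_product =
  fixes K :: real and M :: nat and J :: "'j set" and \<alpha> :: "'j \<Rightarrow> real" and I :: "'i set" and \<beta> :: "'i \<Rightarrow> real"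
  assumes finite_J: "finite J" and finite_I: "finite I"
    and alpha_ne_1: "\<And>j. j \<in> J \<Longrightarrow> \<alpha> j \<noteq> 1" and beta_ne_1: "\<And>i. i \<in> I \<Longrightarrow> \<beta> i \<noteq> 1"
begin

definition f :: "real \<Rightarrow> real" where
  "f x = K * x ^ M * (\<Prod>j\<in>J. 1 - \<alpha> j * x) / (\<Prod>i\<in>I. 1 - \<beta> i * x)"

definition L :: "real \<Rightarrow> real" where
  "L x = real M / x - (\<Sum>j\<in>J. \<alpha> j / (1 - \<alpha> j * x)) + (\<Sum>i\<in>I. \<beta> i / (1 - \<beta> i * x))"

definition U :: "real set" where
  "U = {0<..} \<inter> (\<Inter>j\<in>J. {x. 1 - \<alpha> j * x \<noteq> 0}) \<inter> (\<Inter>i\<in>I. {x. 1 - \<beta> i * x \<noteq> 0})"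

lemma open_U: "open U"
proof -
  have "open {x::real. 1 - a * x \<noteq> 0}" for a
    by (rule open_Collect_neq) (auto intro!: continuous_intros)
  then show ?thesis unfolding U_def
    using finite_I finite_J by (intro open_Int open_INT ballI) auto
qed

lemma one_in_U: "1 \<in> U"
  using alpha_ne_1 beta_ne_1 by (auto simp: U_def)

lemma DERIV_f:
  assumes "x \<in> U" shows "(f has_real_derivative f x * L x) (at x)"
proof -
  have x: "x > 0" "\<And>j. j \<in> J \<Longrightarrow> 1 - \<alpha> j * x \<noteq> 0" "\<And>i. i \<in> I \<Longrightarrow> 1 - \<beta> i * x \<noteq> 0"
    using assms by (auto simp: U_def)
  have 1: "((\<lambda>x. x ^ M) has_real_derivative x ^ M * (real M / x)) (at x)"
    by (rule DERIV_pow[THEN DERIV_cong]) (use x in \<open>cases M; simp add: field_simps\<close>)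
  have 2: "((\<lambda>x. \<Prod>j\<in>J. 1 - \<alpha> j * x) has_real_derivative (\<Prod>j\<in>J. 1 - \<alpha> j * x) * (\<Sum>j\<in>J. - (\<alpha> j / (1 - \<alpha> j * x)))) (at x)"
    by (rule DERIV_prod_log[OF finite_J]) (use x in \<open>auto intro!: derivative_eq_intros simp: field_simps\<close>)
  have 3: "((\<lambda>x. \<Prod>i\<in>I. 1 - \<beta> i * x) has_real_derivative (\<Prod>i\<in>I. 1 - \<beta> i * x) * (\<Sum>i\<in>I. - (\<beta> i / (1 - \<beta> i * x)))) (at x)"
    by (rule DERIV_prod_log[OF finite_I]) (use x in \<open>auto intro!: derivative_eq_intros simp: field_simps\<close>)
  have nz: "(\<Prod>i\<in>I. 1 - \<beta> i * x) \<noteq> 0"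
    using x(3) finite_I by auto
  have "((\<lambda>x. K * (x ^ M * (\<Prod>j\<in>J. 1 - \<alpha> j * x)) / (\<Prod>i\<in>I. 1 - \<beta> i * x)) has_real_derivative
     K * (x ^ M * (\<Prod>j\<in>J. 1 - \<alpha> j * x)) / (\<Prod>i\<in>I. 1 - \<beta> i * x) * L x) (at x)"
    by (rule DERIV_divide[OF DERIV_cmult[OF DERIV_mult[OF 1 2]] 3 nz, THEN DERIV_cong])
      (use nz in \<open>simp add: L_def sum_negf field_simps\<close>)
  then show ?thesis
    unfolding f_def by (simp add: mult.assoc)
qed

lemma DERIV_L_1:
  "(L has_real_derivative - real M - (\<Sum>j\<in>J. (\<alpha> j / (1 - \<alpha> j))\<^sup>2) + (\<Sum>i\<in>I. (\<beta> i / (1 - \<beta> i))\<^sup>2)) (at 1)"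
  unfolding L_def using alpha_ne_1 beta_ne_1
  by (auto intro!: derivative_eq_intros sum.cong simp: power2_eq_square sum_negf)

lemma DERIV_sum_fraction:
  assumes "x \<in> U"
  shows "((\<lambda>x. \<Sum>i\<in>I. c i / (1 - \<beta> i * x)) has_real_derivative (\<Sum>i\<in>I. c i * \<beta> i / (1 - \<beta> i * x)\<^sup>2)) (at x)"
  using assms unfolding U_def
  by (auto intro!: derivative_eq_intros sum.cong simp: power2_eq_square)

lemma first_order:
  assumes eq: "\<And>x. x \<in> U \<Longrightarrow> f x = (\<Sum>i\<in>I. c i / (1 - \<beta> i * x))"
  shows "(\<Sum>i\<in>I. c i * \<beta> i / (1 - \<beta> i)\<^sup>2) = f 1 * L 1"
proof -
  have "(f has_real_derivative (\<Sum>i\<in>I. c i * \<beta> i / (1 - \<beta> i * 1)\<^sup>2)) (at 1)"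
    by (rule has_field_derivative_transform_within_open[OF DERIV_sum_fraction open_U one_in_U])
      (auto simp: eq one_in_U)
  then show ?thesis
    using DERIV_unique[OF DERIV_f[OF one_in_U]] by simp
qed

text \<open>Here a pole at 1 has been split off. With S for the sum, one differentiation gives f L =
  -S + (1 - x) S', and a second one, at 1, gives f (L^2 + L') = -2 S'. The two claims are these
  equations at x = 1.\<close>

lemma second_order:
  assumes eq: "\<And>x. x \<in> U \<Longrightarrow> f x = f 1 + (1 - x) * (\<Sum>i\<in>I. c i / (1 - \<beta> i * x))"
  shows "(\<Sum>i\<in>I. c i / (1 - \<beta> i)) = - f 1 * L 1"
    and "(\<Sum>i\<in>I. c i * \<beta> i / (1 - \<beta> i)\<^sup>2) = - (1/2) * f 1 * ((L 1)\<^sup>2 +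
        (- real M - (\<Sum>j\<in>J. (\<alpha> j / (1 - \<alpha> j))\<^sup>2) + (\<Sum>i\<in>I. (\<beta> i / (1 - \<beta> i))\<^sup>2)))"
proof -
  define S where "S x = (\<Sum>i\<in>I. c i / (1 - \<beta> i * x))" for x
  define S' where "S' x = (\<Sum>i\<in>I. c i * \<beta> i / (1 - \<beta> i * x)\<^sup>2)" for x
  have S: "(S has_real_derivative S' x) (at x)" if "x \<in> U" for x
    unfolding S_def S'_def by (rule DERIV_sum_fraction[OF that])
  have fL: "f x * L x = - S x + (1 - x) * S' x" if x: "x \<in> U" for x
  proof -
    have "((\<lambda>x. f 1 + (1 - x) * S x) has_real_derivative - S x + (1 - x) * S' x) (at x)"
      using S[OF x] by (auto intro!: derivative_eq_intros)
    then have "(f has_real_derivative - S x + (1 - x) * S' x) (at x)"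
      by (rule has_field_derivative_transform_within_open[OF _ open_U x]) (simp add: S_def eq)
    then show ?thesis using DERIV_unique[OF DERIV_f[OF x]] by simp
  qed
  show "(\<Sum>i\<in>I. c i / (1 - \<beta> i)) = - f 1 * L 1"
    using fL[OF one_in_U] by (simp add: S_def)
  \<comment> \<open>Existence of the derivative suffices: its value is multiplied by 1 - x, which is
    0 at the point.\<close>
  have "S' differentiable (at 1)"
    unfolding S'_def using beta_ne_1 finite_I
    by (intro differentiable_sum differentiable_divide differentiable_power differentiable_diff
        differentiable_mult) auto
  then have "\<exists>D. (S' has_real_derivative D) (at 1)"
    by (simp add: real_differentiable_def)
  then obtain D where D: "(S' has_real_derivative D) (at 1)" by blast
  define L' where "L' = - real M - (\<Sum>j\<in>J. (\<alpha> j / (1 - \<alpha> j))\<^sup>2) + (\<Sum>i\<in>I. (\<beta> i / (1 - \<beta> i))\<^sup>2)"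
  have "((\<lambda>x. f x * L x) has_real_derivative f 1 * L 1 * L 1 + L' * f 1) (at 1)"
    unfolding L'_def by (rule DERIV_mult[OF DERIV_f[OF one_in_U] DERIV_L_1])
  moreover have "((\<lambda>x. - S x + (1 - x) * S' x) has_real_derivative - 2 * S' 1) (at 1)"
    using S[OF one_in_U] D by (auto intro!: derivative_eq_intros)
  then have "((\<lambda>x. f x * L x) has_real_derivative - 2 * S' 1) (at 1)"
    by (rule has_field_derivative_transform_within_open[OF _ open_U one_in_U]) (simp add: fL)
  ultimately have "- 2 * S' 1 = f 1 * L 1 * L 1 + L' * f 1"
    by (rule DERIV_unique[symmetric])
  then show "(\<Sum>i\<in>I. c i * \<beta> i / (1 - \<beta> i)\<^sup>2) = - (1/2) * f 1 * ((L 1)\<^sup>2 +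
        (- real M - (\<Sum>j\<in>J. (\<alpha> j / (1 - \<alpha> j))\<^sup>2) + (\<Sum>i\<in>I. (\<beta> i / (1 - \<beta> i))\<^sup>2)))"
    unfolding L'_def[symmetric] by (simp add: S'_def algebra_simps power2_eq_square)
qed

end

text \<open>Dominated convergence for counting measure, the summands being extended by zero outside
  the growing window.\<close>

lemma tannery_int:
  fixes f :: "nat \<Rightarrow> int \<Rightarrow> real"
  assumes bound: "\<And>N k. \<bar>k\<bar> \<le> int N \<Longrightarrow> \<bar>f N k\<bar> \<le> g k" and g: "g summable_on UNIV"
    and lim: "\<And>k. (\<lambda>N. f N k) \<longlonglongrightarrow> l k"
  shows "(\<lambda>N. \<Sum>k=-int N..int N. f N k) \<longlonglongrightarrow> infsum l UNIV" and "l summable_on UNIV"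
proof -
  define F where "F N k = (if \<bar>k\<bar> \<le> int N then f N k else 0)" for N k
  have "g k \<ge> 0" for k
    using bound[of k "nat \<bar>k\<bar>"] by simp
  then have Fg: "\<bar>F N k\<bar> \<le> g k" for N k
    using bound by (auto simp: F_def)
  have Fl: "(\<lambda>N. F N k) \<longlonglongrightarrow> l k" for k
  proof (rule Lim_transform_eventually[OF lim])
    show "\<forall>\<^sub>F N in sequentially. f N k = F N k"
      using eventually_ge_at_top[of "nat \<bar>k\<bar>"] by eventually_elim (auto simp: F_def)
  qed
  have lg: "\<bar>l k\<bar> \<le> g k" for k
    by (rule LIMSEQ_le_const2[OF tendsto_rabs[OF Fl]]) (use Fg in auto)
  have intg: "integrable (count_space UNIV) g"
    using g \<open>\<And>k. g k \<ge> 0\<close> by (metis abs_summable_on_def abs_summable_equivalent abs_of_nonneg real_norm_def summable_on_cong)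
  have "(\<lambda>N. integral\<^sup>L (count_space UNIV) (F N)) \<longlonglongrightarrow> integral\<^sup>L (count_space UNIV) l"
    by (rule integral_dominated_convergence[where w = g]) (use intg Fl Fg in auto)
  moreover have "integral\<^sup>L (count_space UNIV) (F N) = (\<Sum>k=-int N..int N. f N k)" for N
  proof -
    have "integral\<^sup>L (count_space UNIV) (F N) = (\<Sum>k | k \<in> UNIV \<and> F N k \<noteq> 0. F N k)"
      by (rule lebesgue_integral_count_space_finite_support) (rule finite_subset[of _ "{-int N..int N}"], auto simp: F_def)
    also have "\<dots> = (\<Sum>k=-int N..int N. f N k)"
      by (rule sum.mono_neutral_cong_left) (auto simp: F_def split: if_splits)
    finally show ?thesis .
  qed
  moreover have ls: "Infinite_Set_Sum.abs_summable_on l UNIV"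
    unfolding Infinite_Set_Sum.abs_summable_on_def
    by (rule Bochner_Integration.integrable_bound[OF intg]) (use lg in \<open>auto simp: order_trans[OF _ abs_ge_self]\<close>)
  then have "integral\<^sup>L (count_space UNIV) l = infsum l UNIV"
    using infsetsum_infsum[OF ls] by (simp add: infsetsum_def)
  ultimately show "(\<lambda>N. \<Sum>k=-int N..int N. f N k) \<longlonglongrightarrow> infsum l UNIV" by simp
  show "l summable_on UNIV"
    using ls abs_summable_equivalent abs_summable_summable by blast
qed

section \<open>Theta products\<close>

locale nome =
  fixes y :: real
  assumes y_pos: "0 < y" and y_less_1: "y < 1"
begin

definition E :: "int \<Rightarrow> real" where "E i = y powi i"

lemma E_pos [simp]: "E i > 0" using y_pos by (simp add: E_def)
lemma E_nonzero [simp]: "E i \<noteq> 0" using E_pos[of i] by linarith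
lemma E_nonneg [simp]: "E i \<ge> 0" using E_pos[of i] by linarith
lemma E_0 [simp]: "E 0 = 1" by (simp add: E_def)
lemma E_add: "E (i + j) = E i * E j" using y_pos by (simp add: E_def power_int_add)
lemma E_minus: "E (- i) = inverse (E i)" by (simp add: E_def power_int_minus)
lemma E_diff: "E (i - j) = E i / E j" using E_add[of i "- j"] by (simp add: E_minus divide_inverse)
lemma E_mult_minus [simp]: "E i * E (- i) = 1" "E (- i) * E i = 1" by (simp_all add: E_minus)
lemma E_power: "E i ^ n = E (i * int n)" by (simp add: E_def power_int_mult)
lemma E_nat: "E (int n) = y ^ n" by (simp add: E_def)

lemma E_le: "i \<le> j \<Longrightarrow> E j \<le> E i"
proof -
  assume "i \<le> j"
  then have "E j = E i * y ^ nat (j - i)" using E_add[of i "j - i"] E_nat[of "nat (j - i)"] by simp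
  also have "\<dots> \<le> E i * 1" using y_pos y_less_1 by (intro mult_left_mono power_le_one) auto
  finally show ?thesis by simp
qed

lemma E_le_y: "i \<ge> 1 \<Longrightarrow> E i \<le> y"
  using E_le[of 1 i] by (simp add: E_def)

lemma E_eq_1_iff [simp]: "E i = 1 \<longleftrightarrow> i = 0"
proof (cases i "0 :: int" rule: linorder_cases)
  case less
  then have "E (- i) < 1" using E_le_y[of "- i"] y_less_1 by simp
  then show ?thesis using less by (auto simp: E_minus)
next
  case greater
  then have "E i < 1" using E_le_y[of i] y_less_1 by simp
  then show ?thesis using greater by auto
qed simp

lemma E_inj: "E i = E j \<longleftrightarrow> i = j"
  using E_eq_1_iff[of "i - j"] by (auto simp: E_diff)

text \<open>The values at \<open>0\<close> omit the vanishing factor or the pole, so that below \<open>bt 0 = \<Prod>n\<ge>1. (1 - y^(5n))^2\<close>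
  and \<open>PP 0\<close> is a regularized sum.\<close>

definition fc :: "int \<Rightarrow> real" where "fc j = (if j = 0 then 1 else 1 - E j)"
definition gE :: "int \<Rightarrow> real" where "gE j = (if j = 0 then 0 else E j / (1 - E j))"
definition hE :: "int \<Rightarrow> real" where "hE j = (if j = 0 then 0 else E j / (1 - E j)\<^sup>2)"

definition psi :: "int \<Rightarrow> real" where "psi j = (if j = 0 then 0 else 1 / (1 - E j))"

lemma fc_nonzero [simp]: "fc j \<noteq> 0" by (simp add: fc_def)

lemma fc_minus: "j \<noteq> 0 \<Longrightarrow> fc (- j) = - E (- j) * fc j"
  by (simp add: fc_def algebra_simps)

lemma gE_minus: "j \<noteq> 0 \<Longrightarrow> gE (- j) = - 1 - gE j"
proof -
  assume "j \<noteq> 0"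
  moreover have "1 - E j \<noteq> 0" "E j - 1 \<noteq> 0" using \<open>j \<noteq> 0\<close> by auto
  ultimately show ?thesis by (simp add: gE_def E_minus divide_simps)
qed

lemma hE_minus: "hE (- j) = hE j"
proof (cases "j = 0")
  case False
  have "1 - E j \<noteq> 0" using False by simp
  moreover have "1 - E (- j) = - (1 - E j) / E j"
    by (simp add: E_minus field_simps)
  then have "(1 - E (- j))\<^sup>2 = (1 - E j)\<^sup>2 / (E j)\<^sup>2"
    by (simp add: power_divide power2_commute)
  ultimately show ?thesis using False
    by (simp add: hE_def E_minus power2_eq_square)
qed (simp add: hE_def)

lemma gE_square: "(gE j)\<^sup>2 = hE j - gE j"
proof (cases "j = 0")
  case False
  then have "E j / (1 - E j) = E j * (1 - E j) / (1 - E j)\<^sup>2"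
    by (simp add: power2_eq_square)
  then have "hE j - gE j = (E j - E j * (1 - E j)) / (1 - E j)\<^sup>2"
    using False by (simp add: gE_def hE_def diff_divide_distrib)
  then show ?thesis
    using False by (simp add: gE_def power_divide) (simp add: power2_eq_square algebra_simps)
qed (simp add: gE_def hE_def)

lemma one_minus_E_abs: "j \<noteq> 0 \<Longrightarrow> \<bar>1 - E j\<bar> \<ge> 1 - y"
proof (cases "j \<ge> 1")
  case True
  then show ?thesis using E_le_y[of j] by simp
next
  case False
  assume "j \<noteq> 0"
  then have "E (- j) \<le> y" using False by (intro E_le_y) simp
  moreover have "\<bar>1 - E j\<bar> * E (- j) = 1 - E (- j)"
    using \<open>E (- j) \<le> y\<close> y_less_1 E_pos[of "-j"] E_mult_minus[of j] E_le[of j 0] False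
    by (simp add: abs_if algebra_simps)
  ultimately have "1 - y \<le> \<bar>1 - E j\<bar> * E (- j)" by simp
  also have "\<dots> \<le> \<bar>1 - E j\<bar> * 1"
    using \<open>E (- j) \<le> y\<close> y_less_1 by (intro mult_left_mono) auto
  finally show ?thesis by simp
qed

lemma psi_bound: "\<bar>psi j\<bar> \<le> 1 / (1 - y)"
  using one_minus_E_abs[of j] y_less_1 by (auto simp: psi_def abs_divide intro!: divide_left_mono)

lemma hE_bound: "\<bar>hE j\<bar> \<le> 1 / (1 - y)\<^sup>2"
proof -
  have *: "\<bar>hE j\<bar> \<le> 1 / (1 - y)\<^sup>2" if "j \<ge> 1" for j
  proof -
    have "(1 - y)\<^sup>2 \<le> (1 - E j)\<^sup>2"
      using E_le_y[OF that] y_less_1 by (intro power_mono) auto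
    moreover have "E j \<le> 1" using E_le_y[OF that] y_less_1 by simp
    ultimately have "E j / (1 - E j)\<^sup>2 \<le> 1 / (1 - y)\<^sup>2"
      using y_less_1 by (intro frac_le) auto
    then show ?thesis using that by (simp add: hE_def)
  qed
  consider "j = 0" | "j \<ge> 1" | "- j \<ge> 1" by linarith
  then show ?thesis
    using *[of j] *[of "- j"] hE_minus[of j] y_less_1 by cases (auto simp: hE_def)
qed

lemma summable_y: "summable (\<lambda>n. y ^ n)"
proof (rule summable_geometric)
  show "norm y < 1"
    unfolding real_norm_def abs_less_iff using y_pos y_less_1 by linarith
qed

lemma E_linear_le: "E (c + 5 * int n) \<le> E c * y ^ n"
proof -
  have "E (c + 5 * int n) \<le> E (c + int n)" by (rule E_le) simp
  then show ?thesis by (simp add: E_add E_nat)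
qed

lemma summable_E: "summable (\<lambda>n. E (c + 5 * int n))"
  by (rule summable_comparison_test'[OF summable_mult[OF summable_y, of "E c"]])
    (simp add: E_linear_le)

lemma summable_gE: "summable (\<lambda>n. gE (c + 5 * int n))"
proof (rule summable_comparison_test'[of "\<lambda>n. E (c + 5 * int n) * (1 / (1 - y))"])
  show "norm (gE (c + 5 * int n)) \<le> E (c + 5 * int n) * (1 / (1 - y))" for n
    using one_minus_E_abs[of "c + 5 * int n"] y_less_1
    by (auto simp: gE_def abs_divide intro!: divide_left_mono)
qed (intro summable_mult2 summable_E)

lemma summable_hE: "summable (\<lambda>n. hE (c + 5 * int n))"
proof (rule summable_comparison_test'[of "\<lambda>n. E (c + 5 * int n) * (1 / (1 - y)\<^sup>2)"])
  show "norm (hE (c + 5 * int n)) \<le> E (c + 5 * int n) * (1 / (1 - y)\<^sup>2)" for n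
  proof (cases "c + 5 * int n = 0")
    case False
    have "(1 - y)\<^sup>2 \<le> \<bar>1 - E (c + 5 * int n)\<bar>\<^sup>2"
      using one_minus_E_abs[OF False] y_less_1 by (intro power_mono) auto
    then show ?thesis using False y_less_1 by (auto simp: hE_def intro!: divide_left_mono)
  qed (simp add: hE_def)
qed (intro summable_mult2 summable_E)

section \<open>Theta products and their logarithmic derivatives\<close>

definition half_prod :: "int \<Rightarrow> real" where
  "half_prod c = prodinf (\<lambda>n. fc (c + 5 * int n))"
definition half_g :: "int \<Rightarrow> real" where
  "half_g c = (\<Sum>n. gE (c + 5 * int n))"
definition half_h :: "int \<Rightarrow> real" where
  "half_h c = (\<Sum>n. hE (c + 5 * int n))"

text \<open>With z = y^c and q = y^5 this is the theta product of all (1 - z q^n)(1 - q^(n+1)/z), n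
  \<ge> 0. Where no factor vanishes, \<open>rho\<close> is its logarithmic derivative with respect
  to log z, and \<open>PP\<close> is minus the derivative of \<open>rho\<close>.\<close>

definition bt :: "int \<Rightarrow> real" where "bt c = half_prod c * half_prod (5 - c)"
definition rho :: "int \<Rightarrow> real" where "rho c = half_g (5 - c) - half_g c"
definition PP :: "int \<Rightarrow> real" where "PP c = half_h c + half_h (5 - c)"

lemma convergent_fc: "convergent_prod (\<lambda>n. fc (c + 5 * int n))"
proof -
  have "summable (\<lambda>n. norm (fc (c + 5 * int n) - 1))"
    by (rule summable_comparison_test'[OF summable_E[of c]]) (auto simp: fc_def)
  then show ?thesis
    by (intro abs_convergent_prod_imp_convergent_prod summable_imp_abs_convergent_prod)
qed

lemma half_prod_LIMSEQ: "(\<lambda>n. \<Prod>m\<le>n. fc (c + 5 * int m)) \<longlonglongrightarrow> half_prod c"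
  unfolding half_prod_def by (rule convergent_prod_LIMSEQ[OF convergent_fc])

lemma half_prod_nonzero [simp]: "half_prod c \<noteq> 0"
  unfolding half_prod_def by (intro prodinf_nonzero convergent_fc) simp

lemma bt_nonzero [simp]: "bt c \<noteq> 0" by (simp add: bt_def)

lemma half_prod_Suc: "half_prod c = fc c * half_prod (c + 5)"
proof -
  have "(\<lambda>n. \<Prod>m\<le>Suc n. fc (c + 5 * int m)) \<longlonglongrightarrow> half_prod c"
    by (rule LIMSEQ_Suc[OF half_prod_LIMSEQ])
  moreover have "(\<Prod>m\<le>Suc n. fc (c + 5 * int m)) = fc c * (\<Prod>m\<le>n. fc (c + 5 + 5 * int m))" for n
    by (subst prod.atMost_Suc_shift) (simp add: algebra_simps)
  ultimately show ?thesis
    using LIMSEQ_unique[OF _ tendsto_mult_left[OF half_prod_LIMSEQ[of "c + 5"], of "fc c"]]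
    by (simp del: prod.atMost_Suc)
qed

lemma half_g_Suc: "half_g c = gE c + half_g (c + 5)"
  unfolding half_g_def using suminf_split_head[OF summable_gE[of c]] by (simp add: algebra_simps)

lemma half_h_Suc: "half_h c = hE c + half_h (c + 5)"
  unfolding half_h_def using suminf_split_head[OF summable_hE[of c]] by (simp add: algebra_simps)

lemma bt_reflect: "bt (5 - c) = bt c" by (simp add: bt_def)
lemma rho_reflect: "rho (5 - c) = - rho c" by (simp add: rho_def)
lemma PP_reflect: "PP (5 - c) = PP c" by (simp add: PP_def)

text \<open>The functional equation theta(1/z) = -theta(z)/z; \<open>rho_minus\<close> and
  \<open>PP_minus\<close> are its logarithmic derivatives. It fails at \<open>c = 0\<close>, where
  \<open>bt\<close> omits the vanishing factor.\<close>

lemma bt_minus: "c \<noteq> 0 \<Longrightarrow> bt (- c) = - E (- c) * bt c"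
  using half_prod_Suc[of c] half_prod_Suc[of "- c"] fc_minus[of c]
  by (simp add: bt_def algebra_simps)

lemma rho_minus: "c \<noteq> 0 \<Longrightarrow> rho (- c) = 1 - rho c"
  using half_g_Suc[of c] half_g_Suc[of "- c"] gE_minus[of c]
  by (simp add: rho_def algebra_simps)

lemma PP_minus: "PP (- c) = PP c"
  using half_h_Suc[of c] half_h_Suc[of "- c"] hE_minus[of c]
  by (simp add: PP_def algebra_simps)

lemma rho_0 [simp]: "rho 0 = 0"
  using half_g_Suc[of 0] by (simp add: rho_def gE_def)

text \<open>The two lengths are independent because a symmetric range, seen from an index
  \<open>k\<close> in it, is not symmetric.\<close>

definition bt2 :: "nat \<Rightarrow> nat \<Rightarrow> int \<Rightarrow> real" where
  "bt2 u v c = (\<Prod>m\<le>u. fc (c + 5 * int m)) * (\<Prod>m<v. fc (5 - c + 5 * int m))"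

lemma bt2_nonzero [simp]: "bt2 u v c \<noteq> 0" by (simp add: bt2_def)

text \<open>The \<open>v\<close> factors of negative index are reflected by \<open>fc_minus\<close>,
  which collects the sign and the power of \<open>y\<close>. The assumption keeps the reflected
  factors away from index 0, where \<open>fc\<close> is regularized.\<close>

lemma window_prod:
  assumes "5 dvd c \<longrightarrow> c = 0"
  shows "(\<Prod>m=-int v..int u. fc (c + 5 * m)) = (-1) ^ v * E (c * int v - 5 * triangular (int v)) * bt2 u v c"
proof (induction v)
  case 0
  have "(\<Prod>m=-int 0..int u. fc (c + 5 * m)) = (\<Prod>m\<le>u. fc (c + 5 * int m))"
    by (rule prod.reindex_bij_witness[where i = int and j = nat]) auto
  then show ?case by (simp add: bt2_def triangular_def)
next
  case (Suc v)
  have ne: "5 - c + 5 * int v \<noteq> 0"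
  proof
    assume "5 - c + 5 * int v = 0"
    then have "c = 5 * (1 + int v)" by simp
    then show False using assms by (metis dvd_triv_left mult_eq_0_iff zero_neq_numeral of_nat_Suc of_nat_eq_0_iff nat.distinct(1))
  qed
  have "{-int (Suc v)..int u} = insert (- int (Suc v)) {-int v..int u}" by auto
  then have "(\<Prod>m=-int (Suc v)..int u. fc (c + 5 * m)) = fc (- (5 - c + 5 * int v)) * (\<Prod>m=-int v..int u. fc (c + 5 * m))"
    by (simp add: algebra_simps)
  also have "\<dots> = (-1) ^ Suc v * (E (- (5 - c + 5 * int v)) * E (c * int v - 5 * triangular (int v))) * bt2 u (Suc v) c"
    unfolding Suc fc_minus[OF ne] by (simp add: bt2_def)
  also have "E (- (5 - c + 5 * int v)) * E (c * int v - 5 * triangular (int v)) = E (c * int (Suc v) - 5 * triangular (int (Suc v)))"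
    unfolding E_add[symmetric]
    using two_triangular[of "int v"] two_triangular[of "int (Suc v)"]
    by (intro arg_cong[where f = E]) (simp add: algebra_simps)
  finally show ?case .
qed

text \<open>Each reflected term contributes -1 by \<open>gE_minus\<close>; this is the origin of
  \<open>- real v\<close>, and of the compensating \<open>real N\<close> in
  \<open>sum_window_rho_LIMSEQ\<close>.\<close>

lemma window_rho:
  assumes "5 dvd c \<longrightarrow> c = 0"
  shows "(\<Sum>m=-int v..int u. gE (c + 5 * m)) = (\<Sum>m\<le>u. gE (c + 5 * int m)) - (\<Sum>m<v. gE (5 - c + 5 * int m)) - real v"
proof (induction v)
  case 0
  have "(\<Sum>m=-int 0..int u. gE (c + 5 * m)) = (\<Sum>m\<le>u. gE (c + 5 * int m))"
    by (rule sum.reindex_bij_witness[where i = int and j = nat]) auto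
  then show ?case by simp
next
  case (Suc v)
  have ne: "5 - c + 5 * int v \<noteq> 0"
  proof
    assume "5 - c + 5 * int v = 0"
    then have "c = 5 * (1 + int v)" by simp
    then show False using assms by (metis dvd_triv_left mult_eq_0_iff zero_neq_numeral of_nat_Suc of_nat_eq_0_iff nat.distinct(1))
  qed
  have "{-int (Suc v)..int u} = insert (- int (Suc v)) {-int v..int u}" by auto
  then have "(\<Sum>m=-int (Suc v)..int u. gE (c + 5 * m)) = gE (- (5 - c + 5 * int v)) + (\<Sum>m=-int v..int u. gE (c + 5 * m))"
    by (simp add: algebra_simps)
  then show ?case unfolding Suc gE_minus[OF ne] by simp
qed

lemma window_PP:
  "(\<Sum>m=-int v..int u. hE (c + 5 * m)) = (\<Sum>m\<le>u. hE (c + 5 * int m)) + (\<Sum>m<v. hE (5 - c + 5 * int m))"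
proof (induction v)
  case 0
  have "(\<Sum>m=-int 0..int u. hE (c + 5 * m)) = (\<Sum>m\<le>u. hE (c + 5 * int m))"
    by (rule sum.reindex_bij_witness[where i = int and j = nat]) auto
  then show ?case by simp
next
  case (Suc v)
  have "{-int (Suc v)..int u} = insert (- int (Suc v)) {-int v..int u}" by auto
  then have "(\<Sum>m=-int (Suc v)..int u. hE (c + 5 * m)) = hE (- (5 - c + 5 * int v)) + (\<Sum>m=-int v..int u. hE (c + 5 * m))"
    by (simp add: algebra_simps)
  then show ?case unfolding Suc hE_minus by simp
qed

lemma LIMSEQ_half_lessThan:
  "(\<lambda>n. \<Prod>m<n. fc (c + 5 * int m)) \<longlonglongrightarrow> half_prod c"
  by (rule LIMSEQ_imp_Suc) (simp add: lessThan_Suc_atMost half_prod_LIMSEQ del: prod.lessThan_Suc)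

lemma filterlim_nat_shift:
  "filterlim (\<lambda>N. nat (int N - k)) sequentially sequentially"
  unfolding filterlim_at_top
proof
  fix Z :: nat
  show "\<forall>\<^sub>F N in sequentially. Z \<le> nat (int N - k)"
    using eventually_ge_at_top[of "Z + nat \<bar>k\<bar>"] by eventually_elim linarith
qed

lemma bt2_LIMSEQ: "(\<lambda>N. bt2 (nat (int N - k)) (nat (int N + k)) c) \<longlonglongrightarrow> bt c"
  unfolding bt2_def bt_def
  using filterlim_compose[OF half_prod_LIMSEQ filterlim_nat_shift[of k]]
    filterlim_compose[OF LIMSEQ_half_lessThan[of "5 - c"] filterlim_nat_shift[of "- k"]]
  by (intro tendsto_mult) simp_all

text \<open>For \<open>\<bar>c\<bar> < 5\<close> every factor except the one at \<open>c\<close>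
  itself lies in (0, 1], so the partial products decrease to a positive limit. These bounds later
  dominate \<open>kapN\<close> uniformly.\<close>

lemma bt2_bounds:
  assumes "\<bar>c\<bar> < 5"
  shows "\<exists>lo hi. lo > 0 \<and> (\<forall>u v. lo \<le> \<bar>bt2 u v c\<bar> \<and> \<bar>bt2 u v c\<bar> \<le> hi)"
proof -
  have pos: "\<exists>l>0. \<forall>n. l \<le> (\<Prod>m<n. fc (c + 5 * int m)) \<and> (\<Prod>m<n. fc (c + 5 * int m)) \<le> 1" if c: "c \<ge> 1" for c
  proof -
    have f: "0 < fc (c + 5 * int m)" "fc (c + 5 * int m) \<le> 1" for m
      using E_le_y[of "c + 5 * int m"] c y_less_1 by (auto simp: fc_def)
    have dec: "decseq (\<lambda>n. \<Prod>m<n. fc (c + 5 * int m))"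
      by (rule decseq_SucI) (use f in \<open>simp add: mult_left_le prod_nonneg less_imp_le\<close>)
    have ge: "half_prod c \<le> (\<Prod>m<n. fc (c + 5 * int m))" for n
      by (rule decseq_ge[OF dec LIMSEQ_half_lessThan])
    have "half_prod c \<ge> 0"
      by (rule LIMSEQ_le_const[OF LIMSEQ_half_lessThan]) (use f in \<open>auto intro!: exI[of _ 0] prod_nonneg simp: less_imp_le\<close>)
    then have "half_prod c > 0" using half_prod_nonzero[of c] by linarith
    moreover have "(\<Prod>m<n. fc (c + 5 * int m)) \<le> 1" for n
      using f by (intro prod_le_1) (auto intro: less_imp_le)
    ultimately show ?thesis using ge by blast
  qed
  obtain l1 where l1: "l1 > 0" "\<And>n. l1 \<le> (\<Prod>m<n. fc (c + 5 + 5 * int m))" "\<And>n. (\<Prod>m<n. fc (c + 5 + 5 * int m)) \<le> 1"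
    using pos[of "c + 5"] assms by (auto simp: abs_less_iff)
  obtain l2 where l2: "l2 > 0" "\<And>n. l2 \<le> (\<Prod>m<n. fc (5 - c + 5 * int m))" "\<And>n. (\<Prod>m<n. fc (5 - c + 5 * int m)) \<le> 1"
    using pos[of "5 - c"] assms by (auto simp: abs_less_iff)
  have eq: "\<bar>bt2 u v c\<bar> = \<bar>fc c\<bar> * ((\<Prod>m<u. fc (c + 5 + 5 * int m)) * (\<Prod>m<v. fc (5 - c + 5 * int m)))" for u v
  proof -
    have "(\<Prod>m\<le>u. fc (c + 5 * int m)) = fc c * (\<Prod>m<u. fc (c + 5 + 5 * int m))"
      by (subst prod.atMost_shift) (simp add: algebra_simps)
    moreover have "(\<Prod>m<u. fc (c + 5 + 5 * int m)) > 0" "(\<Prod>m<v. fc (5 - c + 5 * int m)) > 0"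
      using l1 l2 by (meson less_le_trans)+
    ultimately show ?thesis by (simp add: bt2_def abs_mult)
  qed
  have "\<bar>fc c\<bar> * (l1 * l2) \<le> \<bar>bt2 u v c\<bar>" "\<bar>bt2 u v c\<bar> \<le> \<bar>fc c\<bar> * (1 * 1)" for u v
    unfolding eq using l1 l2 by (intro mult_left_mono mult_mono; meson abs_ge_zero less_imp_le order_trans zero_le_one)+
  moreover have "\<bar>fc c\<bar> * (l1 * l2) > 0" using l1 l2 by simp
  ultimately show ?thesis by blast
qed

lemma sum_window_rho_LIMSEQ:
  assumes "5 dvd c \<longrightarrow> c = 0"
  shows "(\<lambda>N. - (\<Sum>m=-int N..int N. gE (c + 5 * m)) - real N) \<longlonglongrightarrow> rho c"
proof -
  have "(\<lambda>N. (\<Sum>m<N. gE (5 - c + 5 * int m)) - (\<Sum>m\<le>N. gE (c + 5 * int m))) \<longlonglongrightarrow> half_g (5 - c) - half_g c"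
    unfolding half_g_def by (intro tendsto_diff summable_LIMSEQ summable_LIMSEQ' summable_gE)
  then show ?thesis unfolding window_rho[OF assms] rho_def by simp
qed

lemma sum_window_PP_LIMSEQ: "(\<lambda>N. \<Sum>m=-int N..int N. hE (c + 5 * m)) \<longlonglongrightarrow> PP c"
  unfolding window_PP PP_def half_h_def
  by (intro tendsto_add summable_LIMSEQ summable_LIMSEQ' summable_hE)

lemma summable_int_power: "(\<lambda>k::int. y ^ nat \<bar>k\<bar>) summable_on UNIV"
proof -
  have n: "(\<lambda>n. y ^ n) summable_on (UNIV :: nat set)"
    using summable_y y_pos by (intro norm_summable_imp_summable_on) simp
  have "(\<lambda>k::int. y ^ nat \<bar>k\<bar>) summable_on range int"
    by (subst summable_on_reindex) (auto simp: comp_def n)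
  moreover have "(\<lambda>k::int. y ^ nat \<bar>k\<bar>) summable_on range (\<lambda>n. - int n)"
    by (subst summable_on_reindex) (auto simp: comp_def n inj_on_def)
  moreover have "UNIV = range int \<union> range (\<lambda>n. - int n)"
    by (auto simp: image_iff) (metis int_cases2)
  ultimately show ?thesis by (metis summable_on_union)
qed

lemma summable_quadratic:
  assumes "d \<ge> 1"
  shows "(\<lambda>k. E (k * \<omega> + 5 * int d * triangular k)) summable_on UNIV"
proof -
  \<comment> \<open>Chosen so that, on expanding the square of \<open>\<bar>k\<bar> - u\<close>, the
    mixed term covers both \<open>k * \<omega>\<close> and the linear part of the triangular
    number.\<close>
  define u where "u = \<bar>\<omega>\<bar> + 4"
  have bound: "k * \<omega> + 5 * int d * triangular k \<ge> \<bar>k\<bar> - u\<^sup>2" for k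
  proof -
    have "k * (k + 1) \<ge> 0" by (cases "k \<ge> 0") (auto intro: mult_nonpos_nonpos)
    then have tri: "triangular k \<ge> 0" using two_triangular[of k] by simp
    have "5 * int d * triangular k \<ge> 5 * 1 * triangular k"
      using assms tri by (intro mult_right_mono mult_left_mono) auto
    then have 1: "2 * (5 * int d * triangular k) \<ge> 5 * (k * (k + 1))"
      using two_triangular[of k] by simp
    have 2: "k * \<omega> \<ge> - (\<bar>k\<bar> * \<bar>\<omega>\<bar>)" by (metis abs_ge_minus_self abs_mult minus_le_iff)
    have 3: "k \<ge> - \<bar>k\<bar>" by simp
    have "\<bar>k\<bar> * \<bar>k\<bar> = k * k" by (simp add: abs_mult_self_eq)
    moreover have "(\<bar>k\<bar> - u)\<^sup>2 \<ge> 0" by simp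
    ultimately have "k * k + u\<^sup>2 \<ge> 2 * (\<bar>k\<bar> * u)"
      by (simp add: power2_eq_square algebra_simps)
    moreover have "\<bar>k\<bar> * u = \<bar>k\<bar> * \<bar>\<omega>\<bar> + 4 * \<bar>k\<bar>" by (simp add: u_def algebra_simps)
    moreover have "k * k \<ge> 0" by simp
    moreover have "k * (k + 1) = k * k + k" by (simp add: algebra_simps)
    moreover have "u\<^sup>2 \<ge> 0" by simp
    ultimately show ?thesis using 1 2 3 by linarith
  qed
  show ?thesis
  proof (rule summable_on_comparison_test)
    show "(\<lambda>k::int. E (- u\<^sup>2) * y ^ nat \<bar>k\<bar>) summable_on UNIV"
      by (intro summable_on_cmult_right summable_int_power)
    show "E (k * \<omega> + 5 * int d * triangular k) \<le> E (- u\<^sup>2) * y ^ nat \<bar>k\<bar>" for k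
      using E_le[OF bound[of k]] E_add[of "- u\<^sup>2" "\<bar>k\<bar>"] E_nat[of "nat \<bar>k\<bar>"] by simp
  qed auto
qed

end

section \<open>Bilateral partial fractions\<close>

context nome begin

lemma E_sum: "finite C \<Longrightarrow> E (\<Sum>c\<in>C. g c) = (\<Prod>c\<in>C. E (g c))"
  by (induction C rule: finite_induct) (auto simp: E_add)

text \<open>Seen from \<open>c0 + 5 * k\<close>, the range from -N to N becomes the window from -(N
  + k) to N - k, and \<open>window_prod\<close> applies to each class \<open>c\<close>.\<close>

lemma prod_box_fc:
  assumes C: "finite C" "\<And>c. c \<in> C \<Longrightarrow> 5 dvd c - c0 \<Longrightarrow> c = c0" and k: "\<bar>k\<bar> \<le> int N"
  shows "(\<Prod>(c,l)\<in>C\<times>{-int N..int N}. fc (c + 5 * l - (c0 + 5 * k))) =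
    ((-1) ^ nat (int N + k) * E (- 5 * triangular (int N + k))) ^ card C
     * E ((int N + k) * (\<Sum>C - int (card C) * c0)) * (\<Prod>c\<in>C. bt2 (nat (int N - k)) (nat (int N + k)) (c - c0))"
proof -
  define u where "u = nat (int N - k)"
  define v where "v = nat (int N + k)"
  have uv: "int u = int N - k" "int v = int N + k" using k by (auto simp: u_def v_def)
  have "(\<Prod>(c,l)\<in>C\<times>{-int N..int N}. fc (c + 5 * l - (c0 + 5 * k))) =
      (\<Prod>c\<in>C. \<Prod>l=-int N..int N. fc (c + 5 * l - (c0 + 5 * k)))"
    by (simp add: prod.cartesian_product)
  also have "\<dots> = (\<Prod>c\<in>C. ((-1) ^ v * E (- 5 * triangular (int v))) * E (int v * (c - c0)) * bt2 u v (c - c0))"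
  proof (rule prod.cong[OF refl])
    fix c assume c: "c \<in> C"
    have "(\<Prod>l=-int N..int N. fc (c + 5 * l - (c0 + 5 * k))) = (\<Prod>m=-int v..int u. fc (c - c0 + 5 * m))"
      by (rule prod.reindex_bij_witness[where i = "\<lambda>m. m + k" and j = "\<lambda>l. l - k"])
        (auto simp: uv algebra_simps)
    also have "\<dots> = (-1) ^ v * E ((c - c0) * int v - 5 * triangular (int v)) * bt2 u v (c - c0)"
      by (rule window_prod) (use C(2)[OF c] in auto)
    also have "E ((c - c0) * int v - 5 * triangular (int v)) = E (- 5 * triangular (int v)) * E (int v * (c - c0))"
      unfolding E_add[symmetric] by (simp add: mult.commute)
    finally show "(\<Prod>l=-int N..int N. fc (c + 5 * l - (c0 + 5 * k))) =
      ((-1) ^ v * E (- 5 * triangular (int v))) * E (int v * (c - c0)) * bt2 u v (c - c0)"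
      by (simp only: mult_ac)
  qed
  also have "\<dots> = ((-1) ^ v * E (- 5 * triangular (int v))) ^ card C * (\<Prod>c\<in>C. E (int v * (c - c0))) * (\<Prod>c\<in>C. bt2 u v (c - c0))"
    by (simp add: prod.distrib)
  also have "(\<Prod>c\<in>C. E (int v * (c - c0))) = E (int v * (\<Sum>C - int (card C) * c0))"
    by (simp add: E_sum[OF C(1), symmetric] sum_distrib_left[symmetric] sum_subtractf)
  finally show ?thesis unfolding uv unfolding u_def v_def .
qed

end

text \<open>\<open>A\<close> and \<open>B\<close> index the zeros and poles of a theta quotient in x
  with nome y^5. Differences with elements of \<open>B\<close> stay below 5 in absolute value, so
  distinct indices there are incongruent modulo 5 and \<open>bt2_bounds\<close> applies.\<close>

locale partial_fractions = nome +
  fixes A B :: "int set"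
  assumes finite_A: "finite A" and finite_B: "finite B" and card_less: "card A < card B"
    and A_range: "\<And>a. a \<in> A \<Longrightarrow> a \<noteq> 0 \<and> \<bar>a\<bar> < 5" and B_range: "\<And>b. b \<in> B \<Longrightarrow> \<bar>b\<bar> < 5"
    and AB: "\<And>a b. a \<in> A \<Longrightarrow> b \<in> B \<Longrightarrow> a \<noteq> b \<and> \<bar>a - b\<bar> < 5"
    and BB: "\<And>b b'. b \<in> B \<Longrightarrow> b' \<in> B \<Longrightarrow> \<bar>b - b'\<bar> < 5"
begin

definition d :: nat where "d = card B - card A"
definition S :: int where "S = \<Sum>A - \<Sum>B"
definition sg :: real where "sg = (-1) ^ d"
text \<open>By quasi-periodicity the residue data at the poles \<open>b + 5 * k\<close> of one class
  differ from \<open>kap b\<close> only by this factor. In the truncation \<open>kap b\<close> is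
  replaced by \<open>kapN N b k\<close>.\<close>

definition wt :: "int \<Rightarrow> int \<Rightarrow> real" where
  "wt b k = sg powi k * E (k * (S + int d * b) + 5 * int d * triangular k)"
definition kapN :: "nat \<Rightarrow> int \<Rightarrow> int \<Rightarrow> real" where
  "kapN N b k = (\<Prod>a\<in>A. bt2 (nat (int N - k)) (nat (int N + k)) (a - b)) / (\<Prod>b'\<in>B. bt2 (nat (int N - k)) (nat (int N + k)) (b' - b))"
definition kap :: "int \<Rightarrow> real" where
  "kap b = (\<Prod>a\<in>A. bt (a - b)) / (\<Prod>b'\<in>B. bt (b' - b))"
definition Lam :: real where "Lam = (\<Sum>a\<in>A. rho a) - (\<Sum>b\<in>B. rho b)"
definition H :: real where "H = (\<Sum>a\<in>A. PP a) - (\<Sum>b\<in>B. PP b)"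
definition T0 :: "int \<Rightarrow> real" where "T0 b = (\<Sum>\<^sub>\<infinity>k. wt b k * psi (b + 5 * k))"
definition T1 :: "int \<Rightarrow> real" where "T1 b = (\<Sum>\<^sub>\<infinity>k. wt b k * hE (b + 5 * k))"

lemma d_ge_1: "d \<ge> 1" using card_less by (simp add: d_def)
lemma card_B: "card B = card A + d" using card_less by (simp add: d_def)
lemma sg_cases: "sg = 1 \<or> sg = -1" by (simp add: sg_def neg_one_even_power neg_one_odd_power) (metis neg_one_even_power neg_one_odd_power)
lemma sg_nz: "sg \<noteq> 0" using sg_cases by auto

text \<open>This constant and the power x^(d N) in \<open>hp\<close> undo the signs and powers
  created by reflecting factors of negative index; thereby the values at x = 1 converge.\<close>

abbreviation "KK N \<equiv> sg ^ N * E (- int N * S - 5 * int d * triangular (int N))"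
abbreviation "II N \<equiv> B \<times> {-int N..int N}"
abbreviation "JJ N \<equiv> A \<times> {-int N..int N}"
abbreviation "be \<equiv> \<lambda>(b,k). E (b + 5 * k)"

definition hp :: "nat \<Rightarrow> real poly" where
  "hp N = smult (KK N) (monom 1 (d * N) * (\<Prod>j\<in>JJ N. [:1, - be j:]))"

lemma poly_hp: "poly (hp N) x = KK N * x ^ (d * N) * (\<Prod>j\<in>JJ N. 1 - be j * x)"
  by (simp add: hp_def poly_monom poly_prod mult.commute mult.left_commute)

lemma finite_II: "finite (II N)" and finite_JJ: "finite (JJ N)"
  using finite_A finite_B by auto

text \<open>d N + (2N + 1) card A < (2N + 1) card B, because d = card B - card A is
  positive.\<close>

lemma degree_hp: "degree (hp N) < card (II N)"
proof -
  have "degree (\<Prod>j\<in>JJ N. [:1, - be j:]) \<le> card (JJ N)"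
  proof -
    have "degree (\<Prod>j\<in>JJ N. [:1, - be j:]) \<le> (\<Sum>j\<in>JJ N. degree [:1, - be j:])"
      using degree_prod_sum_le[OF finite_JJ, of "\<lambda>j. [:1, - be j:]" N] unfolding comp_def .
    also have "\<dots> \<le> (\<Sum>j\<in>JJ N. 1)" by (rule sum_mono) (auto split: prod.splits)
    finally show ?thesis by simp
  qed
  then have "degree (hp N) \<le> d * N + card (JJ N)"
    unfolding hp_def
    by (meson add_mono degree_monom_le degree_mult_le degree_smult_le order_trans)
  also have "\<dots> < card (II N)"
    using d_ge_1 by (simp add: card_cartesian_product card_B algebra_simps)
  finally show ?thesis .
qed

lemma dvd_5_B: "b \<in> B \<Longrightarrow> b' \<in> B \<Longrightarrow> 5 dvd b - b' \<Longrightarrow> b = b'"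
  using BB[of b b'] dvd_imp_le_int[of "b - b'" 5] by auto

lemma dvd_5_A: "a \<in> A \<Longrightarrow> b \<in> B \<Longrightarrow> 5 dvd a - b \<Longrightarrow> a = b"
  using AB[of a b] dvd_imp_le_int[of "a - b" 5] by auto

lemma dvd_5_A0: "a \<in> A \<Longrightarrow> \<not> 5 dvd a"
  using A_range[of a] dvd_imp_le_int[of a 5] by auto

lemma dvd_5_B0: "b \<in> B \<Longrightarrow> 5 dvd b \<Longrightarrow> b = 0"
  using B_range[of b] dvd_imp_le_int[of b 5] by auto

lemma inj_be: "inj_on be (II N)"
proof (rule inj_onI, clarify)
  fix b k b' k' assume *: "b \<in> B" "b' \<in> B" "E (b + 5 * k) = E (b' + 5 * k')"
  then have eq: "b - b' = 5 * (k' - k)" by (simp add: E_inj algebra_simps)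
  then have "b = b'" using * dvd_5_B by (metis dvd_triv_left)
  then show "b = b' \<and> k = k'" using eq by simp
qed

definition cc :: "nat \<Rightarrow> int \<times> int \<Rightarrow> real" where
  "cc N i = poly (hp N) (1 / be i) / (\<Prod>j\<in>II N - {i}. 1 - be j / be i)"

lemma sg_ratio:
  assumes "\<bar>k\<bar> \<le> int N"
  shows "sg ^ N / ((-1) ^ nat (int N + k)) ^ d = sg powi k"
proof -
  have "((-1::real) ^ nat (int N + k)) ^ d = sg ^ nat (int N + k)"
    unfolding sg_def by (metis power_mult mult.commute)
  also have "\<dots> = sg powi (int N + k)"
    using assms by (simp add: power_int_def)
  also have "\<dots> = sg ^ N * sg powi k"
    using sg_nz by (simp add: power_int_add)
  finally have "sg ^ N / ((-1) ^ nat (int N + k)) ^ d = 1 / sg powi k"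
    using sg_nz by simp
  also have "\<dots> = sg powi k"
    using sg_cases by (auto simp: power_int_minus_left) (simp add: power_int_def power_inverse)?
  finally show ?thesis .
qed

lemma product_ratio:
  assumes k: "\<bar>k\<bar> \<le> int N" and b: "b \<in> B \<or> b = 0 \<and> k = 0"
  shows "KK N * E (- ((b + 5 * k) * int (d * N))) *
     (\<Prod>(a,l)\<in>JJ N. fc (a + 5 * l - (b + 5 * k))) / (\<Prod>(b',l)\<in>II N. fc (b' + 5 * l - (b + 5 * k)))
     = wt b k * kapN N b k"
proof -
  let ?v = "int N + k"
  let ?X = "(-1) ^ nat ?v * E (- 5 * triangular ?v)"
  let ?PA = "\<Prod>a\<in>A. bt2 (nat (int N - k)) (nat ?v) (a - b)" and ?PB = "\<Prod>b'\<in>B. bt2 (nat (int N - k)) (nat ?v) (b' - b)"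
  have A: "(\<Prod>(a,l)\<in>JJ N. fc (a + 5 * l - (b + 5 * k))) = ?X ^ card A * E (?v * (\<Sum>A - int (card A) * b)) * ?PA"
    by (rule prod_box_fc[OF finite_A _ k]) (use b dvd_5_A dvd_5_A0 in auto)
  have B: "(\<Prod>(b',l)\<in>II N. fc (b' + 5 * l - (b + 5 * k))) = ?X ^ card B * E (?v * (\<Sum>B - int (card B) * b)) * ?PB"
    by (rule prod_box_fc[OF finite_B _ k]) (use b dvd_5_B dvd_5_B0 in auto)
  have X: "?X ^ card B = ?X ^ card A * ?X ^ d" by (simp add: card_B power_add)
  have Xd: "?X ^ d = ((-1) ^ nat ?v) ^ d * E (- 5 * int d * triangular ?v)"
    by (simp add: power_mult_distrib E_power mult_ac)
  have nz: "?X \<noteq> 0" "?PB \<noteq> 0" using finite_B by auto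
  have "KK N * E (- ((b + 5 * k) * int (d * N))) * (?X ^ card A * E (?v * (\<Sum>A - int (card A) * b)) * ?PA)
      / (?X ^ card B * E (?v * (\<Sum>B - int (card B) * b)) * ?PB) =
     (sg ^ N / ((-1) ^ nat ?v) ^ d) * (E (- int N * S - 5 * int d * triangular (int N)) * E (- ((b + 5 * k) * int (d * N)))
       * E (?v * (\<Sum>A - int (card A) * b)) / E (?v * (\<Sum>B - int (card B) * b)) / E (- 5 * int d * triangular ?v)) * (?PA / ?PB)"
    using nz unfolding X Xd by (simp add: field_simps)
  also have "E (- int N * S - 5 * int d * triangular (int N)) * E (- ((b + 5 * k) * int (d * N)))
       * E (?v * (\<Sum>A - int (card A) * b)) / E (?v * (\<Sum>B - int (card B) * b)) / E (- 5 * int d * triangular ?v)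
     = E (k * (S + int d * b) + 5 * int d * triangular k)"
    unfolding E_add[symmetric] E_diff[symmetric]
  proof (rule arg_cong[where f = E])
    have t: "triangular ?v = triangular (int N) + triangular k + int N * k"
      using two_triangular[of ?v] two_triangular[of "int N"] two_triangular[of k] by (simp add: algebra_simps)
    have c: "int (card B) = int (card A) + int d" by (simp add: card_B)
    show "- int N * S - 5 * int d * triangular (int N) + - ((b + 5 * k) * int (d * N)) + ?v * (\<Sum>A - int (card A) * b)
       - ?v * (\<Sum>B - int (card B) * b) - - 5 * int d * triangular ?v = k * (S + int d * b) + 5 * int d * triangular k"
      unfolding t c S_def by (simp add: algebra_simps)
  qed
  finally show ?thesis
    unfolding A B sg_ratio[OF k] by (simp add: wt_def kapN_def)
qed

lemma cc_eq:
  assumes b: "b \<in> B" and k: "\<bar>k\<bar> \<le> int N"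
  shows "cc N (b, k) = wt b k * kapN N b k"
proof -
  have fcE: "1 - E i / E j = fc (i - j)" if "i \<noteq> j" for i j
    using that by (simp add: fc_def E_diff)
  have J: "(\<Prod>j\<in>JJ N. 1 - be j * (1 / E (b + 5 * k))) = (\<Prod>(a,l)\<in>JJ N. fc (a + 5 * l - (b + 5 * k)))"
  proof (rule prod.cong[OF refl], clarify)
    fix a l assume a: "a \<in> A"
    have "a + 5 * l \<noteq> b + 5 * k"
    proof
      assume "a + 5 * l = b + 5 * k"
      then have "a - b = 5 * (k - l)" by simp
      then have "5 dvd a - b" by simp
      then show False using dvd_5_A[OF a b] AB[OF a b] by simp
    qed
    then show "1 - E (a + 5 * l) * (1 / E (b + 5 * k)) = fc (a + 5 * l - (b + 5 * k))"
      using fcE by simp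
  qed
  have "(\<Prod>j\<in>II N - {(b,k)}. 1 - be j / E (b + 5 * k)) = (\<Prod>(b',l)\<in>II N - {(b,k)}. fc (b' + 5 * l - (b + 5 * k)))"
  proof (rule prod.cong[OF refl])
    fix j assume j: "j \<in> II N - {(b,k)}"
    obtain b' l where bl: "j = (b', l)" by (cases j)
    have "be j \<noteq> be (b, k)" using inj_be[of N] j b k unfolding inj_on_def by fastforce
    then show "1 - be j / E (b + 5 * k) = (case j of (b', l) \<Rightarrow> fc (b' + 5 * l - (b + 5 * k)))"
      unfolding bl using fcE by (auto simp: E_inj)
  qed
  also have "\<dots> = (\<Prod>(b',l)\<in>II N. fc (b' + 5 * l - (b + 5 * k)))"
    using b k finite_II by (subst prod.remove[OF finite_II, of "(b,k)"]) (auto simp: fc_def)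
  finally have I: "(\<Prod>j\<in>II N - {(b,k)}. 1 - be j / E (b + 5 * k)) = (\<Prod>(b',l)\<in>II N. fc (b' + 5 * l - (b + 5 * k)))" .
  have P: "(1 / E (b + 5 * k)) ^ (d * N) = E (- ((b + 5 * k) * int (d * N)))"
    by (simp add: E_minus E_power power_one_over inverse_eq_divide)
  have "cc N (b, k) = KK N * E (- ((b + 5 * k) * int (d * N))) *
     (\<Prod>(a,l)\<in>JJ N. fc (a + 5 * l - (b + 5 * k))) / (\<Prod>(b',l)\<in>II N. fc (b' + 5 * l - (b + 5 * k)))"
    unfolding cc_def prod.case poly_hp J I P by simp
  then show ?thesis using product_ratio[OF k, of b] b by simp
qed

definition FN :: "nat \<Rightarrow> real" where
  "FN N = (\<Prod>a\<in>A. bt2 N N a) / (\<Prod>b\<in>B. bt2 N N b)"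
definition LN :: "nat \<Rightarrow> real" where
  "LN N = real (d * N) - (\<Sum>(a,k)\<in>JJ N. gE (a + 5 * k)) + (\<Sum>(b,k)\<in>II N. gE (b + 5 * k))"
definition HN :: "nat \<Rightarrow> real" where
  "HN N = (\<Sum>(a,k)\<in>JJ N. hE (a + 5 * k)) - (\<Sum>(b,k)\<in>II N. hE (b + 5 * k))"

lemma be_ne_1: "j \<in> II N - {(0,0)} \<Longrightarrow> be j \<noteq> 1"
proof (cases j)
  case (Pair b k)
  assume j: "j \<in> II N - {(0,0)}"
  have "b + 5 * k \<noteq> 0"
  proof
    assume "b + 5 * k = 0"
    then have "b = 5 * (- k)" by simp
    then have "5 dvd b" by (metis dvd_triv_left)
    then show False using dvd_5_B0 j Pair \<open>b + 5 * k = 0\<close> by auto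
  qed
  then show ?thesis using Pair by simp
qed

lemma al_ne_1: "j \<in> JJ N \<Longrightarrow> be j \<noteq> 1"
proof (cases j)
  case (Pair a k)
  assume j: "j \<in> JJ N"
  have "a + 5 * k \<noteq> 0"
  proof
    assume "a + 5 * k = 0"
    then have "a = 5 * (- k)" by simp
    then have "5 dvd a" by (metis dvd_triv_left)
    then show False using dvd_5_A0 j Pair by auto
  qed
  then show ?thesis using Pair by simp
qed

lemma finite_identity:
  defines "w \<equiv> \<lambda>N b k. wt b k * kapN N b k"
  shows "0 \<notin> B \<Longrightarrow> (\<Sum>b\<in>B. \<Sum>k=-int N..int N. w N b k * psi (b + 5 * k)) = FN N"
    and "0 \<notin> B \<Longrightarrow> (\<Sum>b\<in>B. \<Sum>k=-int N..int N. w N b k * hE (b + 5 * k)) = FN N * LN N"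
    and "0 \<in> B \<Longrightarrow> (\<Sum>b\<in>B. \<Sum>k=-int N..int N. w N b k * psi (b + 5 * k)) = - FN N * LN N"
    and "0 \<in> B \<Longrightarrow> (\<Sum>b\<in>B. \<Sum>k=-int N..int N. w N b k * hE (b + 5 * k)) = - (1/2) * FN N * ((LN N)\<^sup>2 - LN N - HN N)"
proof -
  \<comment> \<open>With the index (0,0) removed, x = 1 is a regular point whether or not 0 belongs
    to \<open>B\<close>.\<close>
  define I where "I = II N - {(0,0)}"
  interpret R: rational_product "KK N" "d * N" "JJ N" be I be
    by unfold_locales (use be_ne_1 al_ne_1 finite_II finite_JJ in \<open>auto simp: I_def\<close>)
  have fI: "finite I" using finite_II by (simp add: I_def)
  have fE: "fc i = 1 - E i" if "i \<noteq> 0" for i using that by (simp add: fc_def)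
  have f1: "R.f 1 = FN N"
  proof -
    have "(\<Prod>j\<in>JJ N. 1 - be j * 1) = (\<Prod>(a,l)\<in>JJ N. fc (a + 5 * l - (0 + 5 * 0)))"
      by (rule prod.cong[OF refl]) (use al_ne_1 in \<open>auto simp: fc_def\<close>)
    moreover have "(\<Prod>j\<in>I. 1 - be j * 1) = (\<Prod>(b,l)\<in>II N. fc (b + 5 * l - (0 + 5 * 0)))"
    proof (rule prod.mono_neutral_cong_left)
      show "1 - be j * 1 = (case j of (b, l) \<Rightarrow> fc (b + 5 * l - (0 + 5 * 0)))" if "j \<in> I" for j
        using be_ne_1[of j N] that by (cases j) (auto simp: fc_def I_def)
    qed (use finite_II in \<open>auto simp: fc_def I_def\<close>)
    ultimately have "R.f 1 = wt 0 0 * kapN N 0 0"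
      unfolding R.f_def using product_ratio[of 0 N 0] by simp
    then show ?thesis by (simp add: wt_def triangular_def kapN_def FN_def)
  qed
  have sumI: "(\<Sum>j\<in>I. g j) = (\<Sum>(b,k)\<in>II N. g (b,k))" if "g (0,0) = 0" for g :: "int \<times> int \<Rightarrow> real"
    unfolding I_def by (rule sum.mono_neutral_cong_left) (use finite_II that in auto)
  have L1: "R.L 1 = LN N"
  proof -
    have "(\<Sum>j\<in>JJ N. be j / (1 - be j * 1)) = (\<Sum>(a,k)\<in>JJ N. gE (a + 5 * k))"
      by (rule sum.cong[OF refl]) (auto simp: gE_def)
    moreover have "(\<Sum>j\<in>I. be j / (1 - be j * 1)) = (\<Sum>(b,k)\<in>I. gE (b + 5 * k))"
      by (rule sum.cong[OF refl]) (auto simp: gE_def)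
    ultimately show ?thesis
      unfolding R.L_def using sumI[of "\<lambda>(b,k). gE (b + 5 * k)"] by (simp add: LN_def gE_def)
  qed
  have psi_eq: "psi j = 1 / (1 - E j)" and hE_eq: "hE j = E j / (1 - E j)\<^sup>2" for j
    by (simp_all add: psi_def hE_def)
  have gE_eq: "E j / (1 - E j) = gE j" for j by (simp add: gE_def)
  have L2: "- real (d * N) - (\<Sum>j\<in>JJ N. (be j / (1 - be j))\<^sup>2) + (\<Sum>i\<in>I. (be i / (1 - be i))\<^sup>2) = - LN N - HN N"
  proof -
    have "(\<Sum>j\<in>JJ N. (be j / (1 - be j))\<^sup>2) = (\<Sum>(a,k)\<in>JJ N. hE (a + 5 * k) - gE (a + 5 * k))"
      by (rule sum.cong[OF refl]) (auto simp: gE_eq gE_square)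
    moreover have "(\<Sum>j\<in>I. (be j / (1 - be j))\<^sup>2) = (\<Sum>(b,k)\<in>I. hE (b + 5 * k) - gE (b + 5 * k))"
      by (rule sum.cong[OF refl]) (auto simp: gE_eq gE_square)
    moreover have "(\<Sum>(b,k)\<in>I. hE (b + 5 * k) - gE (b + 5 * k)) = (\<Sum>(b,k)\<in>II N. hE (b + 5 * k) - gE (b + 5 * k))"
      unfolding I_def
      by (rule sum.mono_neutral_cong_left) (use finite_II in \<open>auto simp: hE_def gE_def\<close>)
    ultimately show ?thesis
      by (simp add: LN_def HN_def case_prod_unfold sum_subtractf)
  qed
  have PF: "poly (hp N) x = (\<Sum>i\<in>II N. cc N i * (\<Prod>j\<in>II N - {i}. 1 - be j * x))" for x
    unfolding cc_def by (rule partial_fraction_identity[OF finite_II inj_be _ degree_hp]) auto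
  have Rf: "R.f x = poly (hp N) x / (\<Prod>j\<in>I. 1 - be j * x)" for x
    unfolding R.f_def poly_hp by simp
  have nzU: "1 - be j * x \<noteq> 0" if "x \<in> R.U" "j \<in> I" for x j
    using that by (auto simp: R.U_def)
  have psi_sum: "(\<Sum>i\<in>I. cc N i / (1 - be i)) = (\<Sum>b\<in>B. \<Sum>k=-int N..int N. w N b k * psi (b + 5 * k))"
  proof -
    have "(\<Sum>i\<in>I. cc N i / (1 - be i)) = (\<Sum>(b,k)\<in>I. w N b k * psi (b + 5 * k))"
      by (rule sum.cong[OF refl]) (auto simp: I_def psi_eq cc_eq w_def)
    also have "\<dots> = (\<Sum>(b,k)\<in>II N. w N b k * psi (b + 5 * k))"
      using sumI[of "\<lambda>(b,k). w N b k * psi (b + 5 * k)"] by (simp add: psi_def)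
    finally show ?thesis by (simp add: sum.cartesian_product)
  qed
  have h_sum: "(\<Sum>i\<in>I. cc N i * be i / (1 - be i)\<^sup>2) = (\<Sum>b\<in>B. \<Sum>k=-int N..int N. w N b k * hE (b + 5 * k))"
  proof -
    have "(\<Sum>i\<in>I. cc N i * be i / (1 - be i)\<^sup>2) = (\<Sum>(b,k)\<in>I. w N b k * hE (b + 5 * k))"
      by (rule sum.cong[OF refl]) (auto simp: I_def hE_eq cc_eq w_def)
    also have "\<dots> = (\<Sum>(b,k)\<in>II N. w N b k * hE (b + 5 * k))"
      using sumI[of "\<lambda>(b,k). w N b k * hE (b + 5 * k)"] by (simp add: hE_def)
    finally show ?thesis by (simp add: sum.cartesian_product)
  qed
  {
    assume "0 \<notin> B"
    then have I_eq: "I = II N" by (auto simp: I_def)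
    have eq: "R.f x = (\<Sum>i\<in>I. cc N i / (1 - be i * x))" if x: "x \<in> R.U" for x
      unfolding Rf PF I_eq[symmetric] sum_divide_distrib
    proof (rule sum.cong[OF refl])
      fix i assume i: "i \<in> I"
      have "(\<Prod>j\<in>I. 1 - be j * x) = (1 - be i * x) * (\<Prod>j\<in>I - {i}. 1 - be j * x)"
        using fI i by (rule prod.remove)
      moreover have "(\<Prod>j\<in>I - {i}. 1 - be j * x) \<noteq> 0"
        using nzU[OF x] fI by auto
      ultimately show "cc N i * (\<Prod>j\<in>I - {i}. 1 - be j * x) / (\<Prod>j\<in>I. 1 - be j * x) = cc N i / (1 - be i * x)"
        by simp
    qed
    show "(\<Sum>b\<in>B. \<Sum>k=-int N..int N. w N b k * psi (b + 5 * k)) = FN N"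
      using eq[OF R.one_in_U] f1 psi_sum by simp
    show "(\<Sum>b\<in>B. \<Sum>k=-int N..int N. w N b k * hE (b + 5 * k)) = FN N * LN N"
      using R.first_order[OF eq] f1 h_sum L1 by simp
  }
  {
    assume "0 \<in> B"
    then have z: "(0,0) \<in> II N" by simp
    \<comment> \<open>Dividing the polynomial identity by the factors in \<open>I\<close> alone
      leaves a factor 1 - x on every term except that of the removed pole.\<close>
    have eq': "R.f x = cc N (0,0) + (1 - x) * (\<Sum>i\<in>I. cc N i / (1 - be i * x))" if x: "x \<in> R.U" for x
    proof -
      have nz: "(\<Prod>j\<in>I. 1 - be j * x) \<noteq> 0" using nzU[OF x] fI by auto
      have "poly (hp N) x = cc N (0,0) * (\<Prod>j\<in>I. 1 - be j * x) + (\<Sum>i\<in>I. cc N i * (\<Prod>j\<in>II N - {i}. 1 - be j * x))"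
        unfolding PF I_def by (rule sum.remove[OF finite_II z])
      also have "(\<Sum>i\<in>I. cc N i * (\<Prod>j\<in>II N - {i}. 1 - be j * x)) =
          (\<Sum>i\<in>I. (1 - x) * (cc N i / (1 - be i * x)) * (\<Prod>j\<in>I. 1 - be j * x))"
      proof (rule sum.cong[OF refl])
        fix i assume i: "i \<in> I"
        have "II N - {i} = insert (0,0) (I - {i})" using z i by (auto simp: I_def)
        then have "(\<Prod>j\<in>II N - {i}. 1 - be j * x) = (1 - x) * (\<Prod>j\<in>I - {i}. 1 - be j * x)"
          using fI by (simp add: I_def)
        moreover have "(\<Prod>j\<in>I. 1 - be j * x) = (1 - be i * x) * (\<Prod>j\<in>I - {i}. 1 - be j * x)"
          using fI i by (rule prod.remove)
        ultimately show "cc N i * (\<Prod>j\<in>II N - {i}. 1 - be j * x) = (1 - x) * (cc N i / (1 - be i * x)) * (\<Prod>j\<in>I. 1 - be j * x)"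
          using nzU[OF x i] by simp
      qed
      also have "\<dots> = (1 - x) * (\<Sum>i\<in>I. cc N i / (1 - be i * x)) * (\<Prod>j\<in>I. 1 - be j * x)"
        by (simp add: sum_distrib_left sum_distrib_right mult.assoc)
      finally show ?thesis
        unfolding Rf using nz by (simp add: field_simps)
    qed
    have "R.f 1 = cc N (0,0)" using eq'[OF R.one_in_U] by simp
    then have eq: "R.f x = R.f 1 + (1 - x) * (\<Sum>i\<in>I. cc N i / (1 - be i * x))" if "x \<in> R.U" for x
      using eq'[OF that] by simp
    show "(\<Sum>b\<in>B. \<Sum>k=-int N..int N. w N b k * psi (b + 5 * k)) = - FN N * LN N"
      using R.second_order(1)[OF eq] f1 psi_sum L1 by simp
    show "(\<Sum>b\<in>B. \<Sum>k=-int N..int N. w N b k * hE (b + 5 * k)) = - (1/2) * FN N * ((LN N)\<^sup>2 - LN N - HN N)"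
      using R.second_order(2)[OF eq] f1 h_sum L1 L2 by simp
  }
qed

section \<open>Passage to infinite theta products\<close>

lemma kapN_LIMSEQ: "(\<lambda>N. kapN N b k) \<longlonglongrightarrow> kap b"
  unfolding kapN_def kap_def using finite_B
  by (intro tendsto_divide tendsto_prod bt2_LIMSEQ) auto

lemma kapN_bound:
  assumes "b \<in> B"
  shows "\<exists>C. \<forall>N k. \<bar>kapN N b k\<bar> \<le> C"
proof -
  have "\<exists>lo hi. \<forall>c. \<bar>c\<bar> < 5 \<longrightarrow> lo c > 0 \<and> (\<forall>u v. lo c \<le> \<bar>bt2 u v c\<bar> \<and> \<bar>bt2 u v c\<bar> \<le> hi c)"
    using bt2_bounds by metis
  then obtain lo hi where lh: "\<And>c. \<bar>c\<bar> < 5 \<Longrightarrow> lo c > 0"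
      "\<And>c u v. \<bar>c\<bar> < 5 \<Longrightarrow> lo c \<le> \<bar>bt2 u v c\<bar>" "\<And>c u v. \<bar>c\<bar> < 5 \<Longrightarrow> \<bar>bt2 u v c\<bar> \<le> hi c"
    by blast
  have "\<bar>kapN N b k\<bar> \<le> (\<Prod>a\<in>A. hi (a - b)) / (\<Prod>b'\<in>B. lo (b' - b))" for N k
    unfolding kapN_def abs_divide abs_prod
  proof (rule frac_le)
    show "(\<Prod>a\<in>A. \<bar>bt2 (nat (int N - k)) (nat (int N + k)) (a - b)\<bar>) \<le> (\<Prod>a\<in>A. hi (a - b))"
      by (rule prod_mono) (use lh AB assms in auto)
    then show "0 \<le> (\<Prod>a\<in>A. hi (a - b))"
      by (meson abs_ge_zero order_trans prod_nonneg)
    show "0 < (\<Prod>b'\<in>B. lo (b' - b))"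
      by (rule prod_pos) (use lh BB assms in auto)
    show "(\<Prod>b'\<in>B. lo (b' - b)) \<le> (\<Prod>b'\<in>B. \<bar>bt2 (nat (int N - k)) (nat (int N + k)) (b' - b)\<bar>)"
      by (rule prod_mono) (use lh BB assms in \<open>auto intro: less_imp_le\<close>)
  qed
  then show ?thesis by blast
qed

lemma abs_wt: "\<bar>wt b k\<bar> = E (k * (S + int d * b) + 5 * int d * triangular k)"
proof -
  have "\<bar>sg powi k\<bar> = 1"
    using sg_cases by (auto simp: power_int_abs[symmetric])
  then show ?thesis by (simp add: wt_def abs_mult)
qed

lemma wt_summable: "(\<lambda>k. \<bar>wt b k\<bar>) summable_on UNIV"
  unfolding abs_wt by (rule summable_quadratic[OF d_ge_1])

text \<open>Tannery's theorem: \<open>kapN\<close> is bounded uniformly in \<open>N\<close> and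
  \<open>k\<close>, and the weights are summable since their exponents are quadratic in
  \<open>k\<close>.\<close>

lemma LIMSEQ_weighted:
  assumes b: "b \<in> B" and f: "\<And>j. \<bar>f j\<bar> \<le> C"
  shows "(\<lambda>N. \<Sum>k=-int N..int N. wt b k * kapN N b k * f (b + 5 * k)) \<longlonglongrightarrow> kap b * (\<Sum>\<^sub>\<infinity>k. wt b k * f (b + 5 * k))"
proof -
  obtain D where D: "\<And>N k. \<bar>kapN N b k\<bar> \<le> D" using kapN_bound[OF b] by blast
  have "(\<lambda>N. \<Sum>k=-int N..int N. wt b k * kapN N b k * f (b + 5 * k)) \<longlonglongrightarrow> (\<Sum>\<^sub>\<infinity>k. wt b k * kap b * f (b + 5 * k))"
  proof (rule tannery_int(1))
    show "(\<lambda>k. \<bar>wt b k\<bar> * (D * C)) summable_on UNIV"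
      by (rule summable_on_cmult_left[OF wt_summable])
    show "\<bar>wt b k * kapN N b k * f (b + 5 * k)\<bar> \<le> \<bar>wt b k\<bar> * (D * C)" for N k
      unfolding abs_mult mult.assoc using D[of N k] f[of "b + 5 * k"]
      by (intro mult_left_mono mult_mono) (auto intro: order_trans[OF abs_ge_zero])
    show "(\<lambda>N. wt b k * kapN N b k * f (b + 5 * k)) \<longlonglongrightarrow> wt b k * kap b * f (b + 5 * k)" for k
      by (intro tendsto_intros kapN_LIMSEQ)
  qed
  also have "(\<lambda>k. wt b k * kap b * f (b + 5 * k)) = (\<lambda>k. kap b * (wt b k * f (b + 5 * k)))"
    by (simp add: mult_ac)
  also have "infsum \<dots> UNIV = kap b * (\<Sum>\<^sub>\<infinity>k. wt b k * f (b + 5 * k))"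
    by (rule infsum_cmult_right')
  finally show ?thesis .
qed

lemma FN_LIMSEQ: "FN \<longlonglongrightarrow> kap 0"
proof -
  have "FN = (\<lambda>N. kapN N 0 0)" by (rule ext) (simp add: FN_def kapN_def)
  then show ?thesis using kapN_LIMSEQ[of 0 0] by simp
qed

lemma LN_LIMSEQ: "LN \<longlonglongrightarrow> Lam"
proof -
  have "LN = (\<lambda>N. (\<Sum>a\<in>A. - (\<Sum>k=-int N..int N. gE (a + 5 * k)) - real N) - (\<Sum>b\<in>B. - (\<Sum>k=-int N..int N. gE (b + 5 * k)) - real N))"
  proof
    fix N
    have "real (card B) = real (card A) + real d" by (simp add: card_B)
    then show "LN N = (\<Sum>a\<in>A. - (\<Sum>k=-int N..int N. gE (a + 5 * k)) - real N) - (\<Sum>b\<in>B. - (\<Sum>k=-int N..int N. gE (b + 5 * k)) - real N)"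
      by (simp add: LN_def sum.cartesian_product[symmetric] sum_subtractf sum_negf algebra_simps)
  qed
  moreover have "(\<lambda>N. (\<Sum>a\<in>A. - (\<Sum>k=-int N..int N. gE (a + 5 * k)) - real N) - (\<Sum>b\<in>B. - (\<Sum>k=-int N..int N. gE (b + 5 * k)) - real N)) \<longlonglongrightarrow> Lam"
    unfolding Lam_def by (intro tendsto_diff tendsto_sum sum_window_rho_LIMSEQ) (use dvd_5_A0 dvd_5_B0 in auto)
  ultimately show ?thesis by simp
qed

lemma HN_LIMSEQ: "HN \<longlonglongrightarrow> H"
proof -
  have "HN = (\<lambda>N. (\<Sum>a\<in>A. \<Sum>k=-int N..int N. hE (a + 5 * k)) - (\<Sum>b\<in>B. \<Sum>k=-int N..int N. hE (b + 5 * k)))"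
    by (rule ext) (simp add: HN_def sum.cartesian_product)
  then show ?thesis
    unfolding H_def by (simp add: tendsto_diff tendsto_sum sum_window_PP_LIMSEQ)
qed

lemma sum_T0_LIMSEQ:
  "(\<lambda>N. \<Sum>b\<in>B. \<Sum>k=-int N..int N. wt b k * kapN N b k * psi (b + 5 * k)) \<longlonglongrightarrow> (\<Sum>b\<in>B. kap b * T0 b)"
  unfolding T0_def by (intro tendsto_sum LIMSEQ_weighted[OF _ psi_bound])

lemma sum_T1_LIMSEQ:
  "(\<lambda>N. \<Sum>b\<in>B. \<Sum>k=-int N..int N. wt b k * kapN N b k * hE (b + 5 * k)) \<longlonglongrightarrow> (\<Sum>b\<in>B. kap b * T1 b)"
  unfolding T1_def by (intro tendsto_sum LIMSEQ_weighted[OF _ hE_bound])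

text \<open>Limits of the first two finite identities: the value and the logarithmic derivative of
  the theta quotient at x = 1, read off from its partial fractions.\<close>

theorem regular:
  assumes "0 \<notin> B"
  shows "(\<Sum>b\<in>B. kap b * T0 b) = kap 0" "(\<Sum>b\<in>B. kap b * T1 b) = kap 0 * Lam"
  using LIMSEQ_unique[OF sum_T0_LIMSEQ, unfolded finite_identity(1)[OF assms], OF FN_LIMSEQ]
    LIMSEQ_unique[OF sum_T1_LIMSEQ, unfolded finite_identity(2)[OF assms], OF tendsto_mult[OF FN_LIMSEQ LN_LIMSEQ]]
  by auto

text \<open>The quotient now has a pole at x = 1 and \<open>kap 0\<close> contains the regularized
  \<open>bt 0\<close>. The sums skip the pole, as \<open>psi 0\<close> and \<open>hE 0\<close> are
  0, and give the first- and second-order terms of the quotient with its pole removed.\<close>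

theorem singular:
  assumes "0 \<in> B"
  shows "(\<Sum>b\<in>B. kap b * T0 b) = - kap 0 * Lam"
    "(\<Sum>b\<in>B. kap b * T1 b) = - (1/2) * kap 0 * (Lam\<^sup>2 - Lam - H)"
proof -
  have "(\<lambda>N. - FN N * LN N) \<longlonglongrightarrow> - kap 0 * Lam"
    by (intro tendsto_intros FN_LIMSEQ LN_LIMSEQ)
  then show "(\<Sum>b\<in>B. kap b * T0 b) = - kap 0 * Lam"
    by (rule LIMSEQ_unique[OF sum_T0_LIMSEQ, unfolded finite_identity(3)[OF assms]])
  have "(\<lambda>N. - (1/2) * FN N * ((LN N)\<^sup>2 - LN N - HN N)) \<longlonglongrightarrow> - (1/2) * kap 0 * (Lam\<^sup>2 - Lam - H)"
    by (intro tendsto_intros FN_LIMSEQ LN_LIMSEQ HN_LIMSEQ)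
  then show "(\<Sum>b\<in>B. kap b * T1 b) = - (1/2) * kap 0 * (Lam\<^sup>2 - Lam - H)"
    by (rule LIMSEQ_unique[OF sum_T1_LIMSEQ, unfolded finite_identity(4)[OF assms]])
qed

end

section \<open>Partition numbers in residue classes modulo 5\<close>

text \<open>As \<open>p(n) \<le> 2^n\<close>, the series \<open>\<Sum>n. p(5n + r) y^n\<close> converge for \<open>y < 2^-5\<close>.\<close>

locale small_nome = nome +
  assumes y_small: "y < 1 / 32"
begin

lemma npart_bound: "real_of_int (npart z) \<le> 2 ^ nat z"
proof (cases "z < 0")
  case False
  then have "npart z \<le> 2 ^ nat z" using npart_le_power[of "nat z"] by simp
  then have "real_of_int (npart z) \<le> real_of_int (2 ^ nat z)" by (simp only: of_int_le_iff)
  then show ?thesis by simp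
qed simp

definition Pi :: "int \<Rightarrow> real" where
  "Pi r = (\<Sum>\<^sub>\<infinity>n. real_of_int (npart (5 * int n + r)) * y ^ n)"

lemma Pi_has_sum:
  assumes "0 \<le> r" "r \<le> 4"
  shows "((\<lambda>n. real_of_int (npart (5 * int n + r)) * y ^ n) has_sum Pi r) UNIV"
proof -
  have "(\<lambda>n. real_of_int (npart (5 * int n + r)) * y ^ n) summable_on UNIV"
  proof (rule summable_on_comparison_test)
    have "summable (\<lambda>n. (32 * y) ^ n)"
      by (rule summable_geometric) (use y_pos y_small in auto)
    then have "(\<lambda>n. (32 * y) ^ n) summable_on UNIV"
      using y_pos by (intro norm_summable_imp_summable_on) simp
    then show "(\<lambda>n. 2 ^ 4 * (32 * y) ^ n) summable_on UNIV"
      by (rule summable_on_cmult_right)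
    show "real_of_int (npart (5 * int n + r)) * y ^ n \<le> 2 ^ 4 * (32 * y) ^ n" for n
    proof -
      have "(2::real) ^ nat (5 * int n + r) \<le> 2 ^ (5 * n + 4)"
        by (rule power_increasing) (use assms in auto)
      also have "\<dots> = 2 ^ 4 * 32 ^ n" by (simp add: power_add power_mult)
      finally have "real_of_int (npart (5 * int n + r)) \<le> 2 ^ 4 * 32 ^ n"
        using npart_bound[of "5 * int n + r"] by linarith
      then have "real_of_int (npart (5 * int n + r)) * y ^ n \<le> 2 ^ 4 * 32 ^ n * y ^ n"
        using y_pos by (intro mult_right_mono) auto
      then show ?thesis by (simp add: power_mult_distrib)
    qed
  qed (use y_pos npart_nonneg in auto)
  then show ?thesis unfolding Pi_def by (rule has_sum_infsum)
qed

text \<open>\<open>Psi z = \<Sum>n\<ge>0. p(5n + z) y^n\<close> for \<open>z \<le> 4\<close>, where \<open>p\<close> vanishes on negative numbers.\<close>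

definition Psi :: "int \<Rightarrow> real" where "Psi z = E (- (z div 5)) * Pi (z mod 5)"

lemma Psi_shift: "Psi (z - 5 * i) = E i * Psi z"
proof -
  have "(z - 5 * i) div 5 = z div 5 - i" "(z - 5 * i) mod 5 = z mod 5"
    using div_mult_self2[of 5 z "- i"] mod_mult_self2[of z 5 "- i"] by simp_all
  then show ?thesis by (simp add: Psi_def E_add[symmetric])
qed

lemma Psi_eq_Pi: "0 \<le> r \<Longrightarrow> r \<le> 4 \<Longrightarrow> Psi r = Pi r"
  by (simp add: Psi_def)

lemma npart_has_sum:
  assumes "z \<le> 4"
  shows "((\<lambda>n. real_of_int (npart (5 * int n + z)) * y ^ n) has_sum Psi z) UNIV"
proof -
  define K where "K = nat (- (z div 5))"
  define r where "r = z mod 5"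
  have r: "0 \<le> r" "r \<le> 4" by (auto simp: r_def)
  have z: "z = r - 5 * int K" using assms by (simp add: K_def r_def minus_mult_div_eq_mod)
  have "((\<lambda>n. E (int K) * (real_of_int (npart (5 * int n + r)) * y ^ n)) has_sum E (int K) * Pi r) UNIV"
    by (rule has_sum_cmult_right[OF Pi_has_sum[OF r]])
  also have "E (int K) * Pi r = Psi z"
    unfolding z Psi_shift using r by (simp add: Psi_eq_Pi)
  finally have "((\<lambda>n. real_of_int (npart (5 * int n + z)) * y ^ n) has_sum Psi z) (range (\<lambda>n. n + K))"
    by (subst has_sum_reindex) (auto simp: z comp_def E_nat power_add algebra_simps)
  then show ?thesis
  proof (rule has_sum_cong_neutral[THEN iffD1, rotated -1])
    fix n assume "n \<in> UNIV - range (\<lambda>n. n + K)"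
    then have "n < K" by (metis DiffD2 le_add_diff_inverse2 not_le rangeI)
    then show "real_of_int (npart (5 * int n + z)) * y ^ n = 0"
      using r by (simp add: z)
  qed auto
qed

lemma Psi_nonneg: "z \<le> 4 \<Longrightarrow> Psi z \<ge> 0"
  by (rule has_sum_nonneg[OF npart_has_sum]) (use y_pos npart_nonneg in auto)

lemma Pi_nonneg: "0 \<le> r \<Longrightarrow> r \<le> 4 \<Longrightarrow> Pi r \<ge> 0"
  using Psi_nonneg[of r] by (simp add: Psi_eq_Pi)

definition CPsi :: real where "CPsi = (\<Sum>r\<in>{0..4::int}. Pi r)"

lemma CPsi_nonneg: "CPsi \<ge> 0"
  unfolding CPsi_def by (rule sum_nonneg) (auto intro: Pi_nonneg)

lemma Psi_le: "Psi z \<le> CPsi * E (- (z div 5))"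
proof -
  have "Pi (z mod 5) \<le> CPsi"
    unfolding CPsi_def by (rule member_le_sum) (auto intro: Pi_nonneg)
  then show ?thesis by (simp add: Psi_def mult.commute)
qed

text \<open>Fubini: it passes from relations between partition numbers to relations between the
  series \<open>Psi\<close>. The condition \<open>z i \<le> 4\<close> makes \<open>Psi (z i)\<close>
  the series with all its terms.\<close>

lemma interchange:
  fixes c :: "'i \<Rightarrow> real" and z :: "'i \<Rightarrow> int"
  assumes z: "\<And>i. i \<in> I \<Longrightarrow> z i \<le> 4" and s: "(\<lambda>i. \<bar>c i\<bar> * Psi (z i)) summable_on I"
  shows "((\<lambda>n. (\<Sum>\<^sub>\<infinity>i\<in>I. c i * real_of_int (npart (5 * int n + z i))) * y ^ n) has_sum (\<Sum>\<^sub>\<infinity>i\<in>I. c i * Psi (z i))) UNIV"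
proof -
  define f where "f = (\<lambda>(i, n). c i * (real_of_int (npart (5 * int n + z i)) * y ^ n))"
  have norm_f: "(\<lambda>p. norm (f p)) summable_on I \<times> UNIV"
  proof (rule summable_on_SigmaI)
    show "((\<lambda>n. norm (f (i, n))) has_sum \<bar>c i\<bar> * Psi (z i)) UNIV" if "i \<in> I" for i
    proof -
      have "norm (f (i, n)) = \<bar>c i\<bar> * (real_of_int (npart (5 * int n + z i)) * y ^ n)" for n
        using y_pos npart_nonneg[of "5 * int n + z i"] by (simp add: f_def abs_mult)
      then show ?thesis
        using has_sum_cmult_right[OF npart_has_sum[OF z[OF that]], of "\<bar>c i\<bar>"] by simp
    qed
  qed (use s in auto)
  then have f: "f summable_on I \<times> UNIV" by (rule abs_summable_summable)
  have "((\<lambda>i. c i * Psi (z i)) has_sum infsum f (I \<times> UNIV)) I"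
  proof (rule has_sum_SigmaD[OF has_sum_infsum[OF f]])
    show "((\<lambda>n. f (i, n)) has_sum c i * Psi (z i)) UNIV" if "i \<in> I" for i
      unfolding f_def prod.case by (rule has_sum_cmult_right[OF npart_has_sum[OF z[OF that]]])
  qed
  then have 1: "infsum f (I \<times> UNIV) = (\<Sum>\<^sub>\<infinity>i\<in>I. c i * Psi (z i))"
    by (rule infsumI[symmetric])
  have f': "((\<lambda>(n, i). f (i, n)) has_sum infsum f (I \<times> UNIV)) (UNIV \<times> I)"
    using has_sum_infsum[OF f] by (subst has_sum_swap[symmetric]) (simp add: case_prod_unfold)
  have inner: "(\<lambda>i. f (i, n)) summable_on I" for n
    using summable_on_SigmaD1[of "\<lambda>n i. f (i, n)" UNIV "\<lambda>_. I" n] f' by (auto simp: summable_on_def)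
  have "((\<lambda>n. \<Sum>\<^sub>\<infinity>i\<in>I. f (i, n)) has_sum infsum f (I \<times> UNIV)) UNIV"
    by (rule has_sum_SigmaD[OF f']) (simp add: has_sum_infsum inner)
  moreover have "(\<Sum>\<^sub>\<infinity>i\<in>I. f (i, n)) = (\<Sum>\<^sub>\<infinity>i\<in>I. c i * real_of_int (npart (5 * int n + z i))) * y ^ n" for n
    unfolding f_def prod.case mult.assoc[symmetric] using y_pos by (intro infsum_cmult_left') 
  ultimately show ?thesis by (simp add: 1)
qed

lemma Psi_summable:
  assumes "\<And>i. i \<in> I \<Longrightarrow> z i \<le> 4" and "\<And>i. i \<in> I \<Longrightarrow> c i * E (- (z i div 5)) \<le> g i"
    and "\<And>i. i \<in> I \<Longrightarrow> c i \<ge> 0" and "g summable_on I"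
  shows "(\<lambda>i. c i * Psi (z i)) summable_on I"
proof (rule summable_on_comparison_test)
  show "(\<lambda>i. CPsi * g i) summable_on I"
    by (rule summable_on_cmult_right[OF assms(4)])
  show "c i * Psi (z i) \<le> CPsi * g i" if "i \<in> I" for i
  proof -
    have "c i * Psi (z i) \<le> c i * (CPsi * E (- (z i div 5)))"
      using assms(3)[OF that] Psi_le by (intro mult_left_mono) auto
    also have "\<dots> = CPsi * (c i * E (- (z i div 5)))" by simp
    also have "\<dots> \<le> CPsi * g i"
      using assms(2)[OF that] CPsi_nonneg by (intro mult_left_mono) auto
    finally show ?thesis .
  qed
qed (use assms Psi_nonneg in auto)

lemma pentagonal_5: "pentagonal (5 * l + b) = pentagonal b + 5 * ((15 * l\<^sup>2 + l) div 2 + 3 * l * b)"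
proof -
  define q where "q = (15 * l\<^sup>2 + l) div 2"
  have "even (15 * l\<^sup>2 + l)" by simp
  then have "2 * q = 15 * l\<^sup>2 + l" by (simp add: q_def)
  then show ?thesis
    unfolding q_def[symmetric] using two_pentagonal[of "5 * l + b"] two_pentagonal[of b]
    by (simp add: algebra_simps power2_eq_square)
qed

lemma div_5_le: "(u::int) \<le> 5 * a + 4 \<Longrightarrow> u div 5 \<le> a"
  by linarith

lemma inverse_neg_one_power: "inverse ((-1::real) ^ n) = (-1) ^ n"
  by (induction n) auto

lemma pentagonal_nonneg: "pentagonal k \<ge> 0"
proof -
  have "k * (3 * k + 1) \<ge> 0" by (cases "k \<ge> 0") (auto intro: mult_nonpos_nonpos)
  then show ?thesis using two_pentagonal[of k] by simp
qed

lemma pentagonal_ge_abs: "pentagonal k \<ge> \<bar>k\<bar>"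
proof -
  have "k * (3 * k + 1) \<ge> 2 * \<bar>k\<bar>"
  proof (cases "k \<ge> 1")
    case True
    then have "k * 2 \<le> k * (3 * k + 1)" by (intro mult_left_mono) auto
    then show ?thesis using True by simp
  next
    case False
    then have "(- k) * 2 \<le> (- k) * (- 3 * k - 1)" if "k \<noteq> 0" using that by (intro mult_left_mono) auto
    then show ?thesis using False by (cases "k = 0") (auto simp: algebra_simps)
  qed
  then show ?thesis using two_pentagonal[of k] by simp
qed

lemma pentagonal_ge: "pentagonal k \<ge> 5 * \<bar>k\<bar> - 5"
proof -
  \<comment> \<open>No integer lies strictly between the roots 5/3 and 2, so the product is
    nonnegative.\<close>
  have "(\<bar>k\<bar> - 2) * (3 * \<bar>k\<bar> - 5) \<ge> 0"
    by (cases "\<bar>k\<bar> \<ge> 2") (auto intro!: mult_nonneg_nonneg mult_nonpos_nonpos)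
  moreover have "\<bar>k\<bar> * \<bar>k\<bar> = k * k" by (simp add: abs_mult_self_eq)
  ultimately have "3 * (k * k) \<ge> 11 * \<bar>k\<bar> - 10" by (simp add: algebra_simps)
  then show ?thesis using two_pentagonal[of k] by (simp add: algebra_simps)
qed

lemma pentagonal_infsum:
  "(\<Sum>\<^sub>\<infinity>k. (-1) powi k * real_of_int (npart (int N - pentagonal k))) = (if N = 0 then 1 else 0)"
proof -
  let ?f = "\<lambda>k. (-1) powi k * real_of_int (npart (int N - pentagonal k))"
  have "infsum ?f UNIV = infsum ?f {- int N..int N}"
  proof (rule infsum_cong_neutral)
    fix k assume "k \<in> UNIV - {- int N..int N}"
    then have "pentagonal k > int N" using pentagonal_ge_abs[of k] by auto
    then show "?f k = 0" by simp
  qed auto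
  also have "\<dots> = sum ?f {- int N..int N}" by simp
  also have "{- int N..int N} = insert 0 (int ` {1..N} \<union> (\<lambda>j. - int j) ` {1..N})"
  proof (rule set_eqI)
    fix k show "k \<in> {- int N..int N} \<longleftrightarrow> k \<in> insert 0 (int ` {1..N} \<union> (\<lambda>j. - int j) ` {1..N})"
      by (cases k rule: int_cases2) (auto simp: image_iff)
  qed
  also have "sum ?f \<dots> = ?f 0 + (sum ?f (int ` {1..N}) + sum ?f ((\<lambda>j. - int j) ` {1..N}))"
    by (subst sum.insert) (auto intro!: sum.union_disjoint)
  also have "sum ?f (int ` {1..N}) = (\<Sum>j=1..N. ?f (int j))"
    by (subst sum.reindex) auto
  also have "sum ?f ((\<lambda>j. - int j) ` {1..N}) = (\<Sum>j=1..N. ?f (- int j))"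
    by (subst sum.reindex) (auto simp: inj_on_def)
  also have "?f 0 + ((\<Sum>j=1..N. ?f (int j)) + (\<Sum>j=1..N. ?f (- int j))) =
      real_of_int (npart (int N) + (\<Sum>j=1..N. (-1) ^ j * (npart (int N - pentagonal (- int j)) + npart (int N - pentagonal (int j)))))"
    by (simp add: sum.distrib[symmetric] pentagonal_def[of 0] power_int_minus inverse_neg_one_power algebra_simps)
  finally show ?thesis unfolding pentagonal_recursion[OF order_refl] by simp
qed

lemma Psi_pentagonal_summable:
  assumes r: "0 \<le> r" "r \<le> 4"
  shows "(\<lambda>k. Psi (r - pentagonal k)) summable_on UNIV"
proof -
  have "(\<lambda>k. 1 * Psi (r - pentagonal k)) summable_on UNIV"
  proof (rule Psi_summable)
    show "r - pentagonal k \<le> 4" for k using r pentagonal_nonneg[of k] by simp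
    show "1 * E (- ((r - pentagonal k) div 5)) \<le> E (- 1) * y ^ nat \<bar>k\<bar>" for k
    proof -
      have "r - pentagonal k \<le> 5 * (1 - \<bar>k\<bar>) + 4" using pentagonal_ge[of k] r by simp
      then have "(r - pentagonal k) div 5 \<le> 1 - \<bar>k\<bar>" by (rule div_5_le)
      then have "E (- ((r - pentagonal k) div 5)) \<le> E (- 1 + int (nat \<bar>k\<bar>))" by (intro E_le) simp
      then show ?thesis using E_add[of "- 1" "\<bar>k\<bar>"] E_nat[of "nat \<bar>k\<bar>"] by simp
    qed
    show "(\<lambda>k::int. E (- 1) * y ^ nat \<bar>k\<bar>) summable_on UNIV"
      by (intro summable_on_cmult_right summable_int_power)
  qed auto
  then show ?thesis by simp
qed

text \<open>Euler's theorem, \<open>pentagonal_infsum\<close>, restricted to the exponents congruent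
  to \<open>r\<close> modulo 5 and summed against powers of \<open>y\<close>.\<close>

lemma pentagonal_Psi:
  assumes r: "0 \<le> r" "r \<le> 4"
  shows "(\<Sum>\<^sub>\<infinity>k. (-1) powi k * Psi (r - pentagonal k)) = (if r = 0 then 1 else 0)"
proof -
  have sg: "\<bar>(-1::real) powi k\<bar> = 1" for k by (simp add: power_int_abs[symmetric])
  have "(\<lambda>k. \<bar>(-1) powi k\<bar> * Psi (r - pentagonal k)) summable_on UNIV"
    using Psi_pentagonal_summable[OF r] by (simp add: sg)
  then have "((\<lambda>n. (\<Sum>\<^sub>\<infinity>k. (-1) powi k * real_of_int (npart (5 * int n + (r - pentagonal k)))) * y ^ n) has_sum
      (\<Sum>\<^sub>\<infinity>k. (-1) powi k * Psi (r - pentagonal k))) UNIV"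
    by (intro interchange) (use r pentagonal_nonneg sg in \<open>auto simp: add.commute diff_le_eq intro: add_increasing\<close>)
  moreover have "(\<Sum>\<^sub>\<infinity>k. (-1) powi k * real_of_int (npart (5 * int n + (r - pentagonal k)))) = (if n = 0 \<and> r = 0 then 1 else 0)" for n
  proof -
    have "5 * int n + (r - pentagonal k) = int (nat (5 * int n + r)) - pentagonal k" for k
      using r by simp
    then show ?thesis using pentagonal_infsum[of "nat (5 * int n + r)"] r by (auto simp: add_diff_eq)
  qed
  ultimately have "((\<lambda>n. (if n = 0 \<and> r = 0 then 1 else 0) * y ^ n) has_sum (\<Sum>\<^sub>\<infinity>k. (-1) powi k * Psi (r - pentagonal k))) UNIV"
    by simp
  moreover have "((\<lambda>n::nat. (if n = 0 \<and> r = 0 then 1 else 0) * y ^ n) has_sum (if r = 0 then 1 else 0)) UNIV"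
  proof -
    let ?f = "\<lambda>n::nat. (if n = 0 \<and> r = 0 then 1 else 0) * y ^ n"
    have "(?f has_sum sum ?f {0}) {0}" by (rule has_sum_finite) simp
    then have "(?f has_sum sum ?f {0}) UNIV"
      by (rule has_sum_cong_neutral[THEN iffD1, rotated -1]) auto
    then show ?thesis by simp
  qed
  ultimately show ?thesis by (rule has_sum_unique)
qed

end

section \<open>Moment sums\<close>

lemma has_sum_diff:
  fixes f g :: "'a \<Rightarrow> real"
  assumes "(f has_sum a) A" "(g has_sum b) A"
  shows "((\<lambda>x. f x - g x) has_sum (a - b)) A"
  using has_sum_add[OF assms(1) has_sum_uminusI[OF assms(2)]] by simp

lemma infsum_int_split:
  fixes f :: "int \<Rightarrow> real"
  assumes f: "f summable_on UNIV" and f0: "f 0 = 0"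
  shows "((\<lambda>j. f (int (Suc j)) + f (- int (Suc j))) has_sum infsum f UNIV) UNIV"
proof -
  have f': "f summable_on A" for A
    by (rule summable_on_subset_banach[OF f]) simp
  let ?P = "range (\<lambda>j. int (Suc j))" and ?M = "range (\<lambda>j. - int (Suc j))"
  have "(\<lambda>j. f (int (Suc j))) = f \<circ> (\<lambda>j. int (Suc j))" "(\<lambda>j. f (- int (Suc j))) = f \<circ> (\<lambda>j. - int (Suc j))"
    by auto
  then have P: "((\<lambda>j. f (int (Suc j))) has_sum infsum f ?P) UNIV"
    and M: "((\<lambda>j. f (- int (Suc j))) has_sum infsum f ?M) UNIV"
    using has_sum_infsum[OF f'[of ?P]] has_sum_infsum[OF f'[of ?M]]
    by (auto simp: has_sum_reindex inj_on_def)
  have "infsum f UNIV = infsum f (?P \<union> ?M)"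
  proof (rule infsum_cong_neutral)
    fix k assume "k \<in> UNIV - (?P \<union> ?M)"
    have "k = 0"
    proof (rule ccontr)
      assume "k \<noteq> 0"
      then have "k = int (Suc (nat (k - 1))) \<or> k = - int (Suc (nat (- k - 1)))" by auto
      then show False using \<open>k \<in> UNIV - (?P \<union> ?M)\<close> by blast
    qed
    then show "f k = 0" using f0 by simp
  qed auto
  also have "\<dots> = infsum f ?P + infsum f ?M"
    by (rule infsum_Un_disjoint[OF f' f']) auto
  finally show ?thesis using has_sum_add[OF P M] by simp
qed

lemma infsum_residues_5:
  fixes F :: "int \<Rightarrow> real"
  assumes F: "F summable_on UNIV" and R: "bij_betw (\<lambda>b. b mod 5) R {0..4::int}"
  shows "infsum F UNIV = (\<Sum>b\<in>R. \<Sum>\<^sub>\<infinity>l. F (5 * l + b))"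
proof -
  have fin: "finite R" using R bij_betw_finite by blast
  have inj: "b \<in> R \<Longrightarrow> b' \<in> R \<Longrightarrow> b mod 5 = b' mod 5 \<Longrightarrow> b = b'" for b b'
    using R by (auto simp: bij_betw_def inj_on_def)
  have UN: "UNIV = (\<Union>b\<in>R. range (\<lambda>l. 5 * l + b))"
  proof (rule set_eqI, simp)
    fix k :: int
    have "k mod 5 \<in> (\<lambda>b. b mod 5) ` R" using R by (simp add: bij_betw_def)
    then obtain b where b: "b \<in> R" "k mod 5 = b mod 5" by auto
    then have "5 dvd k - b" by (simp add: mod_eq_dvd_iff)
    then obtain l where "k - b = 5 * l" by auto
    then have "k = 5 * l + b" by simp
    then show "\<exists>b\<in>R. k \<in> range (\<lambda>l. 5 * l + b)" using b by blast
  qed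
  have "infsum F (\<Union>b\<in>R. range (\<lambda>l. 5 * l + b)) = (\<Sum>b\<in>R. infsum F (range (\<lambda>l. 5 * l + b)))"
  proof (rule sum_infsum[symmetric, OF fin])
    show "F summable_on range (\<lambda>l. 5 * l + b)" for b
      by (rule summable_on_subset_banach[OF F]) simp
    show "range (\<lambda>l. 5 * l + b) \<inter> range (\<lambda>l. 5 * l + b') = {}" if "b \<in> R" "b' \<in> R" "b \<noteq> b'" for b b'
    proof -
      have "b mod 5 \<noteq> b' mod 5" using that inj by blast
      then have "5 * l + b \<noteq> 5 * l' + b'" for l l' by (metis mod_mult_self4)
      then show ?thesis by auto
    qed
  qed
  also have "\<dots> = (\<Sum>b\<in>R. \<Sum>\<^sub>\<infinity>l. F (5 * l + b))"
    by (rule sum.cong[OF refl], subst infsum_reindex) (auto simp: inj_on_def comp_def)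
  finally show ?thesis unfolding UN[symmetric] .
qed

lemma arithmetic_geometric_has_sum:
  fixes v :: real assumes "0 < v" "v < 1"
  shows "((\<lambda>i. (5 * real i + e) * v ^ i) has_sum (e / (1 - v) + 5 * v / (1 - v)\<^sup>2)) UNIV"
proof -
  have nv: "norm v < 1" using assms by simp
  have g: "((\<lambda>i. v ^ i) has_sum 1 / (1 - v)) UNIV"
    by (rule norm_summable_imp_has_sum) (use assms nv geometric_sums[OF nv] summable_geometric[OF nv] in auto)
  have d: "(\<lambda>n. real (Suc n) * v ^ n) sums (1 / (1 - v)\<^sup>2)"
    using geometric_deriv_sums[OF nv] by simp
  then have d': "((\<lambda>n. real (Suc n) * v ^ n) has_sum (1 / (1 - v)\<^sup>2)) UNIV"
    by (intro norm_summable_imp_has_sum) (use assms in \<open>auto dest: sums_summable\<close>)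
  have "((\<lambda>i. 5 * (real (Suc i) * v ^ i) + (e - 5) * v ^ i) has_sum (5 * (1 / (1 - v)\<^sup>2) + (e - 5) * (1 / (1 - v)))) UNIV"
    by (intro has_sum_add has_sum_cmult_right d' g)
  moreover have "5 * (1 / (1 - v)\<^sup>2) + (e - 5) * (1 / (1 - v)) = e / (1 - v) + 5 * v / (1 - v)\<^sup>2"
  proof -
    have "1 / (1 - v) = (1 - v) / (1 - v)\<^sup>2"
      using assms by (simp add: power2_eq_square)
    then have "1 / (1 - v)\<^sup>2 = v / (1 - v)\<^sup>2 + 1 / (1 - v)"
      by (simp add: add_divide_distrib[symmetric])
    then show ?thesis by (simp add: algebra_simps diff_divide_distrib)
  qed
  ultimately show ?thesis by (simp add: algebra_simps)
qed

context small_nome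
begin

text \<open>The index (m, j) stands for the pair (m + 1, j + 1), so that sums run over all pairs of
  naturals; hence \<open>(-1) ^ j\<close> where the closed forms have \<open>(-1) ^ (j - 1)\<close>.
  The 1 in \<open>expo\<close> is the residue of 5n + 1.\<close>

definition coef :: "nat \<times> nat \<Rightarrow> real" where
  "coef = (\<lambda>(m, j). real (Suc m) * real_of_int (chi (int (Suc m))) * (-1) ^ j)"

definition expo :: "(nat \<Rightarrow> int) \<Rightarrow> nat \<times> nat \<Rightarrow> int" where
  "expo u = (\<lambda>(m, j). 1 - u j - int (Suc m) * int (Suc j))"

lemma coef_summable:
  assumes u: "\<And>j. u j \<ge> 0"
  shows "(\<lambda>p. \<bar>coef p\<bar> * Psi (expo u p)) summable_on UNIV"
proof (rule Psi_summable)
  \<comment> \<open>In terms of the fifth root the division by 5 in the exponent disappears, and the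
    crude bound \<open>- (int m + int j)\<close> on \<open>expo\<close> yields a product of two
    convergent series.\<close>
  define w where "w = root 5 y"
  have w: "0 < w" "w < 1" "w ^ 5 = y"
    using y_pos y_less_1 by (auto simp: w_def)
  have Ew: "E i = w powi (5 * i)" for i
  proof -
    have "y powi i = (w ^ 5) powi i" by (simp only: w(3))
    then show ?thesis by (simp add: E_def power_int_mult)
  qed
  show "expo u p \<le> 4" for p
  proof (cases p)
    case (Pair m j)
    have "int (Suc m) * int (Suc j) \<ge> 0" by simp
    then show ?thesis using u[of j] unfolding Pair expo_def prod.case by linarith
  qed
  show "\<bar>coef p\<bar> * E (- (expo u p div 5)) \<le> (case p of (m, j) \<Rightarrow> (real (Suc m) * w ^ m) * w ^ j)" for p
  proof (cases p)
    case (Pair m j)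
    have "int (Suc m) * int (Suc j) = 1 + int m + int j + int m * int j" by (simp add: algebra_simps)
    moreover have "int m * int j \<ge> 0" by simp
    ultimately have "expo u p \<le> - (int m + int j)"
      using u[of j] unfolding Pair expo_def prod.case by linarith
    then have "5 * (- (expo u p div 5)) \<ge> int (m + j)" by simp
    then have "w powi (5 * (- (expo u p div 5))) \<le> w powi (int (m + j))"
      using w by (intro power_int_decreasing) auto
    then have "E (- (expo u p div 5)) \<le> w ^ m * w ^ j"
      unfolding Ew power_int_of_nat power_add .
    moreover have "\<bar>coef p\<bar> \<le> real (Suc m)"
    proof -
      have "\<bar>real_of_int (chi (int (Suc m)))\<bar> \<le> 1" by (simp add: chi_def)
      then show ?thesis unfolding Pair coef_def by (simp add: abs_mult mult_left_le)
    qed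
    ultimately have "\<bar>coef p\<bar> * E (- (expo u p div 5)) \<le> real (Suc m) * (w ^ m * w ^ j)"
      by (intro mult_mono) auto
    then show ?thesis by (simp add: Pair mult.assoc)
  qed
  have nw: "norm w < 1" using w by simp
  have d: "(\<lambda>n. real (Suc n) * w ^ n) summable_on UNIV"
    using geometric_deriv_sums[OF nw] w by (intro norm_summable_imp_summable_on) (auto dest: sums_summable)
  have g: "(\<lambda>n. w ^ n) summable_on UNIV"
    using summable_geometric[OF nw] w by (intro norm_summable_imp_summable_on) simp
  show "(\<lambda>p. case p of (m, j) \<Rightarrow> (real (Suc m) * w ^ m) * w ^ j) summable_on UNIV"
    unfolding UNIV_Times_UNIV[symmetric]
  proof (rule summable_on_SigmaI)
    show "((\<lambda>j. case (m, j) of (m, j) \<Rightarrow> (real (Suc m) * w ^ m) * w ^ j) has_sum (real (Suc m) * w ^ m) * infsum (\<lambda>n. w ^ n) UNIV) UNIV" for m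
      unfolding prod.case by (rule has_sum_cmult_right[OF has_sum_infsum[OF g]])
    show "(\<lambda>m. real (Suc m) * w ^ m * infsum (\<lambda>n. w ^ n) UNIV) summable_on UNIV"
      by (rule summable_on_cmult_left[OF d])
  qed (use w in auto)
qed auto

lemma coef_npart_infsum:
  assumes u: "\<And>j. u j \<ge> 0" and N: "n \<le> N"
  shows "(\<Sum>\<^sub>\<infinity>p. coef p * real_of_int (npart (int n - 1 + expo u p))) =
    (\<Sum>m=1..N. \<Sum>j=1..N. real m * real_of_int (chi (int m)) * (-1) ^ (j - 1) * real_of_int (npart (int n - u (j - 1) - int m * int j)))"
proof -
  let ?f = "\<lambda>p. coef p * real_of_int (npart (int n - 1 + expo u p))"
  have "infsum ?f UNIV = infsum ?f ({..<N} \<times> {..<N})"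
  proof (rule infsum_cong_neutral)
    fix p assume p: "p \<in> UNIV - {..<N} \<times> {..<N}"
    obtain m j where mj: "p = (m, j)" by (cases p)
    have "int (Suc m) * int (Suc j) = 1 + int m + int j + int m * int j" by (simp add: algebra_simps)
    moreover have "int m * int j \<ge> 0" by simp
    moreover have "int m \<ge> int N \<or> int j \<ge> int N" using p mj by auto
    ultimately have "int n - 1 + expo u p < 0"
      using u[of j] N unfolding mj expo_def prod.case by linarith
    then show "?f p = 0" by simp
  qed auto
  also have "\<dots> = sum ?f ({..<N} \<times> {..<N})" by simp
  also have "\<dots> = (\<Sum>m<N. \<Sum>j<N. ?f (m, j))" by (simp add: sum.cartesian_product)
  also have "\<dots> = (\<Sum>m=1..N. \<Sum>j=1..N. real m * real_of_int (chi (int m)) * (-1) ^ (j - 1) * real_of_int (npart (int n - u (j - 1) - int m * int j)))"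
  proof (rule sum.reindex_bij_witness[where i = "\<lambda>m. m - 1" and j = Suc])
    fix m :: nat
    show "(\<Sum>j=1..N. real (Suc m) * real_of_int (chi (int (Suc m))) * (-1) ^ (j - 1) * real_of_int (npart (int n - u (j - 1) - int (Suc m) * int j))) = (\<Sum>j<N. ?f (m, j))"
      by (rule sum.reindex_bij_witness[where i = Suc and j = "\<lambda>j. j - 1"]) (auto simp: coef_def expo_def algebra_simps)
  qed auto
  finally show ?thesis .
qed

definition moment_sum :: "(nat \<Rightarrow> int) \<Rightarrow> real" where
  "moment_sum u = (\<Sum>\<^sub>\<infinity>p. coef p * Psi (expo u p))"

definition geo :: "real \<Rightarrow> nat \<Rightarrow> real" where
  "geo e j = e / (1 - E (int (Suc j))) + 5 * hE (int (Suc j))"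

text \<open>\<open>chi\<close> selects the indices congruent to 2 and 3 modulo 5. Along each class
  \<open>Psi_shift\<close> makes \<open>Psi\<close> geometric with ratio y^(j+1), and
  \<open>geo\<close> is the resulting arithmetic-geometric sum.\<close>

lemma inner_has_sum:
  "((\<lambda>m. real (Suc m) * real_of_int (chi (int (Suc m))) * Psi (z - int (Suc m) * int (Suc j))) has_sum
     geo 2 j * Psi (z - 2 * int (Suc j)) - geo 3 j * Psi (z - 3 * int (Suc j))) UNIV"
proof -
  define v where "v = E (int (Suc j))"
  have v: "0 < v" "v < 1"
    using E_le_y[of "int (Suc j)"] y_less_1 by (auto simp: v_def)
  have geo: "geo e j = e / (1 - v) + 5 * v / (1 - v)\<^sup>2" for e
    by (simp add: geo_def hE_def v_def)
  define f where "f m = real (Suc m) * real_of_int (chi (int (Suc m))) * Psi (z - int (Suc m) * int (Suc j))" for m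
  have shift: "Psi (z - int (5 * i + e) * int (Suc j)) = v ^ i * Psi (z - int e * int (Suc j))" for i e :: nat
  proof -
    have "z - int (5 * i + e) * int (Suc j) = (z - int e * int (Suc j)) - 5 * (int (Suc j) * int i)"
      by (simp add: algebra_simps)
    then show ?thesis unfolding v_def E_power by (simp only: Psi_shift)
  qed
  have "((\<lambda>i. f (5 * i + 1)) has_sum geo 2 j * Psi (z - 2 * int (Suc j))) UNIV"
  proof -
    have "f (5 * i + 1) = (5 * real i + 2) * v ^ i * Psi (z - 2 * int (Suc j))" for i
    proof -
      have m: "Suc (5 * i + 1) = 5 * i + 2" by simp
      have c: "chi (int (5 * i + 2)) = 1" by (simp add: chi_def)
      show ?thesis unfolding f_def m c shift by simp
    qed
    then show ?thesis
      unfolding geo using has_sum_cmult_left[OF arithmetic_geometric_has_sum[OF v, of 2], of "Psi (z - 2 * int (Suc j))"] by simp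
  qed
  then have A: "(f has_sum geo 2 j * Psi (z - 2 * int (Suc j))) (range (\<lambda>i. 5 * i + 1))"
    by (subst has_sum_reindex) (auto simp: inj_on_def comp_def)
  have "((\<lambda>i. f (5 * i + 2)) has_sum - (geo 3 j * Psi (z - 3 * int (Suc j)))) UNIV"
  proof -
    have "f (5 * i + 2) = (5 * real i + 3) * v ^ i * (- Psi (z - 3 * int (Suc j)))" for i
    proof -
      have m: "Suc (5 * i + 2) = 5 * i + 3" by simp
      have c: "chi (int (5 * i + 3)) = - 1" by (simp add: chi_def)
      show ?thesis unfolding f_def m c shift by (simp add: algebra_simps)
    qed
    then show ?thesis
      unfolding geo using has_sum_cmult_left[OF arithmetic_geometric_has_sum[OF v, of 3], of "- Psi (z - 3 * int (Suc j))"] by simp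
  qed
  then have B: "(f has_sum - (geo 3 j * Psi (z - 3 * int (Suc j)))) (range (\<lambda>i. 5 * i + 2))"
    by (subst has_sum_reindex) (auto simp: inj_on_def comp_def)
  have "range (\<lambda>i::nat. 5 * i + 1) \<inter> range (\<lambda>i. 5 * i + 2) = {}"
  proof -
    have "5 * i + 1 \<noteq> 5 * k + (2::nat)" for i k by presburger
    then show ?thesis by auto
  qed
  from has_sum_Un_disjoint[OF A B this]
  have "(f has_sum geo 2 j * Psi (z - 2 * int (Suc j)) - geo 3 j * Psi (z - 3 * int (Suc j))) (range (\<lambda>i. 5 * i + 1) \<union> range (\<lambda>i. 5 * i + 2))"
    by simp
  then have "(f has_sum geo 2 j * Psi (z - 2 * int (Suc j)) - geo 3 j * Psi (z - 3 * int (Suc j))) UNIV"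
  proof (rule has_sum_cong_neutral[THEN iffD1, rotated -1])
    fix m :: nat assume m: "m \<in> UNIV - (range (\<lambda>i. 5 * i + 1) \<union> range (\<lambda>i. 5 * i + 2))"
    have "int (Suc m) mod 5 \<noteq> 2" "int (Suc m) mod 5 \<noteq> 3"
    proof -
      show "int (Suc m) mod 5 \<noteq> 2"
      proof
        assume "int (Suc m) mod 5 = 2"
        then have "m = 5 * (m div 5) + 1" by presburger
        then have "m \<in> range (\<lambda>i. 5 * i + 1)" by (rule range_eqI)
        then show False using m by simp
      qed
      show "int (Suc m) mod 5 \<noteq> 3"
      proof
        assume "int (Suc m) mod 5 = 3"
        then have "m = 5 * (m div 5) + 2" by presburger
        then have "m \<in> range (\<lambda>i. 5 * i + 2)" by (rule range_eqI)
        then show False using m by simp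
      qed
    qed
    then show "f m = 0" unfolding f_def chi_def by simp
  qed auto
  then show ?thesis unfolding f_def .
qed

lemma moment_sum_has_sum:
  assumes u: "\<And>j. u j \<ge> 0"
  shows "((\<lambda>j. (-1) ^ j * (geo 2 j * Psi (1 - u j - 2 * int (Suc j)) - geo 3 j * Psi (1 - u j - 3 * int (Suc j)))) has_sum moment_sum u) UNIV"
proof -
  let ?f = "\<lambda>p. coef p * Psi (expo u p)"
  have "expo u p \<le> 4" for p
  proof (cases p)
    case (Pair m j)
    have "int (Suc m) * int (Suc j) \<ge> 0" by simp
    then show ?thesis using u[of j] unfolding Pair expo_def prod.case by linarith
  qed
  then have eq: "(\<lambda>p. norm (?f p)) = (\<lambda>p. \<bar>coef p\<bar> * Psi (expo u p))"
    using Psi_nonneg by (intro ext) (simp add: abs_mult)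
  have "?f summable_on UNIV"
    by (rule abs_summable_summable) (simp only: eq coef_summable[OF u])
  then have "(?f has_sum moment_sum u) (UNIV \<times> UNIV)"
    unfolding moment_sum_def UNIV_Times_UNIV by (rule has_sum_infsum)
  then have "((\<lambda>(j, m). ?f (m, j)) has_sum moment_sum u) (UNIV \<times> UNIV)"
    by (subst has_sum_swap[symmetric]) (simp add: case_prod_unfold)
  then show ?thesis
  proof (rule has_sum_SigmaD)
    fix j
    have eq: "(\<lambda>m. case (j, m) of (j, m) \<Rightarrow> ?f (m, j)) = (\<lambda>m. (-1) ^ j *
        (real (Suc m) * real_of_int (chi (int (Suc m))) * Psi (1 - u j - int (Suc m) * int (Suc j))))"
      unfolding prod.case coef_def expo_def by (intro ext) (simp only: mult_ac)
    show "((\<lambda>m. case (j, m) of (j, m) \<Rightarrow> ?f (m, j)) has_sum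
       (-1) ^ j * (geo 2 j * Psi (1 - u j - 2 * int (Suc j)) - geo 3 j * Psi (1 - u j - 3 * int (Suc j)))) UNIV"
      unfolding eq by (rule has_sum_cmult_right[OF inner_has_sum])
  qed
qed

end

text \<open>Properties shared by \<open>pentagonal\<close> and \<open>triangular\<close>. The bounds
  by -3 keep 1 - t(k) - e k at most 4 for e = 1, 2. The slope 7 leaves 5 |k| after the loss of 2 |k|
  from e k, hence one factor \<open>y\<close> per unit of |k|.\<close>

locale moment = small_nome +
  fixes t :: "int \<Rightarrow> int"
  assumes t_nonneg: "t k \<ge> 0" and t_minus: "t (- k) = t k - k"
    and t_growth: "t k \<ge> 7 * \<bar>k\<bar> - 28" and t_low: "t k + k \<ge> -3" "t k + 2 * k \<ge> -3"
begin

definition bil :: "int \<Rightarrow> (int \<Rightarrow> real) \<Rightarrow> real" where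
  "bil e f = (\<Sum>\<^sub>\<infinity>k. (-1) powi k * Psi (1 - t k - e * k) * f k)"

lemma bil_summable:
  assumes e: "e = 1 \<or> e = 2" and f: "\<And>k. \<bar>f k\<bar> \<le> C"
  shows "(\<lambda>k. (-1) powi k * Psi (1 - t k - e * k) * f k) summable_on UNIV"
proof (rule abs_summable_summable, rule summable_on_comparison_test)
  have z: "1 - t k - e * k \<le> 4" for k using e t_low[of k] by auto
  have "(\<lambda>k. 1 * Psi (1 - t k - e * k)) summable_on UNIV"
  proof (rule Psi_summable)
    show "1 * E (- ((1 - t k - e * k) div 5)) \<le> E (- 5) * y ^ nat \<bar>k\<bar>" for k
    proof -
      have "e * k \<ge> - 2 * \<bar>k\<bar>" using e by auto
      then have "1 - t k - e * k \<le> 5 * (5 - \<bar>k\<bar>) + 4" using t_growth[of k] by simp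
      then have "(1 - t k - e * k) div 5 \<le> 5 - \<bar>k\<bar>" by (rule div_5_le)
      then have "E (- ((1 - t k - e * k) div 5)) \<le> E (- 5 + \<bar>k\<bar>)" by (intro E_le) simp
      then show ?thesis using E_add[of "- 5" "\<bar>k\<bar>"] E_nat[of "nat \<bar>k\<bar>"] by simp
    qed
    show "(\<lambda>k::int. E (- 5) * y ^ nat \<bar>k\<bar>) summable_on UNIV"
      by (intro summable_on_cmult_right summable_int_power)
  qed (use z in auto)
  then show "(\<lambda>k. Psi (1 - t k - e * k) * C) summable_on UNIV"
    by (intro summable_on_cmult_left) simp
  have sg: "\<bar>(-1::real) powi k\<bar> = 1" for k by (simp add: power_int_abs[symmetric])
  show "norm ((-1) powi k * Psi (1 - t k - e * k) * f k) \<le> Psi (1 - t k - e * k) * C" for k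
    using Psi_nonneg[OF z[of k]] f[of k] by (simp add: abs_mult sg mult_left_mono)
qed auto

text \<open>As t(-k) = t(k) - k, the terms for k and -k involve only \<open>Psi\<close> at 1 - t(k)
  - c k with c = 1, 2, 3, up to a shift by 5k that produces 1/v. The coefficients 5, -2, -5 result
  from comparing these three values with \<open>geo 2\<close> and \<open>geo 3\<close>.\<close>

lemma moment_difference:
  "moment_sum (\<lambda>j. t (- int (Suc j))) - moment_sum (\<lambda>j. t (int (Suc j))) = 5 * bil 2 hE - 2 * bil 1 psi - 5 * bil 1 hE"
proof -
  let ?F = "\<lambda>e f k. (-1) powi k * Psi (1 - t k - e * k) * f k"
  have h: "?F e hE summable_on UNIV" if "e = 1 \<or> e = 2" for e
    by (rule bil_summable[OF that hE_bound])
  have p: "?F 1 psi summable_on UNIV"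
    by (rule bil_summable[OF _ psi_bound]) simp
  have H: "((\<lambda>j. ?F e hE (int (Suc j)) + ?F e hE (- int (Suc j))) has_sum bil e hE) UNIV" if "e = 1 \<or> e = 2" for e
    unfolding bil_def by (rule infsum_int_split[OF h[OF that]]) (simp add: hE_def)
  have P: "((\<lambda>j. ?F 1 psi (int (Suc j)) + ?F 1 psi (- int (Suc j))) has_sum bil 1 psi) UNIV"
    unfolding bil_def by (rule infsum_int_split[OF p]) (simp add: psi_def)
  have lhs: "((\<lambda>j. (-1) ^ j * (geo 2 j * Psi (1 - t (- int (Suc j)) - 2 * int (Suc j)) - geo 3 j * Psi (1 - t (- int (Suc j)) - 3 * int (Suc j)))
      - (-1) ^ j * (geo 2 j * Psi (1 - t (int (Suc j)) - 2 * int (Suc j)) - geo 3 j * Psi (1 - t (int (Suc j)) - 3 * int (Suc j))))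
     has_sum moment_sum (\<lambda>j. t (- int (Suc j))) - moment_sum (\<lambda>j. t (int (Suc j)))) UNIV"
    by (rule has_sum_diff[OF moment_sum_has_sum moment_sum_has_sum]) (rule t_nonneg)+
  have rhs: "((\<lambda>j. 5 * (?F 2 hE (int (Suc j)) + ?F 2 hE (- int (Suc j))) - 2 * (?F 1 psi (int (Suc j)) + ?F 1 psi (- int (Suc j)))
      - 5 * (?F 1 hE (int (Suc j)) + ?F 1 hE (- int (Suc j)))) has_sum (5 * bil 2 hE - 2 * bil 1 psi - 5 * bil 1 hE)) UNIV"
    by (intro has_sum_diff has_sum_cmult_right H P) auto
  have "(-1) ^ j * (geo 2 j * Psi (1 - t (- int (Suc j)) - 2 * int (Suc j)) - geo 3 j * Psi (1 - t (- int (Suc j)) - 3 * int (Suc j)))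
      - (-1) ^ j * (geo 2 j * Psi (1 - t (int (Suc j)) - 2 * int (Suc j)) - geo 3 j * Psi (1 - t (int (Suc j)) - 3 * int (Suc j)))
    = 5 * (?F 2 hE (int (Suc j)) + ?F 2 hE (- int (Suc j))) - 2 * (?F 1 psi (int (Suc j)) + ?F 1 psi (- int (Suc j)))
      - 5 * (?F 1 hE (int (Suc j)) + ?F 1 hE (- int (Suc j)))" for j
  proof -
    define k where "k = int (Suc j)"
    define v where "v = E k"
    have k: "k \<noteq> 0" by (simp add: k_def)
    then have v: "v \<noteq> 1" "v \<noteq> 0" by (auto simp: v_def)
    have sgk: "(-1::real) powi k = - ((-1) ^ j)" by (simp add: k_def power_int_add)
    have sgmk: "(-1::real) powi (- k) = - ((-1) ^ j)"
      unfolding power_int_minus sgk by (simp add: inverse_neg_one_power)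
    define p1 where "p1 = Psi (1 - t k - k)"
    define p2 where "p2 = Psi (1 - t k - 2 * k)"
    define p3 where "p3 = Psi (1 - t k - 3 * k)"
    have e1: "Psi (1 - t (- k) - 2 * k) = p1" "Psi (1 - t (- k) - 3 * k) = p2"
      unfolding t_minus p1_def p2_def by (simp_all add: algebra_simps)
    have s2: "Psi (1 - t (- k) - 2 * (- k)) = p2 / v"
    proof -
      have "1 - t (- k) - 2 * (- k) = (1 - t k - 2 * k) - 5 * (- k)" by (simp add: t_minus)
      then show ?thesis unfolding p2_def v_def by (simp only: Psi_shift) (simp add: E_minus field_simps)
    qed
    have s3: "Psi (1 - t (- k) - 1 * (- k)) = p3 / v"
    proof -
      have "1 - t (- k) - 1 * (- k) = (1 - t k - 3 * k) - 5 * (- k)" by (simp add: t_minus)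
      then show ?thesis unfolding p3_def v_def by (simp only: Psi_shift) (simp add: E_minus field_simps)
    qed
    have hk: "hE k = v / (1 - v)\<^sup>2" using k by (simp add: hE_def v_def)
    have pk: "psi k = 1 / (1 - v)" using k by (simp add: psi_def v_def)
    have pmk: "psi (- k) = - v / (1 - v)"
      using k v by (simp add: psi_def E_minus v_def[symmetric] divide_simps)
        (simp add: algebra_simps)?
    have g: "geo e j = e / (1 - v) + 5 * (v / (1 - v)\<^sup>2)" for e
      unfolding geo_def k_def[symmetric] hk v_def[symmetric] by (rule refl)
    have nz: "1 - v \<noteq> 0" using v by simp
    define a where "a = 1 / (1 - v)"
    define h where "h = v / (1 - v)\<^sup>2"
    have "a = (1 - v) / (1 - v)\<^sup>2" using nz by (simp add: a_def power2_eq_square)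
    moreover have "h / v = 1 / (1 - v)\<^sup>2" using v by (simp add: h_def)
    ultimately have hv: "h / v = h + a" by (simp add: h_def add_divide_distrib[symmetric])
    have f: "p2 / v * h = p2 * (h + a)" "p3 / v * h = p3 * (h + a)" "p3 / v * (- v / (1 - v)) = - p3 * a"
      using v by (simp_all add: hv[symmetric]) (simp add: a_def)
    have "(-1) ^ j * (geo 2 j * p1 - geo 3 j * p2) - (-1) ^ j * (geo 2 j * p2 - geo 3 j * p3) =
      5 * (- ((-1) ^ j) * p2 * h + - ((-1) ^ j) * (p2 / v) * h) - 2 * (- ((-1) ^ j) * p1 * a + - ((-1) ^ j) * (p3 / v) * (- v / (1 - v)))
      - 5 * (- ((-1) ^ j) * p1 * h + - ((-1) ^ j) * (p3 / v) * h)"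
      unfolding mult.assoc f unfolding g h_def[symmetric] using a_def by (simp add: algebra_simps)
    then show ?thesis
      unfolding k_def[symmetric] e1 s2 s3 s3[unfolded mult_1] sgk sgmk hE_minus hk pk pmk p1_def[symmetric] p2_def[symmetric] p3_def[symmetric] mult_1
        a_def[symmetric] h_def[symmetric] .
  qed
  then show ?thesis using has_sum_unique[OF lhs] rhs by simp
qed

text \<open>Writing k = 5l + b moves the whole dependence on \<open>l\<close> out of
  \<open>Psi\<close> into a power of \<open>y\<close>.\<close>

lemma bil_split:
  assumes e: "e = 1 \<or> e = 2" and f: "\<And>k. \<bar>f k\<bar> \<le> C" and R: "bij_betw (\<lambda>b. b mod 5) R {0..4::int}"
    and t5: "\<And>l b. t (5 * l + b) = t b + 5 * q l b"
  shows "bil e f = (\<Sum>b\<in>R. (-1) powi b * Psi (1 - t b - e * b) * (\<Sum>\<^sub>\<infinity>l. (-1) powi l * E (q l b + e * l) * f (b + 5 * l)))"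
proof -
  let ?F = "\<lambda>k. (-1) powi k * Psi (1 - t k - e * k) * f k"
  have F: "?F summable_on UNIV" by (rule bil_summable[OF e f])
  have "bil e f = (\<Sum>b\<in>R. \<Sum>\<^sub>\<infinity>l. ?F (5 * l + b))"
    unfolding bil_def by (rule infsum_residues_5[OF F R])
  also have "\<dots> = (\<Sum>b\<in>R. (-1) powi b * Psi (1 - t b - e * b) * (\<Sum>\<^sub>\<infinity>l. (-1) powi l * E (q l b + e * l) * f (b + 5 * l)))"
  proof (rule sum.cong[OF refl])
    fix b
    have "(\<Sum>\<^sub>\<infinity>l. ?F (5 * l + b)) = (\<Sum>\<^sub>\<infinity>l. (-1) powi b * Psi (1 - t b - e * b) * ((-1) powi l * E (q l b + e * l) * f (b + 5 * l)))"
    proof (rule infsum_cong)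
      fix l
      have "1 - t (5 * l + b) - e * (5 * l + b) = (1 - t b - e * b) - 5 * (q l b + e * l)"
        unfolding t5 by (simp add: algebra_simps)
      then have "Psi (1 - t (5 * l + b) - e * (5 * l + b)) = E (q l b + e * l) * Psi (1 - t b - e * b)"
        by (simp only: Psi_shift)
      moreover have "(-1::real) powi (5 * l + b) = (-1) powi l * (-1) powi b"
        by (simp add: power_int_add power_int_mult)
      ultimately show "?F (5 * l + b) = (-1) powi b * Psi (1 - t b - e * b) * ((-1) powi l * E (q l b + e * l) * f (b + 5 * l))"
        by (simp add: add.commute mult_ac)
    qed
    also have "\<dots> = (-1) powi b * Psi (1 - t b - e * b) * (\<Sum>\<^sub>\<infinity>l. (-1) powi l * E (q l b + e * l) * f (b + 5 * l))"
      by (rule infsum_cmult_right')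
    finally show "(\<Sum>\<^sub>\<infinity>l. ?F (5 * l + b)) = (-1) powi b * Psi (1 - t b - e * b) * (\<Sum>\<^sub>\<infinity>l. (-1) powi l * E (q l b + e * l) * f (b + 5 * l))" .
  qed
  finally show ?thesis .
qed

end

section \<open>The triple product identity\<close>

definition qq :: "real \<Rightarrow> nat \<Rightarrow> real" where "qq q n = (\<Prod>i=1..n. 1 - q ^ i)"

definition gauss :: "real \<Rightarrow> nat \<Rightarrow> nat \<Rightarrow> real" where
  "gauss q n k = (if k \<le> n then qq q n / (qq q k * qq q (n - k)) else 0)"

context
  fixes q :: real assumes q: "0 < q" "q < 1"
begin

lemma qq_Suc: "qq q (Suc n) = qq q n * (1 - q ^ Suc n)"
  by (simp add: qq_def)

lemma one_minus_power_pos: "i > 0 \<Longrightarrow> 1 - q ^ i > 0"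
  using q by (simp add: power_less_one_iff)

lemma qq_pos: "qq q n > 0"
  unfolding qq_def by (rule prod_pos) (use one_minus_power_pos in auto)

lemma gauss_Pascal: "gauss q (Suc n) (Suc k) = gauss q n (Suc k) + q ^ (n - k) * gauss q n k" if "k \<le> n"
proof (cases "k = n")
  case True
  have "qq q n \<noteq> 0" "qq q (Suc n) \<noteq> 0" using qq_pos[of n] qq_pos[of "Suc n"] by auto
  then show ?thesis using True by (simp add: gauss_def qq_def[of q 0])
next
  case False
  then have "k < n" using that by simp
  then obtain l where n: "n = Suc (k + l)" using less_imp_Suc_add by blast
  have nz: "qq q k \<noteq> 0" "qq q l \<noteq> 0" "qq q n \<noteq> 0" "1 - q ^ Suc k \<noteq> 0" "1 - q ^ Suc l \<noteq> 0"
    using qq_pos[of k] qq_pos[of l] qq_pos[of n] one_minus_power_pos[of "Suc k"] one_minus_power_pos[of "Suc l"] by auto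
  have "gauss q (Suc n) (Suc k) = qq q n * (1 - q ^ Suc n) / (qq q k * (1 - q ^ Suc k) * (qq q l * (1 - q ^ Suc l)))"
    by (simp add: gauss_def n qq_Suc)
  moreover have "gauss q n (Suc k) = qq q n / (qq q k * (1 - q ^ Suc k) * qq q l)"
    by (simp add: gauss_def n qq_Suc)
  moreover have "q ^ (n - k) * gauss q n k = q ^ Suc l * (qq q n / (qq q k * (qq q l * (1 - q ^ Suc l))))"
    by (simp add: gauss_def n qq_Suc)
  moreover have "1 - q ^ Suc n = (1 - q ^ Suc l) + q ^ Suc l * (1 - q ^ Suc k)"
    by (simp add: n power_add algebra_simps)
  then have "qq q n * (1 - q ^ Suc n) / (qq q k * (1 - q ^ Suc k) * (qq q l * (1 - q ^ Suc l))) =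
      qq q n / (qq q k * (1 - q ^ Suc k) * qq q l) + q ^ Suc l * (qq q n / (qq q k * (qq q l * (1 - q ^ Suc l))))"
  proof -
    have "X * (b + w * a) / (K * a * (M * b)) = X / (K * a * M) + w * (X / (K * (M * b)))"
      if "a \<noteq> 0" "b \<noteq> 0" "K \<noteq> 0" "M \<noteq> 0" for X a b w K M :: real
      using that by (simp add: field_simps)
    from this[OF nz(4,5,1,2), of "qq q n" "q ^ Suc l"] show ?thesis
      by (simp only: \<open>1 - q ^ Suc n = (1 - q ^ Suc l) + q ^ Suc l * (1 - q ^ Suc k)\<close>)
  qed
  ultimately show ?thesis by simp
qed

lemma gauss_0 [simp]: "gauss q n 0 = 1"
  using qq_pos[of n] by (simp add: gauss_def qq_def[of q 0])

text \<open>The finite binomial theorem of Rothe and Cauchy; the induction step is the Pascal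
  rule.\<close>

lemma q_binomial: "(\<Prod>i<n. 1 + z * q ^ i) = (\<Sum>k\<le>n. gauss q n k * q ^ (k * (k - 1) div 2) * z ^ k)"
proof (induction n)
  case 0
  then show ?case by simp
next
  case (Suc n)
  let ?a = "\<lambda>k. q ^ (k * (k - 1) div 2) * z ^ k"
  have shift: "?a (Suc k) = ?a k * q ^ k * z" for k
  proof -
    have "Suc k * (Suc k - 1) div 2 = k * (k - 1) div 2 + k"
      by (cases k) (auto simp: algebra_simps)
    then show ?thesis by (simp add: power_add)
  qed
  have "(\<Prod>i<Suc n. 1 + z * q ^ i) = (\<Sum>k\<le>n. gauss q n k * ?a k) * (1 + z * q ^ n)"
    using Suc by (simp add: mult.assoc)
  also have "\<dots> = (\<Sum>k\<le>n. gauss q n k * ?a k) + (\<Sum>k\<le>n. gauss q n k * ?a k * (z * q ^ n))"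
    by (simp only: distrib_left mult_1_right sum_distrib_right)
  also have "(\<Sum>k\<le>n. gauss q n k * ?a k) = (\<Sum>k\<le>Suc n. gauss q n k * ?a k)"
    by (simp add: gauss_def)
  also have "\<dots> = 1 + (\<Sum>k\<le>n. gauss q n (Suc k) * ?a (Suc k))"
    by (subst sum.atMost_Suc_shift) simp
  also have "(\<Sum>k\<le>n. gauss q n k * ?a k * (z * q ^ n)) = (\<Sum>k\<le>n. q ^ (n - k) * gauss q n k * ?a (Suc k))"
  proof (rule sum.cong[OF refl])
    fix k assume "k \<in> {..n}"
    then have "q ^ n = q ^ (n - k) * q ^ k" by (simp add: power_add[symmetric])
    then show "gauss q n k * ?a k * (z * q ^ n) = q ^ (n - k) * gauss q n k * ?a (Suc k)"
      unfolding shift by (simp only: mult_ac)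
  qed
  also have "1 + (\<Sum>k\<le>n. gauss q n (Suc k) * ?a (Suc k)) + (\<Sum>k\<le>n. q ^ (n - k) * gauss q n k * ?a (Suc k)) =
      1 + (\<Sum>k\<le>n. gauss q (Suc n) (Suc k) * ?a (Suc k))"
    by (simp add: sum.distrib[symmetric] gauss_Pascal distrib_right del: power_Suc)
  also have "\<dots> = (\<Sum>k\<le>Suc n. gauss q (Suc n) k * ?a k)"
    by (subst sum.atMost_Suc_shift) simp
  finally show ?case by (simp only: mult.assoc)
qed

end

context nome
begin

lemma E5_power: "(y ^ 5) ^ n = E (5 * int n)"
  using E_nat[of "5 * n"] by (simp add: power_mult)

lemma y5: "0 < y ^ 5" "y ^ 5 < 1"
  using y_pos y_less_1 by (auto simp: power_less_one_iff)

text \<open>The q-binomial theorem with 2N factors and z = -y^(c - 5N). Reflecting the first N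
  factors produces the same sign and power as recentring the sum at N, so both cancel.\<close>

lemma finite_triple_product:
  "(\<Prod>i<N. 1 - E (c + 5 * int i)) * (\<Prod>i<N. 1 - E (5 - c + 5 * int i)) =
    (\<Sum>k=-int N..int N. gauss (y ^ 5) (2 * N) (nat (int N + k)) * ((-1) powi k * E (5 * triangular (- k) + c * k)))"
proof -
  let ?q = "y ^ 5"
  define z where "z = - E (c - 5 * int N)"
  have "(\<Prod>i<2 * N. 1 + z * ?q ^ i) = (\<Prod>i<2 * N. 1 - E (c + 5 * (int i - int N)))"
    unfolding z_def E5_power
    by (rule prod.cong) (simp_all add: E_add[symmetric] algebra_simps)
  also have "\<dots> = (\<Prod>i<N. 1 - E (c - 5 * int (Suc i))) * (\<Prod>i<N. 1 - E (c + 5 * int i))"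
  proof -
    have "(\<Prod>i<2 * N. 1 - E (c + 5 * (int i - int N))) =
        (\<Prod>i\<in>{..<N} \<union> {N..<2*N}. 1 - E (c + 5 * (int i - int N)))"
      by (rule prod.cong) auto
    also have "\<dots> = (\<Prod>i<N. 1 - E (c + 5 * (int i - int N))) * (\<Prod>i=N..<2*N. 1 - E (c + 5 * (int i - int N)))"
      by (rule prod.union_disjoint) auto
    also have "(\<Prod>i<N. 1 - E (c + 5 * (int i - int N))) = (\<Prod>i<N. 1 - E (c - 5 * int (Suc i)))"
      by (rule prod.reindex_bij_witness[where i = "\<lambda>i. N - Suc i" and j = "\<lambda>i. N - Suc i"]) (auto simp: of_nat_diff algebra_simps)
    also have "(\<Prod>i=N..<2*N. 1 - E (c + 5 * (int i - int N))) = (\<Prod>i<N. 1 - E (c + 5 * int i))"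
      by (rule prod.reindex_bij_witness[where i = "\<lambda>i. i + N" and j = "\<lambda>i. i - N"]) (auto simp: of_nat_diff)
    finally show ?thesis .
  qed
  also have "(\<Prod>i<N. 1 - E (c - 5 * int (Suc i))) = (-1) ^ N * E (c * int N - 5 * triangular (int N)) * (\<Prod>i<N. 1 - E (5 - c + 5 * int i))"
  proof (induction N)
    case (Suc N)
    have "1 - E (c - 5 * int (Suc N)) = - E (c - 5 * int (Suc N)) * (1 - E (5 - c + 5 * int N))"
      by (simp add: algebra_simps E_add[symmetric])
    moreover have "E (c * int (Suc N) - 5 * triangular (int (Suc N))) = E (c * int N - 5 * triangular (int N)) * E (c - 5 * int (Suc N))"
      unfolding E_add[symmetric] using two_triangular[of "int N"] two_triangular[of "int (Suc N)"]
      by (intro arg_cong[where f = E]) (simp add: algebra_simps)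
    ultimately show ?case using Suc by simp
  qed (simp add: triangular_def)
  finally have lhs: "(\<Prod>i<2 * N. 1 + z * ?q ^ i) = (-1) ^ N * E (c * int N - 5 * triangular (int N)) *
      ((\<Prod>i<N. 1 - E (c + 5 * int i)) * (\<Prod>i<N. 1 - E (5 - c + 5 * int i)))"
    by (simp only: mult_ac)
  have "(\<Prod>i<2 * N. 1 + z * ?q ^ i) = (\<Sum>k\<le>2 * N. gauss ?q (2 * N) k * ?q ^ (k * (k - 1) div 2) * z ^ k)"
    by (rule q_binomial[OF y5])
  also have "\<dots> = (\<Sum>k=-int N..int N. gauss ?q (2 * N) (nat (int N + k)) * ?q ^ (nat (int N + k) * (nat (int N + k) - 1) div 2) * z ^ nat (int N + k))"
    by (rule sum.reindex_bij_witness[where i = "\<lambda>k. nat (int N + k)" and j = "\<lambda>n. int n - int N"]) auto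
  also have "\<dots> = (\<Sum>k=-int N..int N. (-1) ^ N * E (c * int N - 5 * triangular (int N)) *
      (gauss ?q (2 * N) (nat (int N + k)) * ((-1) powi k * E (5 * triangular (- k) + c * k))))"
  proof (rule sum.cong[OF refl])
    fix k assume k: "k \<in> {-int N..int N}"
    define n where "n = nat (int N + k)"
    have n: "int n = int N + k" using k by (simp add: n_def)
    have t: "int (n * (n - 1) div 2) = triangular (int n - 1)"
      by (cases n) (auto simp: triangular_def zdiv_int mult.commute algebra_simps)
    have "?q ^ (n * (n - 1) div 2) * E (c - 5 * int N) ^ n = E (5 * triangular (int n - 1) + (c - 5 * int N) * int n)"
      unfolding E5_power E_power t by (rule E_add[symmetric])
    also have "5 * triangular (int n - 1) + (c - 5 * int N) * int n = (c * int N - 5 * triangular (int N)) + (5 * triangular (- k) + c * k)"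
      using two_triangular[of "int n - 1"] two_triangular[of "int N"] two_triangular[of "- k"] unfolding n
      by (simp add: algebra_simps)
    finally have Ee: "?q ^ (n * (n - 1) div 2) * E (c - 5 * int N) ^ n = E (c * int N - 5 * triangular (int N)) * E (5 * triangular (- k) + c * k)"
      by (simp only: E_add)
    have "(-1::real) ^ n = (-1) powi (int N + k)" using n by (metis power_int_of_nat)
    also have "\<dots> = (-1) ^ N * (-1) powi k" by (simp add: power_int_add)
    finally have sg: "(-1::real) ^ n = (-1) ^ N * (-1) powi k" .
    have "z ^ n = (-1) ^ n * E (c - 5 * int N) ^ n" unfolding z_def by (rule power_minus)
    then have "?q ^ (n * (n - 1) div 2) * z ^ n = (-1) ^ n * (?q ^ (n * (n - 1) div 2) * E (c - 5 * int N) ^ n)" by simp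
    then have eq: "?q ^ (n * (n - 1) div 2) * z ^ n = (-1) ^ N * E (c * int N - 5 * triangular (int N)) * ((-1) powi k * E (5 * triangular (- k) + c * k))"
      unfolding Ee sg by simp
    show "gauss ?q (2 * N) (nat (int N + k)) * ?q ^ (nat (int N + k) * (nat (int N + k) - 1) div 2) * z ^ nat (int N + k) =
      (-1) ^ N * E (c * int N - 5 * triangular (int N)) * (gauss ?q (2 * N) (nat (int N + k)) * ((-1) powi k * E (5 * triangular (- k) + c * k)))"
      unfolding n_def[symmetric] mult.assoc[of "gauss ?q (2 * N) n"] eq by (simp only: mult_ac)
  qed
  also have "\<dots> = (-1) ^ N * E (c * int N - 5 * triangular (int N)) *
      (\<Sum>k=-int N..int N. gauss ?q (2 * N) (nat (int N + k)) * ((-1) powi k * E (5 * triangular (- k) + c * k)))"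
    by (rule sum_distrib_left[symmetric])
  finally show ?thesis unfolding lhs by simp
qed

definition theta :: "int \<Rightarrow> real" where
  "theta c = (\<Sum>\<^sub>\<infinity>k. (-1) powi k * E (5 * triangular (- k) + c * k))"

lemma abs_sgn_powi: "\<bar>(-1::real) powi k\<bar> = 1"
  by (simp add: power_int_abs[symmetric])

lemma theta_summable: "(\<lambda>k. E (5 * triangular (- k) + c * k)) summable_on UNIV"
proof -
  have "(\<lambda>k. E (k * (c - 5) + 5 * int 1 * triangular k)) summable_on UNIV"
    by (rule summable_quadratic) simp
  moreover have "5 * triangular (- k) + c * k = k * (c - 5) + 5 * int 1 * triangular k" for k
    using two_triangular[of k] two_triangular[of "- k"] by (simp add: algebra_simps)
  ultimately show ?thesis by simp
qed

lemma qq_limit: "\<exists>L>0. qq (y ^ 5) \<longlonglongrightarrow> L \<and> (\<forall>n. L \<le> qq (y ^ 5) n)"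
proof -
  have eq: "qq (y ^ 5) = (\<lambda>n. \<Prod>m<n. fc (5 + 5 * int m))"
  proof
    fix n
    show "qq (y ^ 5) n = (\<Prod>m<n. fc (5 + 5 * int m))"
      unfolding qq_def E5_power
      by (rule prod.reindex_bij_witness[where i = Suc and j = "\<lambda>i. i - 1"]) (auto simp: fc_def of_nat_diff algebra_simps)
  qed
  have lim: "qq (y ^ 5) \<longlonglongrightarrow> half_prod 5" unfolding eq by (rule LIMSEQ_half_lessThan)
  have dec: "decseq (qq (y ^ 5))"
  proof (rule decseq_SucI)
    fix n
    have "y ^ 5 * (y ^ 5) ^ n \<ge> 0" using y_pos by simp
    then show "qq (y ^ 5) (Suc n) \<le> qq (y ^ 5) n"
      using qq_pos[OF y5, of n] by (simp add: qq_Suc[OF y5] mult_left_le)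
  qed
  have ge: "half_prod 5 \<le> qq (y ^ 5) n" for n by (rule decseq_ge[OF dec lim])
  have "half_prod 5 \<ge> 0"
    by (rule LIMSEQ_le_const[OF lim]) (use qq_pos[OF y5] less_imp_le in blast)
  then have "half_prod 5 > 0" using half_prod_nonzero[of 5] by linarith
  then show ?thesis using lim ge by blast
qed

text \<open>Jacobi's triple product; only the independence of the constant \<open>K\<close> from \<open>c\<close> matters.\<close>

lemma triple_product: "\<exists>K>0. \<forall>c. \<not> 5 dvd c \<longrightarrow> theta c = K * bt c"
proof -
  obtain L where L: "L > 0" "qq (y ^ 5) \<longlonglongrightarrow> L" "\<And>n. L \<le> qq (y ^ 5) n"
    using qq_limit by blast
  have qq1: "qq (y ^ 5) n \<le> 1" for n
    unfolding qq_def by (rule prod_le_1) (use y_pos y_less_1 in \<open>auto intro!: power_le_one\<close>)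
  have "theta c = L * bt c" if c: "\<not> 5 dvd c" for c
  proof -
    let ?f = "\<lambda>N k. gauss (y ^ 5) (2 * N) (nat (int N + k)) * ((-1) powi k * E (5 * triangular (- k) + c * k))"
    have g: "gauss (y ^ 5) (2 * N) (nat (int N + k)) = qq (y ^ 5) (2 * N) / (qq (y ^ 5) (nat (int N + k)) * qq (y ^ 5) (nat (int N - k)))"
      if "\<bar>k\<bar> \<le> int N" for N k
    proof -
      have "nat (int N + k) \<le> 2 * N" "2 * N - nat (int N + k) = nat (int N - k)" using that by auto
      then show ?thesis by (simp add: gauss_def)
    qed
    \<comment> \<open>At a fixed distance from the centre the Gaussian coefficients tend to 1/L, and
      all are bounded by 1/L^2, where L is the limit of (q; q)_n.\<close>
    have "(\<lambda>N. \<Sum>k=-int N..int N. ?f N k) \<longlonglongrightarrow> (\<Sum>\<^sub>\<infinity>k. (1 / L) * ((-1) powi k * E (5 * triangular (- k) + c * k)))"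
    proof (rule tannery_int(1))
      show "\<bar>?f N k\<bar> \<le> 1 / (L * L) * E (5 * triangular (- k) + c * k)" if "\<bar>k\<bar> \<le> int N" for N k
      proof -
        have "qq (y ^ 5) (2 * N) / (qq (y ^ 5) (nat (int N + k)) * qq (y ^ 5) (nat (int N - k))) \<le> 1 / (L * L)"
          using L qq1 by (intro frac_le mult_mono) (auto intro: less_imp_le order_trans)
        moreover have "qq (y ^ 5) (2 * N) / (qq (y ^ 5) (nat (int N + k)) * qq (y ^ 5) (nat (int N - k))) \<ge> 0"
          using qq_pos[OF y5] by (simp add: less_imp_le)
        ultimately show ?thesis
          unfolding g[OF that] abs_mult abs_sgn_powi by (simp only: abs_of_nonneg E_nonneg mult_1) (intro mult_right_mono E_nonneg)
      qed
      show "(\<lambda>k. 1 / (L * L) * E (5 * triangular (- k) + c * k)) summable_on UNIV"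
        by (rule summable_on_cmult_right[OF theta_summable])
      show "(\<lambda>N. ?f N k) \<longlonglongrightarrow> (1 / L) * ((-1) powi k * E (5 * triangular (- k) + c * k))" for k
      proof (rule tendsto_mult_right)
        have "(\<lambda>N. qq (y ^ 5) (2 * N)) \<longlonglongrightarrow> L"
          by (rule filterlim_compose[OF L(2)]) (simp add: filterlim_subseq strict_mono_def)
        then have "(\<lambda>N. qq (y ^ 5) (2 * N) / (qq (y ^ 5) (nat (int N + k)) * qq (y ^ 5) (nat (int N - k)))) \<longlonglongrightarrow> L / (L * L)"
          using filterlim_compose[OF L(2) filterlim_nat_shift[of k]] filterlim_compose[OF L(2) filterlim_nat_shift[of "- k"]] L(1)
          by (intro tendsto_divide tendsto_mult) auto
        then have "(\<lambda>N. qq (y ^ 5) (2 * N) / (qq (y ^ 5) (nat (int N + k)) * qq (y ^ 5) (nat (int N - k)))) \<longlonglongrightarrow> 1 / L"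
          using L(1) by simp
        moreover have "\<forall>\<^sub>F N in sequentially. qq (y ^ 5) (2 * N) / (qq (y ^ 5) (nat (int N + k)) * qq (y ^ 5) (nat (int N - k))) = gauss (y ^ 5) (2 * N) (nat (int N + k))"
          using eventually_ge_at_top[of "nat \<bar>k\<bar>"] by eventually_elim (rule g[symmetric], linarith)
        ultimately show "(\<lambda>N. gauss (y ^ 5) (2 * N) (nat (int N + k))) \<longlonglongrightarrow> 1 / L"
          by (rule Lim_transform_eventually)
      qed
    qed
    also have "(\<Sum>\<^sub>\<infinity>k. (1 / L) * ((-1) powi k * E (5 * triangular (- k) + c * k))) = (1 / L) * theta c"
      unfolding theta_def by (rule infsum_cmult_right')
    finally have 1: "(\<lambda>N. (\<Prod>i<N. 1 - E (c + 5 * int i)) * (\<Prod>i<N. 1 - E (5 - c + 5 * int i))) \<longlonglongrightarrow> (1 / L) * theta c"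
      unfolding finite_triple_product .
    have "1 - E (c + 5 * int i) = fc (c + 5 * int i)" "1 - E (5 - c + 5 * int i) = fc (5 - c + 5 * int i)" for i
    proof -
      have "c + 5 * int i \<noteq> 0" "5 - c + 5 * int i \<noteq> 0"
        using c by (metis add.commute add_eq_0_iff dvd_minus_iff dvd_triv_left)
          (use c in presburger)
      then show "1 - E (c + 5 * int i) = fc (c + 5 * int i)" "1 - E (5 - c + 5 * int i) = fc (5 - c + 5 * int i)"
        by (simp_all add: fc_def)
    qed
    then have "(\<lambda>N. (\<Prod>i<N. 1 - E (c + 5 * int i)) * (\<Prod>i<N. 1 - E (5 - c + 5 * int i))) \<longlonglongrightarrow> bt c"
      unfolding bt_def using tendsto_mult[OF LIMSEQ_half_lessThan[of c] LIMSEQ_half_lessThan[of "5 - c"]] by simp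
    from LIMSEQ_unique[OF this 1] show ?thesis using L(1) by (simp add: field_simps)
  qed
  then show ?thesis using L(1) by blast
qed

end

section \<open>The quintuple product identity and the relations between the series\<close>

lemma infsum_two_parametrizations:
  fixes h :: "int \<times> int \<Rightarrow> real"
  assumes h: "h summable_on UNIV" and "inj \<phi>" "inj \<psi>" "range \<phi> \<inter> range \<psi> = {}" "range \<phi> \<union> range \<psi> = UNIV"
  shows "infsum h UNIV = infsum (\<lambda>x. h (\<phi> x)) UNIV + infsum (\<lambda>x. h (\<psi> x)) UNIV"
proof -
  have h': "h summable_on A" for A by (rule summable_on_subset_banach[OF h]) simp
  have "infsum h (range \<phi> \<union> range \<psi>) = infsum h (range \<phi>) + infsum h (range \<psi>)"
    by (rule infsum_Un_disjoint[OF h' h' assms(4)])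
  then show ?thesis
    using assms by (simp add: infsum_reindex comp_def)
qed

text \<open>The lattice is split by the parity of the coordinate sum.\<close>

lemma infsum_parity:
  fixes h :: "int \<times> int \<Rightarrow> real"
  assumes h: "h summable_on UNIV"
  shows "infsum h UNIV = (\<Sum>\<^sub>\<infinity>(l,w). h (l, 2 * w - l)) + (\<Sum>\<^sub>\<infinity>(l,w). h (l, 2 * w + 1 - l))"
proof -
  let ?\<phi> = "\<lambda>(l,w). (l, 2 * w - l) :: int \<times> int" and ?\<psi> = "\<lambda>(l,w). (l, 2 * w + 1 - l) :: int \<times> int"
  have "infsum h UNIV = infsum (\<lambda>x. h (?\<phi> x)) UNIV + infsum (\<lambda>x. h (?\<psi> x)) UNIV"
  proof (rule infsum_two_parametrizations[OF h])
    show "inj ?\<phi>" "inj ?\<psi>" by (auto simp: inj_on_def)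
    show "range ?\<phi> \<inter> range ?\<psi> = {}"
    proof -
      have "2 * w - l \<noteq> 2 * w' + 1 - l" for w w' l :: int by presburger
      then show ?thesis by auto
    qed
    show "range ?\<phi> \<union> range ?\<psi> = UNIV"
    proof (rule set_eqI, clarify)
      fix l j :: int
      have "j = 2 * ((l + j) div 2) - l \<or> j = 2 * ((l + j) div 2) + 1 - l" by presburger
      then consider w where "j = 2 * w - l" | w where "j = 2 * w + 1 - l" by blast
      then show "(l, j) \<in> range ?\<phi> \<union> range ?\<psi> \<longleftrightarrow> (l, j) \<in> UNIV"
      proof cases
        case 1 then have "(l, j) = ?\<phi> (l, w)" by simp
        then show ?thesis by blast
      next
        case 2 then have "(l, j) = ?\<psi> (l, w)" by simp
        then show ?thesis by blast
      qed
    qed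
  qed
  then show ?thesis by (simp add: case_prod_unfold)
qed

text \<open>Again a splitting by the parity of the coordinate sum, now in rotated coordinates that
  match the remaining terms in \<open>quint_theta\<close>.\<close>

lemma infsum_rotated:
  fixes g :: "int \<times> int \<Rightarrow> real"
  assumes g: "g summable_on UNIV"
  shows "infsum g UNIV = (\<Sum>\<^sub>\<infinity>(l,w). g (l + w, w - l)) + (\<Sum>\<^sub>\<infinity>(l,w). g (l + w + 1, l - w))"
proof -
  let ?\<phi> = "\<lambda>(l,w). (l + w, w - l) :: int \<times> int" and ?\<psi> = "\<lambda>(l,w). (l + w + 1, l - w) :: int \<times> int"
  have "infsum g UNIV = infsum (\<lambda>x. g (?\<phi> x)) UNIV + infsum (\<lambda>x. g (?\<psi> x)) UNIV"
  proof (rule infsum_two_parametrizations[OF g])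
    show "inj ?\<phi>" "inj ?\<psi>" by (auto simp: inj_on_def)
    show "range ?\<phi> \<inter> range ?\<psi> = {}"
    proof -
      have "\<not> (l + w = l' + w' + 1 \<and> w - l = l' - w')" for w w' l l' :: int by presburger
      then show ?thesis by fastforce
    qed
    show "range ?\<phi> \<union> range ?\<psi> = UNIV"
    proof (rule set_eqI, clarify)
      fix m s :: int
      have "m + s = 2 * ((m + s) div 2) \<or> m + s = 2 * ((m + s) div 2) + 1" by presburger
      then consider w where "m + s = 2 * w" | w where "m + s = 2 * w + 1" by blast
      then show "(m, s) \<in> range ?\<phi> \<union> range ?\<psi> \<longleftrightarrow> (m, s) \<in> UNIV"
      proof cases
        case 1 then have "(m, s) = ?\<phi> (m - w, w)" by simp
        then show ?thesis by blast
      next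
        case 2 then have "(m, s) = ?\<psi> (w, m - w - 1)" by simp
        then show ?thesis by blast
      qed
    qed
  qed
  then show ?thesis by (simp add: case_prod_unfold)
qed

lemma product_has_sum:
  fixes f g :: "int \<Rightarrow> real"
  assumes f: "(\<lambda>x. \<bar>f x\<bar>) summable_on UNIV" and g: "(\<lambda>x. \<bar>g x\<bar>) summable_on UNIV"
  shows "((\<lambda>(x, z). f x * g z) has_sum infsum f UNIV * infsum g UNIV) UNIV"
proof -
  have f': "f summable_on UNIV" and g': "g summable_on UNIV"
    using f g by (auto intro: abs_summable_summable)
  have "(\<lambda>p. norm (case p of (x, z) \<Rightarrow> f x * g z)) summable_on UNIV \<times> UNIV"
  proof (rule summable_on_SigmaI)
    show "((\<lambda>z. norm (case (x, z) of (x, z) \<Rightarrow> f x * g z)) has_sum \<bar>f x\<bar> * infsum (\<lambda>z. \<bar>g z\<bar>) UNIV) UNIV" for x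
      using has_sum_cmult_right[OF has_sum_infsum[OF g], of "\<bar>f x\<bar>"] by (simp add: abs_mult)
    show "(\<lambda>x. \<bar>f x\<bar> * infsum (\<lambda>z. \<bar>g z\<bar>) UNIV) summable_on UNIV"
      by (rule summable_on_cmult_left[OF f])
  qed auto
  then have "(\<lambda>(x, z). f x * g z) summable_on UNIV \<times> UNIV" by (rule abs_summable_summable)
  then have "((\<lambda>(x, z). f x * g z) has_sum infsum f UNIV * infsum g UNIV) (UNIV \<times> UNIV)"
    by (intro has_sum_SigmaI[where g = "\<lambda>x. f x * infsum g UNIV"])
      (auto intro: has_sum_cmult_right has_sum_cmult_left has_sum_infsum f' g')
  then show ?thesis by simp
qed

context nome
begin

text \<open>The series side of the quintuple product with z = y^c and q = y^5; by
  \<open>quint_theta\<close> it plays the role of \<open>euler5\<close> times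
  theta(z^2)/theta(z).\<close>

definition quint :: "int \<Rightarrow> real" where
  "quint c = (\<Sum>\<^sub>\<infinity>l. (-1) powi l * E (5 * pentagonal (- l) + 3 * c * l)) +
             (\<Sum>\<^sub>\<infinity>l. (-1) powi l * E (5 * pentagonal (- l) + 3 * c * l + c + 5 * l))"

definition euler5 :: real where
  "euler5 = (\<Sum>\<^sub>\<infinity>s. (-1) powi s * E (5 * pentagonal (- s)))"

lemma pentagonal_summable: "(\<lambda>l. E (5 * pentagonal (- l) + a * l + b)) summable_on UNIV"
proof -
  have "(\<lambda>l. E b * E (l * (a - 10) + 5 * int 3 * triangular l)) summable_on UNIV"
    by (intro summable_on_cmult_right summable_quadratic) simp
  moreover have "5 * pentagonal (- l) + a * l + b = b + (l * (a - 10) + 5 * int 3 * triangular l)" for l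
    using two_pentagonal[of "- l"] two_triangular[of l] by (simp add: algebra_simps)
  ultimately show ?thesis by (simp only: E_add)
qed

lemma abs_signed: "\<bar>(-1) powi k * E i\<bar> = E i"
  by (simp add: abs_mult abs_sgn_powi)

lemma signed_mult: "((-1) powi k * E i) * ((-1) powi l * E j) = (-1) powi (k + l) * E (i + j)"
  by (simp add: power_int_add E_add)

lemma powi_even: "(-1::real) powi (2 * k) = 1" by (simp add: power_int_mult)
lemma powi_odd: "(-1::real) powi (2 * k + 1) = -1" by (simp add: power_int_add power_int_mult)

lemma signed_product_has_sum:
  assumes "(\<lambda>l. E (p l)) summable_on UNIV" "(\<lambda>l. E (q l)) summable_on UNIV"
  shows "((\<lambda>(l, j). (-1) powi (l + j) * E (p l + q j)) has_sum
    (\<Sum>\<^sub>\<infinity>l. (-1) powi l * E (p l)) * (\<Sum>\<^sub>\<infinity>l. (-1) powi l * E (q l))) UNIV"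
proof -
  have "((\<lambda>(l, j). ((-1) powi l * E (p l)) * ((-1) powi j * E (q j))) has_sum
    (\<Sum>\<^sub>\<infinity>l. (-1) powi l * E (p l)) * (\<Sum>\<^sub>\<infinity>l. (-1) powi l * E (q l))) UNIV"
    by (rule product_has_sum) (simp_all only: abs_signed assms)
  then show ?thesis by (simp only: signed_mult)
qed

text \<open>The quintuple product identity, as a consequence of the triple product: expand both sides as
  double series and compare after splitting by parity.\<close>

lemma quint_theta: "quint c * theta c = euler5 * theta (2 * c)"
proof -
  define p where "p = (\<lambda>l. 5 * pentagonal (- l) + 3 * c * l)"
  define p' where "p' = (\<lambda>l. 5 * pentagonal (- l) + 3 * c * l + c + 5 * l)"
  define th where "th = (\<lambda>k. 5 * triangular (- k) + c * k)"
  define th2 where "th2 = (\<lambda>k. 5 * triangular (- k) + (2 * c) * k)"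
  define pe where "pe = (\<lambda>s. 5 * pentagonal (- s))"
  have sp: "(\<lambda>l. E (p l)) summable_on UNIV" "(\<lambda>l. E (p' l)) summable_on UNIV" "(\<lambda>l. E (pe l)) summable_on UNIV"
    "(\<lambda>l. E (th l)) summable_on UNIV" "(\<lambda>l. E (th2 l)) summable_on UNIV"
    using pentagonal_summable[of "3 * c" 0] pentagonal_summable[of "3 * c + 5" c] pentagonal_summable[of 0 0]
      theta_summable[of c] theta_summable[of "2 * c"]
    by (simp_all add: p_def p'_def pe_def th_def th2_def algebra_simps)
  define f1 where "f1 = (\<lambda>(l,j). (-1) powi (l + j) * E (p l + th j))"
  define f2 where "f2 = (\<lambda>(l,j). (-1) powi (l + j) * E (p' l + th j))"
  define g where "g = (\<lambda>(m,s). (-1) powi (m + s) * E (th2 m + pe s))"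
  have F1: "(f1 has_sum infsum (\<lambda>l. (-1) powi l * E (p l)) UNIV * theta c) UNIV"
    and F2: "(f2 has_sum infsum (\<lambda>l. (-1) powi l * E (p' l)) UNIV * theta c) UNIV"
    and G: "(g has_sum theta (2 * c) * euler5) UNIV"
    using signed_product_has_sum[OF sp(1,4)] signed_product_has_sum[OF sp(2,4)] signed_product_has_sum[OF sp(5,3)]
    unfolding f1_def f2_def g_def theta_def euler5_def th_def th2_def pe_def by simp_all
  have s1: "f1 summable_on UNIV" and s2: "f2 summable_on UNIV" and sg: "g summable_on UNIV"
    using F1 F2 G by (auto simp: summable_on_def)
  have e1: "f1 (l, 2 * w - l) = g (l + w, w - l)" for l w
  proof -
    have "p l + th (2 * w - l) = th2 (l + w) + pe (w - l)"
      using two_pentagonal[of "- l"] two_triangular[of "- (2 * w - l)"] two_triangular[of "- (l + w)"] two_pentagonal[of "- (w - l)"]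
      by (simp add: p_def th_def th2_def pe_def algebra_simps)
    moreover have "(-1::real) powi (l + (2 * w - l)) = 1" "(-1::real) powi ((l + w) + (w - l)) = 1"
      using powi_even[of w] by simp_all
    ultimately show ?thesis by (simp add: f1_def g_def)
  qed
  have e2: "f2 (l, 2 * w + 1 - l) = g (l + w + 1, l - w)" for l w
  proof -
    have "p' l + th (2 * w + 1 - l) = th2 (l + w + 1) + pe (l - w)"
      using two_pentagonal[of "- l"] two_triangular[of "- (2 * w + 1 - l)"] two_triangular[of "- (l + w + 1)"] two_pentagonal[of "- (l - w)"]
      by (simp add: p'_def th_def th2_def pe_def algebra_simps)
    moreover have "l + (2 * w + 1 - l) = 2 * w + 1" "(l + w + 1) + (l - w) = 2 * l + 1" by simp_all
    ultimately show ?thesis unfolding f2_def g_def prod.case by (simp only: powi_odd)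
  qed
  \<comment> \<open>The odd terms of \<open>f1\<close> cancel the even terms of \<open>f2\<close>
    after exchanging the coordinates; what remains are the two halves of \<open>g\<close>.\<close>
  have e3: "f1 (l, 2 * w + 1 - l) = - f2 (w, 2 * l - w)" for l w
  proof -
    have "p l + th (2 * w + 1 - l) = p' w + th (2 * l - w)"
      using two_pentagonal[of "- l"] two_triangular[of "- (2 * w + 1 - l)"] two_triangular[of "- (2 * l - w)"] two_pentagonal[of "- w"]
      by (simp add: p_def p'_def th_def algebra_simps)
    moreover have "l + (2 * w + 1 - l) = 2 * w + 1" "w + (2 * l - w) = 2 * l" by simp_all
    ultimately show ?thesis unfolding f1_def f2_def prod.case by (simp only: powi_odd powi_even)
  qed
  have "quint c * theta c = infsum f1 UNIV + infsum f2 UNIV"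
    unfolding infsumI[OF F1] infsumI[OF F2] quint_def p_def p'_def by (simp add: distrib_right)
  also have "\<dots> = (\<Sum>\<^sub>\<infinity>(l,w). f1 (l, 2 * w - l)) + (\<Sum>\<^sub>\<infinity>(l,w). f1 (l, 2 * w + 1 - l))
      + ((\<Sum>\<^sub>\<infinity>(l,w). f2 (l, 2 * w - l)) + (\<Sum>\<^sub>\<infinity>(l,w). f2 (l, 2 * w + 1 - l)))"
    by (simp only: infsum_parity[OF s1] infsum_parity[OF s2])
  also have "(\<Sum>\<^sub>\<infinity>(l,w). f1 (l, 2 * w + 1 - l)) = - (\<Sum>\<^sub>\<infinity>(l,w). f2 (l, 2 * w - l))"
  proof -
    have "(\<Sum>\<^sub>\<infinity>(l,w). f1 (l, 2 * w + 1 - l)) = - (\<Sum>\<^sub>\<infinity>(l,w). f2 (w, 2 * l - w))"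
      unfolding e3 case_prod_unfold by (rule infsum_uminus)
    also have "(\<Sum>\<^sub>\<infinity>(l,w). f2 (w, 2 * l - w)) = (\<Sum>\<^sub>\<infinity>(l,w). f2 (l, 2 * w - l))"
      by (rule infsum_reindex_bij_witness[where i = prod.swap and j = prod.swap]) auto
    finally show ?thesis .
  qed
  also have "(\<Sum>\<^sub>\<infinity>(l,w). f1 (l, 2 * w - l)) = (\<Sum>\<^sub>\<infinity>(l,w). g (l + w, w - l))"
    unfolding e1 ..
  also have "(\<Sum>\<^sub>\<infinity>(l,w). f2 (l, 2 * w + 1 - l)) = (\<Sum>\<^sub>\<infinity>(l,w). g (l + w + 1, l - w))"
    unfolding e2 ..
  finally have "quint c * theta c = infsum g UNIV"
    using infsum_rotated[OF sg] by simp
  then show ?thesis unfolding infsumI[OF G] by simp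
qed

text \<open>At c = 2 the right side involves \<open>bt 4 = bt 1\<close>, so the two quotients are
  mutually inverse: with A = bt 2 / bt 1, \<open>quint 1\<close> and \<open>quint 2\<close> are
  \<open>euler5\<close> times A and 1/A.\<close>

lemma quint_1: "quint 1 * bt 1 = euler5 * bt 2" and quint_2: "quint 2 * bt 2 = euler5 * bt 1"
proof -
  obtain K where K: "K > 0" "\<And>c. \<not> 5 dvd c \<Longrightarrow> theta c = K * bt c" using triple_product by blast
  show "quint 1 * bt 1 = euler5 * bt 2"
    using quint_theta[of 1] K(1) by (simp add: K(2))
  have "bt 4 = bt 1" using bt_reflect[of 1] by simp
  then show "quint 2 * bt 2 = euler5 * bt 1"
    using quint_theta[of 2] K(1) by (simp add: K(2))
qed

end

context small_nome
begin

text \<open>The 5-dissection of Euler's theorem. The representatives 0, 1, 2, -2, -1 have pentagonal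
  numbers 0, 2, 7, 5, 1; grouping 0 with 5 and 2 with 7 gives \<open>quint 1\<close> and
  \<open>quint 2\<close>, while 1 alone gives \<open>euler5\<close>.\<close>

lemma Psi_recurrence:
  assumes r: "0 \<le> r" "r \<le> 4"
  shows "Psi r * quint 1 - Psi (r - 1) * euler5 - Psi (r - 2) * quint 2 = (if r = 0 then 1 else 0)"
proof -
  define qd where "qd l = (15 * l\<^sup>2 + l) div 2" for l :: int
  have qd: "2 * qd l = 15 * l\<^sup>2 + l" for l
  proof -
    have "even (15 * l\<^sup>2 + l)" by simp
    then show ?thesis by (simp add: qd_def)
  qed
  define V where "V b = (\<Sum>\<^sub>\<infinity>l. (-1) powi l * E (qd l + 3 * l * b))" for b
  let ?F = "\<lambda>k. (-1) powi k * Psi (r - pentagonal k)"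
  have "?F summable_on UNIV"
  proof (rule abs_summable_summable)
    have "norm (?F k) = Psi (r - pentagonal k)" for k
      using Psi_nonneg[of "r - pentagonal k"] pentagonal_nonneg[of k] r by (simp add: abs_mult abs_sgn_powi)
    then show "(\<lambda>k. norm (?F k)) summable_on UNIV"
      using Psi_pentagonal_summable[OF r] by simp
  qed
  have R: "bij_betw (\<lambda>b. b mod 5) {0, 1, 2, -2, -1} {0..4::int}"
  proof -
    have "{0..4::int} = {0, 1, 2, 3, 4}" by auto
    then show ?thesis by (auto simp: bij_betw_def inj_on_def)
  qed
  have "infsum ?F UNIV = (\<Sum>b\<in>{0, 1, 2, -2, -1}. \<Sum>\<^sub>\<infinity>l. ?F (5 * l + b))"
    by (rule infsum_residues_5[OF \<open>?F summable_on UNIV\<close> R])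
  also have "\<dots> = (\<Sum>b\<in>{0, 1, 2, -2, -1}. (-1) powi b * Psi (r - pentagonal b) * V b)"
  proof (rule sum.cong[OF refl])
    fix b
    have "?F (5 * l + b) = (-1) powi b * Psi (r - pentagonal b) * ((-1) powi l * E (qd l + 3 * l * b))" for l
    proof -
      have "r - pentagonal (5 * l + b) = (r - pentagonal b) - 5 * (qd l + 3 * l * b)"
        unfolding pentagonal_5 qd_def by simp
      then have "Psi (r - pentagonal (5 * l + b)) = E (qd l + 3 * l * b) * Psi (r - pentagonal b)"
        by (simp only: Psi_shift)
      moreover have "(-1::real) powi (5 * l + b) = (-1) powi l * (-1) powi b"
        by (simp add: power_int_add power_int_mult)
      ultimately show ?thesis by (simp add: mult_ac)
    qed
    then show "(\<Sum>\<^sub>\<infinity>l. ?F (5 * l + b)) = (-1) powi b * Psi (r - pentagonal b) * V b"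
      unfolding V_def by (simp only: infsum_cmult_right')
  qed
  also have "\<dots> = Psi r * V 0 - Psi (r - 2) * V 1 + Psi (r - 7) * V 2 + Psi (r - 5) * V (-2) - Psi (r - 1) * V (-1)"
    by (simp add: pentagonal_def)
  also have "Psi (r - 7) = y * Psi (r - 2)"
    using Psi_shift[of "r - 2" 1] by (simp add: E_def)
  also have "Psi (r - 5) = y * Psi r"
    using Psi_shift[of r 1] by (simp add: E_def)
  also have "V (-1) = euler5"
    unfolding V_def euler5_def
  proof (rule infsum_cong)
    fix l
    have "qd l + 3 * l * - 1 = 5 * pentagonal (- l)"
      using qd[of l] two_pentagonal[of "- l"] by (simp add: algebra_simps power2_eq_square)
    then show "(-1) powi l * E (qd l + 3 * l * - 1) = (-1) powi l * E (5 * pentagonal (- l))" by simp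
  qed
  finally have eq: "infsum ?F UNIV = Psi r * (V 0 + y * V (-2)) - Psi (r - 1) * euler5 - Psi (r - 2) * (V 1 - y * V 2)"
    by (simp add: algebra_simps)
  have q1: "V 0 + y * V (-2) = quint 1"
  proof -
    have "V 0 = (\<Sum>\<^sub>\<infinity>l. (-1) powi l * E (5 * pentagonal (- l) + 3 * 1 * l))"
      unfolding V_def
    proof (rule infsum_cong)
      fix l
      have "qd l + 3 * l * 0 = 5 * pentagonal (- l) + 3 * 1 * l"
        using qd[of l] two_pentagonal[of "- l"] by (simp add: algebra_simps power2_eq_square)
      then show "(-1) powi l * E (qd l + 3 * l * 0) = (-1) powi l * E (5 * pentagonal (- l) + 3 * 1 * l)" by simp
    qed
    moreover have "y * V (-2) = (\<Sum>\<^sub>\<infinity>l. (-1) powi l * E (5 * pentagonal (- l) + 3 * 1 * l + 1 + 5 * l))"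
    proof -
      have "y * V (-2) = (\<Sum>\<^sub>\<infinity>l. E 1 * ((-1) powi l * E (qd l + 3 * l * -2)))"
        unfolding V_def by (subst infsum_cmult_right') (simp add: E_def)
      also have "\<dots> = (\<Sum>\<^sub>\<infinity>l. (-1) powi l * E (5 * pentagonal (- l) + 3 * 1 * l + 1 + 5 * l))"
      proof (rule infsum_reindex_bij_witness[where i = uminus and j = uminus])
        fix l :: int
        have "1 + (qd l + 3 * l * -2) = 5 * pentagonal (- (- l)) + 3 * 1 * - l + 1 + 5 * - l"
          using qd[of l] two_pentagonal[of l] by (simp add: algebra_simps power2_eq_square)
        then have eq: "E 1 * E (qd l + 3 * l * -2) = E (5 * pentagonal (- (- l)) + 3 * 1 * - l + 1 + 5 * - l)"
          by (simp only: E_add[symmetric])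
        have "(-1::real) powi (- l) = (-1) powi l"
          by (cases l rule: int_cases2) (simp_all add: power_int_minus inverse_neg_one_power)
        then show "(-1) powi (- l) * E (5 * pentagonal (- (- l)) + 3 * 1 * - l + 1 + 5 * - l) = E 1 * ((-1) powi l * E (qd l + 3 * l * -2))"
          unfolding eq[symmetric] by simp
      qed auto
      finally show ?thesis .
    qed
    ultimately show ?thesis by (simp add: quint_def)
  qed
  have q2: "V 1 - y * V 2 = quint 2"
  proof -
    have "V 1 = (\<Sum>\<^sub>\<infinity>l. (-1) powi l * E (5 * pentagonal (- l) + 3 * 2 * l))"
      unfolding V_def
    proof (rule infsum_cong)
      fix l
      have "qd l + 3 * l * 1 = 5 * pentagonal (- l) + 3 * 2 * l"
        using qd[of l] two_pentagonal[of "- l"] by (simp add: algebra_simps power2_eq_square)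
      then show "(-1) powi l * E (qd l + 3 * l * 1) = (-1) powi l * E (5 * pentagonal (- l) + 3 * 2 * l)" by (simp only:)
    qed
    moreover have "- y * V 2 = (\<Sum>\<^sub>\<infinity>l. (-1) powi l * E (5 * pentagonal (- l) + 3 * 2 * l + 2 + 5 * l))"
    proof -
      have "- y * V 2 = (\<Sum>\<^sub>\<infinity>l. - E 1 * ((-1) powi l * E (qd l + 3 * l * 2)))"
        unfolding V_def by (subst infsum_cmult_right') (simp add: E_def)
      also have "\<dots> = (\<Sum>\<^sub>\<infinity>l. (-1) powi l * E (5 * pentagonal (- l) + 3 * 2 * l + 2 + 5 * l))"
      proof (rule infsum_reindex_bij_witness[where i = "\<lambda>l. - 1 - l" and j = "\<lambda>l. - 1 - l"])
        fix l :: int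
        have "1 + (qd l + 3 * l * 2) = 5 * pentagonal (- (- 1 - l)) + 3 * 2 * (- 1 - l) + 2 + 5 * (- 1 - l)"
          using qd[of l] two_pentagonal[of "- (- 1 - l)"] by (simp add: algebra_simps power2_eq_square)
        then have "E 1 * E (qd l + 3 * l * 2) = E (5 * pentagonal (- (- 1 - l)) + 3 * 2 * (- 1 - l) + 2 + 5 * (- 1 - l))"
          by (simp only: E_add[symmetric])
        moreover have "(-1::real) powi (- 1 - l) = - ((-1) powi l)"
          by (cases l rule: int_cases2) (simp_all add: power_int_diff power_int_minus inverse_neg_one_power inverse_neg_one_power[unfolded inverse_eq_divide])
        ultimately show "(-1) powi (- 1 - l) * E (5 * pentagonal (- (- 1 - l)) + 3 * 2 * (- 1 - l) + 2 + 5 * (- 1 - l)) = - E 1 * ((-1) powi l * E (qd l + 3 * l * 2))"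
          by (metis (no_types, lifting) mult.left_commute mult_minus_left)
      qed auto
      finally show ?thesis .
    qed
    ultimately show ?thesis by (simp add: quint_def)
  qed
  show ?thesis
    using pentagonal_Psi[OF r] unfolding eq q1 q2 .
qed

text \<open>Otherwise both quintuple series vanish as well, and the recurrence for
  \<open>r = 0\<close> reads 0 = 1.\<close>

lemma euler5_nonzero: "euler5 \<noteq> 0"
proof
  assume "euler5 = 0"
  then have "quint 1 = 0" "quint 2 = 0" using quint_1 quint_2 by auto
  then show False using Psi_recurrence[of 0] \<open>euler5 = 0\<close> by simp
qed

text \<open>The quotient bt 2 / bt 1 is, up to the factor y^(1/5), the reciprocal of the
  Rogers-Ramanujan continued fraction.\<close>

lemma Psi_relation:
  assumes "1 \<le> r" "r \<le> 4"
  shows "bt 2 / bt 1 * Psi r = Psi (r - 1) + Psi (r - 2) / (bt 2 / bt 1)"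
proof -
  have "quint 1 = euler5 * (bt 2 / bt 1)" "quint 2 = euler5 / (bt 2 / bt 1)"
    using quint_1 quint_2 by (simp_all add: field_simps)
  then have "euler5 * (bt 2 / bt 1 * Psi r - Psi (r - 1) - Psi (r - 2) / (bt 2 / bt 1)) = 0"
    using Psi_recurrence[of r] assms by (simp add: algebra_simps)
  then show ?thesis using euler5_nonzero by simp
qed

end

section \<open>Evaluation of the bilateral sums\<close>

lemma scaled_sums:
  fixes c :: real and K T :: "int \<Rightarrow> real"
  shows "(\<Sum>b\<in>{b1}. K b * T b) = K 0 * X \<Longrightarrow> c * K b1 = w1 \<Longrightarrow> c * K 0 = v \<Longrightarrow> v * X = R \<Longrightarrow> w1 * T b1 = R"
    and "(\<Sum>b\<in>{b1, b2}. K b * T b) = K 0 * X \<Longrightarrow> b1 \<noteq> b2 \<Longrightarrow> c * K b1 = w1 \<Longrightarrow> c * K b2 = w2 \<Longrightarrow>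
      c * K 0 = v \<Longrightarrow> v * X = R \<Longrightarrow> w1 * T b1 + w2 * T b2 = R"
    and "(\<Sum>b\<in>{b1, b2, b3}. K b * T b) = K 0 * X \<Longrightarrow> b1 \<notin> {b2, b3} \<Longrightarrow> b2 \<noteq> b3 \<Longrightarrow>
      c * K b1 = w1 \<Longrightarrow> c * K b2 = w2 \<Longrightarrow> c * K b3 = w3 \<Longrightarrow>
      c * K 0 = v \<Longrightarrow> v * X = R \<Longrightarrow> w1 * T b1 + w2 * T b2 + w3 * T b3 = R"
  by (auto simp: mult.assoc distrib_left[symmetric] add.assoc)

context nome
begin

text \<open>\<open>KAP\<close>, \<open>TT\<close>, \<open>LAM\<close> and \<open>HH\<close> restate
  the locale constants with explicit sets. The point is that \<open>TT\<close> depends on them only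
  through \<open>d\<close> and \<open>S\<close>, so expansions with different pole sets share the
  same sums.\<close>

definition KAP :: "int set \<Rightarrow> int set \<Rightarrow> int \<Rightarrow> real" where
  "KAP A B b = (\<Prod>a\<in>A. bt (a - b)) / (\<Prod>b'\<in>B. bt (b' - b))"

definition TT :: "(int \<Rightarrow> real) \<Rightarrow> int \<Rightarrow> int \<Rightarrow> int \<Rightarrow> real" where
  "TT f d S b = (\<Sum>\<^sub>\<infinity>l. (-1) powi l * E (l * (S + d * b) + 5 * d * triangular l) * f (b + 5 * l))"

definition LAM :: "int set \<Rightarrow> int set \<Rightarrow> real" where
  "LAM A B = (\<Sum>a\<in>A. rho a) - (\<Sum>b\<in>B. rho b)"

definition HH :: "int set \<Rightarrow> int set \<Rightarrow> real" where
  "HH A B = (\<Sum>a\<in>A. PP a) - (\<Sum>b\<in>B. PP b)"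

lemma partial_fractions_TT:
  assumes pf: "partial_fractions y A B" and d: "int (card B) - int (card A) = d" "odd d" and S: "\<Sum>A - \<Sum>B = S"
  shows "0 \<notin> B \<Longrightarrow> (\<Sum>b\<in>B. KAP A B b * TT psi d S b) = KAP A B 0 * 1"
    and "0 \<notin> B \<Longrightarrow> (\<Sum>b\<in>B. KAP A B b * TT hE d S b) = KAP A B 0 * LAM A B"
    and "0 \<in> B \<Longrightarrow> (\<Sum>b\<in>B. KAP A B b * TT psi d S b) = KAP A B 0 * (- LAM A B)"
    and "0 \<in> B \<Longrightarrow> (\<Sum>b\<in>B. KAP A B b * TT hE d S b) = KAP A B 0 * (- (1/2) * ((LAM A B)\<^sup>2 - LAM A B - HH A B))"
proof -
  interpret pf: partial_fractions y A B by (rule pf)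
  have d': "int pf.d = d" using d(1) pf.card_less by (simp add: pf.d_def)
  have "odd pf.d" using d(2) d' by (metis even_of_nat)
  then have sg: "pf.sg = -1" by (simp add: pf.sg_def)
  have kap: "pf.kap = KAP A B" by (rule ext) (simp add: pf.kap_def KAP_def)
  have T0: "pf.T0 b = TT psi d S b" and T1: "pf.T1 b = TT hE d S b" for b
    by (simp_all add: pf.T0_def pf.T1_def TT_def pf.wt_def sg pf.S_def S d')
  have L: "pf.Lam = LAM A B" "pf.H = HH A B" by (simp_all add: pf.Lam_def LAM_def pf.H_def HH_def)
  show "0 \<notin> B \<Longrightarrow> (\<Sum>b\<in>B. KAP A B b * TT psi d S b) = KAP A B 0 * 1"
    "0 \<notin> B \<Longrightarrow> (\<Sum>b\<in>B. KAP A B b * TT hE d S b) = KAP A B 0 * LAM A B"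
    "0 \<in> B \<Longrightarrow> (\<Sum>b\<in>B. KAP A B b * TT psi d S b) = KAP A B 0 * (- LAM A B)"
    "0 \<in> B \<Longrightarrow> (\<Sum>b\<in>B. KAP A B b * TT hE d S b) = KAP A B 0 * (- (1/2) * ((LAM A B)\<^sup>2 - LAM A B - HH A B))"
    using pf.regular pf.singular unfolding T0 T1 L kap by auto
qed

lemma partial_fractions_intro:
  assumes "finite A" "finite B" "card A < card B" "\<forall>a\<in>A. a \<noteq> 0 \<and> \<bar>a\<bar> < 5" "\<forall>b\<in>B. \<bar>b\<bar> < 5"
    "\<forall>a\<in>A. \<forall>b\<in>B. a \<noteq> b \<and> \<bar>a - b\<bar> < 5" "\<forall>b\<in>B. \<forall>b'\<in>B. \<bar>b - b'\<bar> < 5"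
  shows "partial_fractions y A B"
  by unfold_locales (use assms in auto)

abbreviation "g1 \<equiv> bt 1"
abbreviation "g2 \<equiv> bt 2"
abbreviation "q2 \<equiv> bt 0"
abbreviation "AA \<equiv> g2 / g1"
abbreviation "uu \<equiv> q2 / g1"

lemma bt_values:
  "bt 3 = g2" "bt 4 = g1" "bt (-1) = - g1 / y" "bt (-2) = - g2 / y ^ 2" "bt (-3) = - g2 / y ^ 3" "bt (-4) = - g1 / y ^ 4"
proof -
  show 3: "bt 3 = g2" and 4: "bt 4 = g1" using bt_reflect[of 2] bt_reflect[of 1] by simp_all
  have E: "E (-1) = 1 / y" "E (-2) = 1 / y ^ 2" "E (-3) = 1 / y ^ 3" "E (-4) = 1 / y ^ 4"
    using E_nat[of 1] E_nat[of 2] E_nat[of 3] E_nat[of 4] E_minus[of 1] E_minus[of 2] E_minus[of 3] E_minus[of 4]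
    by (simp_all add: inverse_eq_divide)
  show "bt (-1) = - g1 / y" "bt (-2) = - g2 / y ^ 2" "bt (-3) = - g2 / y ^ 3" "bt (-4) = - g1 / y ^ 4"
    using bt_minus[of 1] bt_minus[of 2] bt_minus[of 3] bt_minus[of 4] unfolding E 3 4 by simp_all
qed

lemma rho_values:
  "rho 3 = - rho 2" "rho 4 = - rho 1" "rho (-1) = 1 - rho 1" "rho (-2) = 1 - rho 2" "rho (-4) = 1 + rho 1"
proof -
  show "rho 3 = - rho 2" and 4: "rho 4 = - rho 1" using rho_reflect[of 2] rho_reflect[of 1] by simp_all
  show "rho (-1) = 1 - rho 1" "rho (-2) = 1 - rho 2" "rho (-4) = 1 + rho 1"
    using rho_minus[of 1] rho_minus[of 2] rho_minus[of 4] 4 by simp_all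
qed

lemma PP_values: "PP 3 = PP 2" "PP 4 = PP 1" "PP (-1) = PP 1"
  using PP_reflect[of 2] PP_reflect[of 1] PP_minus[of 1] by simp_all

lemma nz: "g1 \<noteq> 0" "g2 \<noteq> 0" "q2 \<noteq> 0" "y \<noteq> 0"
  using y_pos by auto

lemmas list_simps = KAP_def LAM_def HH_def bt_values rho_values PP_values

text \<open>The digits in the names are the elements of the pole set \<open>B\<close>, with \<open>34\<close> standing for the
  representatives \<open>-2, -1\<close>; \<open>c\<close> is the normalization that turns all \<open>KAP A B b\<close> into monomials in \<open>AA\<close> and \<open>y\<close>.\<close>

lemma N014: "AA * TT hE 3 (-5) 0 + (- y) * TT hE 3 (-5) 1 + (y ^ 7) * TT hE 3 (-5) 4
    = - (1/2) * AA * (PP 0 + 2 * PP 1)"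
  by (rule scaled_sums(3)[OF partial_fractions_TT(4)[OF partial_fractions_intro[of "{}" "{0,1,4}"]], where c = "q2 * g1 * g2" and v = "AA"])
    (use nz in \<open>auto simp: list_simps field_simps power_numeral_reduce\<close>)

lemma N023: "(1 / AA) * TT hE 3 (-5) 0 + (- (y ^ 2)) * TT hE 3 (-5) 2 + (y ^ 4) * TT hE 3 (-5) 3
    = - (1/2) * (1 / AA) * (PP 0 + 2 * PP 2)"
  by (rule scaled_sums(3)[OF partial_fractions_TT(4)[OF partial_fractions_intro[of "{}" "{0,2,3}"]], where c = "q2 * g1 * g2" and v = "1 / AA"])
    (use nz in \<open>auto simp: list_simps field_simps power_numeral_reduce\<close>)

lemma N024h: "1 * TT hE 3 (-6) 0 + (- (y ^ 2) / AA) * TT hE 3 (-6) 2 + (y ^ 6) * TT hE 3 (-6) 4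
    = - (1/2) * ((rho 1 - rho 2)\<^sup>2 - (rho 1 - rho 2) + (PP 0 + PP 1 + PP 2))"
  by (rule scaled_sums(3)[OF partial_fractions_TT(4)[OF partial_fractions_intro[of "{}" "{0,2,4}"]], where c = "q2 * g1 * g2" and v = "1"])
    (use nz in \<open>auto simp: list_simps field_simps power_numeral_reduce\<close>)

lemma N123h: "1 * TT hE 3 (-6) 1 + (- y * AA) * TT hE 3 (-6) 2 + (y ^ 3) * TT hE 3 (-6) 3
    = - (q2 / g2) * rho 1"
  by (rule scaled_sums(3)[OF partial_fractions_TT(2)[OF partial_fractions_intro[of "{}" "{1,2,3}"]], where c = "q2 * g1 * g2" and v = "q2 / g2"])
    (use nz in \<open>auto simp: list_simps field_simps power_numeral_reduce\<close>)

lemma N024p: "1 * TT psi 3 (-6) 0 + (- (y ^ 2) / AA) * TT psi 3 (-6) 2 + (y ^ 6) * TT psi 3 (-6) 4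
    = - (rho 1 - rho 2)"
  by (rule scaled_sums(3)[OF partial_fractions_TT(3)[OF partial_fractions_intro[of "{}" "{0,2,4}"]], where c = "q2 * g1 * g2" and v = "1"])
    (use nz in \<open>auto simp: list_simps field_simps power_numeral_reduce\<close>)

lemma N123p: "1 * TT psi 3 (-6) 1 + (- y * AA) * TT psi 3 (-6) 2 + (y ^ 3) * TT psi 3 (-6) 3
    = q2 / g2"
  by (rule scaled_sums(3)[OF partial_fractions_TT(1)[OF partial_fractions_intro[of "{}" "{1,2,3}"]], where c = "q2 * g1 * g2" and v = "q2 / g2"])
    (use nz in \<open>auto simp: list_simps field_simps power_numeral_reduce\<close>)

lemma M0: "1 * TT hE 1 0 0
    = - (1/2) * (PP 0)"
  by (rule scaled_sums(1)[OF partial_fractions_TT(4)[OF partial_fractions_intro[of "{}" "{0}"]], where c = "q2" and v = "1"])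
    (use nz in \<open>auto simp: list_simps field_simps power_numeral_reduce\<close>)

text \<open>For d = 1 three poles need two zeros; {2, 3} is chosen because 2 + 3 - (0 + 1 + 4) = 0
  is the value of S that \<open>bil_triangular\<close> requires for e = 2.\<close>

lemma M014: "(AA ^ 2) * TT hE 1 0 0 + (- y) * TT hE 1 0 1 + (y ^ 4) * TT hE 1 0 4
    = - (1/2) * (AA ^ 2) * (PP 0 + 2 * PP 1 - 2 * PP 2)"
  by (rule scaled_sums(3)[OF partial_fractions_TT(4)[OF partial_fractions_intro[of "{2,3}" "{0,1,4}"]], where c = "q2" and v = "AA ^ 2"])
    (use nz in \<open>auto simp: list_simps field_simps power_numeral_reduce\<close>)

lemma M023: "(1 / AA ^ 2) * TT hE 1 0 0 + y * TT hE 1 0 2 + (- (y ^ 2)) * TT hE 1 0 3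
    = - (1/2) * (1 / AA ^ 2) * (PP 0 + 2 * PP 2 - 2 * PP 1)"
  by (rule scaled_sums(3)[OF partial_fractions_TT(4)[OF partial_fractions_intro[of "{1,4}" "{0,2,3}"]], where c = "q2" and v = "1 / AA ^ 2"])
    (use nz in \<open>auto simp: list_simps field_simps power_numeral_reduce\<close>)

lemma M02h: "1 * TT hE 1 (-1) 0 + y * TT hE 1 (-1) 2
    = - (1/2) * ((rho 1 - rho 2)\<^sup>2 - (rho 1 - rho 2) - PP 1 + PP 0 + PP 2)"
  by (rule scaled_sums(2)[OF partial_fractions_TT(4)[OF partial_fractions_intro[of "{1}" "{0,2}"]], where c = "q2 * AA" and v = "1"])
    (use nz in \<open>auto simp: list_simps field_simps power_numeral_reduce\<close>)

lemma M1h: "1 * TT hE 1 (-1) 1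
    = - uu * rho 1"
  by (rule scaled_sums(1)[OF partial_fractions_TT(2)[OF partial_fractions_intro[of "{}" "{1}"]], where c = "q2" and v = "uu"])
    (use nz in \<open>auto simp: list_simps field_simps power_numeral_reduce\<close>)

lemma M34h: "1 * TT hE 1 (-1) (-2) + (- 1) * TT hE 1 (-1) (-1)
    = (y * (q2 / g2) / AA) * (2 * rho 1 + rho 2 - 1)"
  by (rule scaled_sums(2)[OF partial_fractions_TT(2)[OF partial_fractions_intro[of "{-4}" "{-2,-1}"]], where c = "- q2 * y ^ 2 / AA" and v = "y * (q2 / g2) / AA"])
    (use nz in \<open>auto simp: list_simps field_simps power_numeral_reduce\<close>)

text \<open>A second evaluation: the sums of \<open>M02h\<close> and of \<open>M1h\<close> occur
  together, with the same \<open>d\<close> and \<open>S\<close>. The comparison yields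
  \<open>PP_relation\<close>.\<close>

lemma M012h: "1 * TT hE 1 (-1) 0 + (- (AA ^ 2)) * TT hE 1 (-1) 1 + y * TT hE 1 (-1) 2
    = - (1/2) * ((1 - 2 * rho 1 - 2 * rho 2)\<^sup>2 - (1 - 2 * rho 1 - 2 * rho 2) + PP 0)"
  by (rule scaled_sums(3)[OF partial_fractions_TT(4)[OF partial_fractions_intro[of "{-1,3}" "{0,1,2}"]], where c = "- q2 * y" and v = "1"])
    (use nz in \<open>auto simp: list_simps field_simps power_numeral_reduce\<close>)

lemma M02p: "1 * TT psi 1 (-1) 0 + y * TT psi 1 (-1) 2
    = - (rho 1 - rho 2)"
  by (rule scaled_sums(2)[OF partial_fractions_TT(3)[OF partial_fractions_intro[of "{1}" "{0,2}"]], where c = "q2 * AA" and v = "1"])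
    (use nz in \<open>auto simp: list_simps field_simps power_numeral_reduce\<close>)

lemma M1p: "1 * TT psi 1 (-1) 1
    = uu"
  by (rule scaled_sums(1)[OF partial_fractions_TT(1)[OF partial_fractions_intro[of "{}" "{1}"]], where c = "q2" and v = "uu"])
    (use nz in \<open>auto simp: list_simps field_simps power_numeral_reduce\<close>)

lemma M34p: "1 * TT psi 1 (-1) (-2) + (- 1) * TT psi 1 (-1) (-1)
    = y * (q2 / g2) / AA"
  by (rule scaled_sums(2)[OF partial_fractions_TT(1)[OF partial_fractions_intro[of "{-4}" "{-2,-1}"]], where c = "- q2 * y ^ 2 / AA" and v = "y * (q2 / g2) / AA"])
    (use nz in \<open>auto simp: list_simps field_simps power_numeral_reduce\<close>)

lemma M012p: "1 * TT psi 1 (-1) 0 + (- (AA ^ 2)) * TT psi 1 (-1) 1 + y * TT psi 1 (-1) 2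
    = - (1 - 2 * rho 1 - 2 * rho 2)"
  by (rule scaled_sums(3)[OF partial_fractions_TT(3)[OF partial_fractions_intro[of "{-1,3}" "{0,1,2}"]], where c = "- q2 * y" and v = "1"])
    (use nz in \<open>auto simp: list_simps field_simps power_numeral_reduce\<close>)

text \<open>The auxiliary value S = -2: \<open>W04\<close> and \<open>W2\<close> together contain
  the sums of \<open>W024\<close>, and the comparison yields \<open>rho_relation_2\<close>.\<close>

lemma W04: "1 * TT psi 1 (-2) 0 + (y ^ 2) * TT psi 1 (-2) 4
    = - (rho 1 + rho 2)"
  by (rule scaled_sums(2)[OF partial_fractions_TT(3)[OF partial_fractions_intro[of "{2}" "{0,4}"]], where c = "q2 / AA" and v = "1"])
    (use nz in \<open>auto simp: list_simps field_simps power_numeral_reduce\<close>)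

lemma W2: "1 * TT psi 1 (-2) 2
    = q2 / g2"
  by (rule scaled_sums(1)[OF partial_fractions_TT(1)[OF partial_fractions_intro[of "{}" "{2}"]], where c = "q2" and v = "q2 / g2"])
    (use nz in \<open>auto simp: list_simps field_simps power_numeral_reduce\<close>)

lemma W024: "1 * TT psi 1 (-2) 0 + (y / AA ^ 2) * TT psi 1 (-2) 2 + (y ^ 2) * TT psi 1 (-2) 4
    = - (2 * rho 1 - 2 * rho 2)"
  by (rule scaled_sums(3)[OF partial_fractions_TT(3)[OF partial_fractions_intro[of "{1,3}" "{0,2,4}"]], where c = "q2" and v = "1"])
    (use nz in \<open>auto simp: list_simps field_simps power_numeral_reduce\<close>)

end

section \<open>Comparison of the moments\<close>

context nome
begin

text \<open>\<open>M02p\<close> and \<open>M1p\<close> together contain the sums of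
  \<open>M012p\<close>; subtracting eliminates the sums and leaves a theta quotient in terms of
  logarithmic derivatives.\<close>

lemma rho_relation_1: "AA ^ 2 * uu = 1 - 3 * rho 1 - rho 2"
proof -
  have "TT psi 1 (-1) 0 + y * TT psi 1 (-1) 2 = - (rho 1 - rho 2)" using M02p by simp
  moreover have "TT psi 1 (-1) 1 = uu" using M1p by simp
  moreover have "TT psi 1 (-1) 0 - AA ^ 2 * TT psi 1 (-1) 1 + y * TT psi 1 (-1) 2 = - (1 - 2 * rho 1 - 2 * rho 2)"
    using M012p by simp
  ultimately show ?thesis by simp
qed

lemma rho_relation_2: "y * (q2 / g2) / AA ^ 2 = 3 * rho 2 - rho 1"
proof -
  define k where "k = y / AA ^ 2"
  define v where "v = q2 / g2"
  have "TT psi 1 (-2) 0 + y ^ 2 * TT psi 1 (-2) 4 = - (rho 1 + rho 2)" using W04 by simp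
  moreover have "TT psi 1 (-2) 2 = v" using W2 by (simp add: v_def)
  moreover have "TT psi 1 (-2) 0 + k * TT psi 1 (-2) 2 + y ^ 2 * TT psi 1 (-2) 4 = - (2 * rho 1 - 2 * rho 2)"
    using W024 by (simp add: k_def)
  ultimately have "k * v = 3 * rho 2 - rho 1" by simp
  then show ?thesis by (simp add: k_def v_def mult.commute)
qed

text \<open>The same comparison at second order. The quadratic expression in \<open>rho\<close>
  factors as (1 - 3 rho 1 - rho 2)(3 rho 2 - rho 1), and both factors are theta quotients by the two
  preceding relations.\<close>

lemma PP_relation: "PP 1 - PP 2 = y * uu * (q2 / g2)"
proof -
  define s where "s = AA ^ 2 * uu"
  have s: "s = 1 - 3 * rho 1 - rho 2" unfolding s_def by (rule rho_relation_1)
  have "TT hE 1 (-1) 0 + y * TT hE 1 (-1) 2 = - (1/2) * ((rho 1 - rho 2)\<^sup>2 - (rho 1 - rho 2) - PP 1 + PP 0 + PP 2)"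
    using M02h by simp
  moreover have "AA ^ 2 * TT hE 1 (-1) 1 = - s * rho 1" using M1h by (simp add: s_def)
  moreover have "TT hE 1 (-1) 0 - AA ^ 2 * TT hE 1 (-1) 1 + y * TT hE 1 (-1) 2 =
      - (1/2) * ((1 - 2 * rho 1 - 2 * rho 2)\<^sup>2 - (1 - 2 * rho 1 - 2 * rho 2) + PP 0)"
    using M012h by simp
  ultimately have "PP 1 - PP 2 = (rho 1 - rho 2)\<^sup>2 - (rho 1 - rho 2) - (1 - 2 * rho 1 - 2 * rho 2)\<^sup>2
      + (1 - 2 * rho 1 - 2 * rho 2) - 2 * s * rho 1"
    by (simp only:) (simp add: algebra_simps)
  also have "\<dots> = s * (3 * rho 2 - rho 1)"
    unfolding s by (simp add: algebra_simps power2_eq_square)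
  also have "\<dots> = y * uu * (q2 / g2)"
    unfolding rho_relation_2[symmetric] s_def using nz by (simp add: field_simps)
  finally show ?thesis .
qed

end

lemma (in small_nome) moment_pentagonal: "moment y pentagonal"
proof unfold_locales
  show "pentagonal k \<ge> 0" for k by (rule pentagonal_nonneg)
  show "pentagonal (- k) = pentagonal k - k" for k by (rule pentagonal_uminus)
  show "pentagonal k \<ge> 7 * \<bar>k\<bar> - 28" for k
  proof -
    have "(2 * \<bar>k\<bar> - 5) * (2 * \<bar>k\<bar> - 5) \<ge> 0" by simp
    moreover have "\<bar>k\<bar> * \<bar>k\<bar> = k * k" by (simp add: abs_mult_self_eq)
    ultimately have "4 * (k * k) \<ge> 20 * \<bar>k\<bar> - 25" by (simp add: algebra_simps)
    then show ?thesis using two_pentagonal[of k] by (simp add: algebra_simps)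
  qed
  show "pentagonal k + k \<ge> - 3" "pentagonal k + 2 * k \<ge> - 3" for k
    using pentagonal_ge[of k] pentagonal_ge_abs[of k] by linarith+
qed

lemma (in small_nome) moment_triangular: "moment y triangular"
proof unfold_locales
  have sq: "k * k \<ge> a * k + a * k - a * a" for a k :: int
  proof -
    have "(k - a) * (k - a) \<ge> 0" by simp
    then show ?thesis by (simp add: algebra_simps)
  qed
  show "triangular k \<ge> 0" for k by (rule triangular_nonneg)
  show "triangular (- k) = triangular k - k" for k by (rule triangular_uminus)
  show "triangular k \<ge> 7 * \<bar>k\<bar> - 28" for k
  proof -
    have "(\<bar>k\<bar> - 7) * (\<bar>k\<bar> - 8) \<ge> 0"
      by (cases "\<bar>k\<bar> \<ge> 8") (auto intro!: mult_nonneg_nonneg mult_nonpos_nonpos)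
    moreover have "\<bar>k\<bar> * \<bar>k\<bar> = k * k" by (simp add: abs_mult_self_eq)
    ultimately have "k * k \<ge> 15 * \<bar>k\<bar> - 56" by (simp add: algebra_simps)
    then show ?thesis using two_triangular[of k] by (simp add: algebra_simps)
  qed
  show "triangular k + k \<ge> - 3" "triangular k + 2 * k \<ge> - 3" for k
  proof -
    have "(k + 2) * (k + 3) \<ge> 0"
      by (cases "k \<ge> -2") (auto intro!: mult_nonneg_nonneg mult_nonpos_nonpos)
    then have "k * k + 5 * k + 6 \<ge> 0" by (simp add: algebra_simps)
    then show "triangular k + 2 * k \<ge> - 3" using two_triangular[of k] by (simp add: algebra_simps)
    have "(k + 1) * (k + 2) \<ge> 0"
      by (cases "k \<ge> -1") (auto intro!: mult_nonneg_nonneg mult_nonpos_nonpos)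
    then have "k * k + 3 * k + 2 \<ge> 0" by (simp add: algebra_simps)
    then show "triangular k + k \<ge> - 3" using two_triangular[of k] by (simp add: algebra_simps)
  qed
qed

lemma triangular_5: "triangular (5 * l + b) = triangular b + 5 * ((5 * l\<^sup>2 + l) div 2 + l * b)"
proof -
  define q where "q = (5 * l\<^sup>2 + l) div 2"
  have "even (5 * l\<^sup>2 + l)" by simp
  then have "2 * q = 5 * l\<^sup>2 + l" by (simp add: q_def)
  then show ?thesis
    unfolding q_def[symmetric] using two_triangular[of "5 * l + b"] two_triangular[of b]
    by (simp add: algebra_simps power2_eq_square)
qed

lemma residues_5: "bij_betw (\<lambda>b. b mod 5) {0, 1, 2, 3, 4} {0..4::int}" "bij_betw (\<lambda>b. b mod 5) {0, 1, 2, -2, -1} {0..4::int}"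
proof -
  have "{0..4::int} = {0, 1, 2, 3, 4}" by auto
  then show "bij_betw (\<lambda>b. b mod 5) {0, 1, 2, 3, 4} {0..4::int}" "bij_betw (\<lambda>b. b mod 5) {0, 1, 2, -2, -1} {0..4::int}"
    by (auto simp: bij_betw_def inj_on_def)
qed

context small_nome
begin

text \<open>The exponent (15 l^2 + l)/2 + 3 l b + e l has the shape l (S + d b) + 5 d l(l + 1)/2
  with d = 3 and S = e - 7; the triangular case gives d = 1 and S = e - 2.\<close>

lemma bil_pentagonal:
  assumes e: "e = 1 \<or> e = 2" and f: "\<And>k. \<bar>f k\<bar> \<le> C"
  shows "moment.bil y pentagonal e f = (\<Sum>b\<in>{0, 1, 2, 3, 4}. (-1) powi b * Psi (1 - pentagonal b - e * b) * TT f 3 (e - 7) b)"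
proof -
  interpret P: moment y pentagonal by (rule moment_pentagonal)
  have "(15 * l\<^sup>2 + l) div 2 + 3 * l * b + e * l = l * ((e - 7) + 3 * b) + 5 * 3 * triangular l" for l b
  proof -
    have "even (15 * l\<^sup>2 + l)" by simp
    then have "2 * ((15 * l\<^sup>2 + l) div 2) = 15 * l\<^sup>2 + l" by simp
    then show ?thesis using two_triangular[of l] by (simp add: algebra_simps power2_eq_square)
  qed
  then show ?thesis
    unfolding TT_def P.bil_split[OF e f residues_5(1) pentagonal_5] by simp
qed

lemma bil_triangular:
  assumes e: "e = 1 \<or> e = 2" and f: "\<And>k. \<bar>f k\<bar> \<le> C" and R: "bij_betw (\<lambda>b. b mod 5) R {0..4::int}"
  shows "moment.bil y triangular e f = (\<Sum>b\<in>R. (-1) powi b * Psi (1 - triangular b - e * b) * TT f 1 (e - 2) b)"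
proof -
  interpret P: moment y triangular by (rule moment_triangular)
  have "(5 * l\<^sup>2 + l) div 2 + l * b + e * l = l * ((e - 2) + 1 * b) + 5 * 1 * triangular l" for l b
  proof -
    have "even (5 * l\<^sup>2 + l)" by simp
    then have "2 * ((5 * l\<^sup>2 + l) div 2) = 5 * l\<^sup>2 + l" by simp
    then show ?thesis using two_triangular[of l] by (simp add: algebra_simps power2_eq_square)
  qed
  then show ?thesis
    unfolding TT_def P.bil_split[OF e f R triangular_5] by simp
qed

lemma Psi_values:
  "Psi 1 = Pi 1" "Psi 2 = Pi 2" "Psi (-1) = y * Pi 4" "Psi (-2) = y * Pi 3" "Psi (-3) = y * Pi 2" "Psi (-4) = y * Pi 1"
  "Psi (-6) = y ^ 2 * Pi 4" "Psi (-8) = y ^ 2 * Pi 2" "Psi (-10) = y ^ 2 * Pi 0" "Psi (-11) = y ^ 3 * Pi 4"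
  "Psi (-17) = y ^ 4 * Pi 3" "Psi (-20) = y ^ 4 * Pi 0" "Psi (-29) = y ^ 6 * Pi 1" "Psi (-33) = y ^ 7 * Pi 2"
  by (simp_all add: Psi_def E_def)

lemma Pi_relations:
  "AA * Pi 1 = Pi 0 + y * Pi 4 / AA" "AA * Pi 2 = Pi 1 + Pi 0 / AA"
  "AA * Pi 3 = Pi 2 + Pi 1 / AA" "AA * Pi 4 = Pi 3 + Pi 2 / AA"
  using Psi_relation[of 1] Psi_relation[of 2] Psi_relation[of 3] Psi_relation[of 4]
  by (simp_all add: Psi_values Psi_eq_Pi)

text \<open>Each class sum enters with a power of \<open>y\<close> times some \<open>Pi r\<close>;
  where classes overlap, \<open>Pi_relations\<close> splits the coefficient so that the sums regroup
  into the available pole sets.\<close>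

lemma bil_values:
  defines "v \<equiv> q2 / g2" and "R \<equiv> (rho 1 - rho 2)\<^sup>2 - (rho 1 - rho 2)"
  shows "moment.bil y pentagonal 2 hE = - (1/2) * (Pi 2 * AA * (PP 0 + 2 * PP 1) - Pi 0 / AA * (PP 0 + 2 * PP 2))"
    and "moment.bil y triangular 2 hE = - (1/2) * Pi 1 * PP 0 + (PP 2 - PP 1) * (Pi 3 * AA ^ 2 - y * Pi 4 / AA ^ 2)"
    and "moment.bil y pentagonal 1 psi = - Pi 1 * (rho 1 - rho 2) - y * Pi 3 * v"
    and "moment.bil y triangular 1 psi = - Pi 1 * (rho 1 - rho 2) - y * Pi 4 * uu + Pi 2 * y * v / AA"
    and "moment.bil y pentagonal 1 hE = - (1/2) * Pi 1 * (R + (PP 0 + PP 1 + PP 2)) + y * Pi 3 * v * rho 1"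
    and "moment.bil y triangular 1 hE = - (1/2) * Pi 1 * (R - PP 1 + PP 0 + PP 2) + y * Pi 4 * uu * rho 1
       + Pi 2 * y * v / AA * (2 * rho 1 + rho 2 - 1)"
proof -
  define A where "A = AA"
  have A: "A \<noteq> 0" using nz by (simp add: A_def)
  note Pi = Pi_relations[folded A_def]
  \<comment> \<open>The class b = 0 carries \<open>Pi 1\<close> and lies in both {0, 1, 4} and {0,
    2, 3}; this splits it with the weights A and 1/A that \<open>N014\<close> and
    \<open>N023\<close> demand.\<close>
  have c0: "A * Pi 2 - Pi 0 / A = Pi 1" using Pi(2) by simp
  have e12: "- (7::int) + 2 = -5" "2 - (7::int) = -5" "1 - (7::int) = -6" "2 - (2::int) = 0" "1 - (2::int) = -1" by simp_all
  have pe: "pentagonal 0 = 0" "pentagonal 1 = 2" "pentagonal 2 = 7" "pentagonal 3 = 15" "pentagonal 4 = 26"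
    and tr: "triangular 0 = 0" "triangular 1 = 1" "triangular 2 = 3" "triangular 3 = 6" "triangular 4 = 10"
      "triangular (-1) = 0" "triangular (-2) = 1"
    by (simp_all add: pentagonal_def triangular_def)
  have sgn: "(-1::real) powi 0 = 1" "(-1::real) powi 1 = -1" "(-1::real) powi 2 = 1" "(-1::real) powi 3 = -1" "(-1::real) powi 4 = 1"
    "(-1::real) powi (-1) = -1" "(-1::real) powi (-2) = 1"
    by (simp_all add: power_int_def)
  have combine: "p * X + q * Y = Z" if "X = X'" "Y = Y'" "p * X' + q * Y' = Z" for p q X X' Y Y' Z :: real
    using that by simp
  show "moment.bil y pentagonal 2 hE = - (1/2) * (Pi 2 * AA * (PP 0 + 2 * PP 1) - Pi 0 / AA * (PP 0 + 2 * PP 2))"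
  proof -
    have "moment.bil y pentagonal 2 hE = (A * Pi 2 - Pi 0 / A) * TT hE 3 (-5) 0 - y * Pi 2 * TT hE 3 (-5) 1 + y ^ 2 * Pi 0 * TT hE 3 (-5) 2
        - y ^ 4 * Pi 0 * TT hE 3 (-5) 3 + y ^ 7 * Pi 2 * TT hE 3 (-5) 4"
      using bil_pentagonal[OF _ hE_bound, of 2] unfolding c0 by (simp add: pe sgn Psi_values e12)
    also have "\<dots> = Pi 2 * ((A) * TT hE 3 (-5) 0 + (- y) * TT hE 3 (-5) 1 + (y ^ 7) * TT hE 3 (-5) 4)
        + (- Pi 0) * ((1 / A) * TT hE 3 (-5) 0 + (- (y ^ 2)) * TT hE 3 (-5) 2 + (y ^ 4) * TT hE 3 (-5) 3)"
      by (simp add: algebra_simps)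
    also have "\<dots> = - (1/2) * (Pi 2 * A * (PP 0 + 2 * PP 1) - Pi 0 / A * (PP 0 + 2 * PP 2))"
      unfolding N014[folded A_def] N023[folded A_def] by (simp add: algebra_simps)
    finally show ?thesis unfolding A_def .
  qed
  have x0: "TT hE 1 0 0 = - (1/2) * PP 0" using M0 by simp
  show "moment.bil y triangular 2 hE = - (1/2) * Pi 1 * PP 0 + (PP 2 - PP 1) * (Pi 3 * AA ^ 2 - y * Pi 4 / AA ^ 2)"
  proof -
    have "moment.bil y triangular 2 hE = Pi 1 * TT hE 1 0 0 - y * Pi 3 * TT hE 1 0 1 + y ^ 2 * Pi 4 * TT hE 1 0 2
        - y ^ 3 * Pi 4 * TT hE 1 0 3 + y ^ 4 * Pi 3 * TT hE 1 0 4"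
      using bil_triangular[OF _ hE_bound residues_5(1), of 2] by (simp add: tr sgn Psi_values e12)
    \<comment> \<open>What the two triples leave over at b = 0 is evaluated alone by
      \<open>M0\<close>.\<close>
    also have "\<dots> = Pi 3 * ((A ^ 2) * TT hE 1 0 0 + (- y) * TT hE 1 0 1 + (y ^ 4) * TT hE 1 0 4)
        + y * Pi 4 * ((1 / A ^ 2) * TT hE 1 0 0 + (y) * TT hE 1 0 2 + (- (y ^ 2)) * TT hE 1 0 3)
        + (Pi 1 - Pi 3 * A ^ 2 - y * Pi 4 / A ^ 2) * TT hE 1 0 0"
      by (simp add: algebra_simps power_numeral_reduce)
    also have "\<dots> = - (1/2) * Pi 1 * PP 0 + (PP 2 - PP 1) * (Pi 3 * A ^ 2 - y * Pi 4 / A ^ 2)"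
      unfolding M014[folded A_def] M023[folded A_def] by (simp add: x0 algebra_simps diff_divide_distrib)
    finally show ?thesis unfolding A_def .
  qed
  \<comment> \<open>Likewise the class b = 2 lies in both {0, 2, 4} and {1, 2, 3}, and
    \<open>Pi 2\<close> is split between them.\<close>
  have c2: "- (Pi 1 * (y ^ 2 / A)) + y ^ 2 * A * Pi 3 = y ^ 2 * Pi 2"
  proof -
    have "y ^ 2 * (A * Pi 3 - Pi 1 / A) = y ^ 2 * Pi 2" using Pi(3) by simp
    then show ?thesis by (simp add: algebra_simps)
  qed
  have pent1: "moment.bil y pentagonal 1 f = Pi 1 * ((1) * TT f 3 (-6) 0 + (- (y ^ 2) / A) * TT f 3 (-6) 2 + (y ^ 6) * TT f 3 (-6) 4)
        + (- y * Pi 3) * ((1) * TT f 3 (-6) 1 + (- y * A) * TT f 3 (-6) 2 + (y ^ 3) * TT f 3 (-6) 3)"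
    if f: "\<And>k. \<bar>f k\<bar> \<le> C" for f C
  proof -
    have "moment.bil y pentagonal 1 f = Pi 1 * TT f 3 (-6) 0 - y * Pi 3 * TT f 3 (-6) 1 + (y ^ 2 * Pi 2) * TT f 3 (-6) 2
        - y ^ 4 * Pi 3 * TT f 3 (-6) 3 + y ^ 6 * Pi 1 * TT f 3 (-6) 4"
      using bil_pentagonal[OF _ f, of 1] by (simp add: pe sgn Psi_values e12)
    then show ?thesis
      unfolding c2[symmetric] by (simp add: algebra_simps power_numeral_reduce)
  qed
  show "moment.bil y pentagonal 1 psi = - Pi 1 * (rho 1 - rho 2) - y * Pi 3 * v"
    unfolding pent1[OF psi_bound] N024p[folded A_def] N123p[folded A_def] v_def by (simp add: algebra_simps)
  show "moment.bil y pentagonal 1 hE = - (1/2) * Pi 1 * (R + (PP 0 + PP 1 + PP 2)) + y * Pi 3 * v * rho 1"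
    unfolding pent1[OF hE_bound] N024h[folded A_def] N123h[folded A_def] v_def R_def by simp
  have tri1: "moment.bil y triangular 1 f = Pi 1 * ((1) * TT f 1 (-1) 0 + (y) * TT f 1 (-1) 2) - y * Pi 4 * ((1) * TT f 1 (-1) 1)
        + Pi 2 * ((1) * TT f 1 (-1) (-2) + (- 1) * TT f 1 (-1) (-1))"
    if f: "\<And>k. \<bar>f k\<bar> \<le> C" for f C
    using bil_triangular[OF _ f residues_5(2), of 1] by (simp add: tr sgn Psi_values e12 algebra_simps)
  show "moment.bil y triangular 1 psi = - Pi 1 * (rho 1 - rho 2) - y * Pi 4 * uu + Pi 2 * y * v / AA"
    unfolding tri1[OF psi_bound] M02p M1p M34p v_def by (simp add: algebra_simps)
  show "moment.bil y triangular 1 hE = - (1/2) * Pi 1 * (R - PP 1 + PP 0 + PP 2) + y * Pi 4 * uu * rho 1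
       + Pi 2 * y * v / AA * (2 * rho 1 + rho 2 - 1)"
    unfolding tri1[OF hE_bound] M02h M1h M34h v_def R_def by simp
qed

text \<open>The \<open>psi\<close> sums agree on their own. For \<open>hE\<close> the pentagonal
  value exceeds the triangular one by the same amount, -Pi 1 PP 1 + y u v A Pi 2, at e = 2 and at e
  = 1, and these enter with opposite coefficients 5 and -5.\<close>

lemma bil_balance:
  "5 * moment.bil y pentagonal 2 hE - 2 * moment.bil y pentagonal 1 psi - 5 * moment.bil y pentagonal 1 hE =
   5 * moment.bil y triangular 2 hE - 2 * moment.bil y triangular 1 psi - 5 * moment.bil y triangular 1 hE"
proof -
  define A where "A = AA"
  define u where "u = uu"
  define v where "v = q2 / g2"
  have A: "A \<noteq> 0" using nz by (simp add: A_def)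
  have uv: "u = v * A" using nz by (simp add: u_def v_def A_def)
  note Pi = Pi_relations[folded A_def]
  have s: "A ^ 2 * u = 1 - 3 * rho 1 - rho 2" unfolding A_def u_def by (rule rho_relation_1)
  have P12: "PP 1 - PP 2 = y * u * v" unfolding u_def v_def by (rule PP_relation)
  have B: "moment.bil y pentagonal 1 psi = moment.bil y triangular 1 psi"
  proof -
    have "y * Pi 4 * u = y * v * (A * Pi 4)" by (simp add: uv)
    also have "\<dots> = y * Pi 3 * v + Pi 2 * y * v / A" unfolding Pi(4) by (simp add: algebra_simps)
    finally show ?thesis
      unfolding bil_values(3,4) A_def[symmetric] u_def[symmetric] v_def[symmetric] by simp
  qed
  have D: "moment.bil y pentagonal 1 hE - moment.bil y triangular 1 hE = - Pi 1 * PP 1 + y * u * v * (A * Pi 2)"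
  proof -
    have 1: "y * Pi 4 * u * rho 1 = y * Pi 3 * v * rho 1 + Pi 2 * y * v / A * rho 1"
    proof -
      have "y * Pi 4 * u = y * v * (A * Pi 4)" by (simp add: uv)
      also have "\<dots> = y * Pi 3 * v + Pi 2 * y * v / A" unfolding Pi(4) by (simp add: algebra_simps)
      finally show ?thesis by (simp add: algebra_simps)
    qed
    have "moment.bil y pentagonal 1 hE - moment.bil y triangular 1 hE = - Pi 1 * PP 1 + Pi 2 * y * v / A * (1 - 3 * rho 1 - rho 2)"
      unfolding bil_values(5,6) A_def[symmetric] u_def[symmetric] v_def[symmetric] 1 by (simp add: algebra_simps)
    also have "Pi 2 * y * v / A * (1 - 3 * rho 1 - rho 2) = y * u * v * (A * Pi 2)"
      unfolding s[symmetric] using A by (simp add: power2_eq_square)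
    finally show ?thesis .
  qed
  have C: "moment.bil y pentagonal 2 hE - moment.bil y triangular 2 hE = - Pi 1 * PP 1 + y * u * v * (A * Pi 2)"
  proof -
    have p0: "Pi 2 * A = Pi 1 + Pi 0 / A" using Pi(2) by (simp add: mult.commute)
    have br: "Pi 3 * A ^ 2 - y * Pi 4 / A ^ 2 - Pi 0 / A = A * Pi 2"
    proof -
      have "Pi 3 * A ^ 2 = A * (A * Pi 3)" by (simp add: power2_eq_square)
      also have "\<dots> = A * Pi 2 + Pi 1" unfolding Pi(3) using A by (simp add: algebra_simps)
      finally have 1: "Pi 3 * A ^ 2 = A * Pi 2 + Pi 1" .
      have "Pi 1 = (A * Pi 1) / A" using A by simp
      also have "\<dots> = Pi 0 / A + y * Pi 4 / A ^ 2" unfolding Pi(1) by (simp add: add_divide_distrib power2_eq_square)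
      finally show ?thesis using 1 by simp
    qed
    define w z where "w = Pi 0 / A" and "z = y * Pi 4 / A ^ 2"
    have "moment.bil y pentagonal 2 hE - moment.bil y triangular 2 hE
      = - Pi 1 * PP 1 + (PP 1 - PP 2) * (Pi 3 * A ^ 2 - y * Pi 4 / A ^ 2 - Pi 0 / A)"
      unfolding bil_values(1,2) A_def[symmetric] p0 w_def[symmetric] z_def[symmetric] by (simp add: algebra_simps)
    then show ?thesis unfolding br P12 by simp
  qed
  show ?thesis using B C D by linarith
qed

lemma moment_sums_agree:
  "moment_sum (\<lambda>j. pentagonal (- int (Suc j))) - moment_sum (\<lambda>j. pentagonal (int (Suc j))) =
   moment_sum (\<lambda>j. triangular (- int (Suc j))) - moment_sum (\<lambda>j. triangular (int (Suc j)))"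
proof -
  interpret P: moment y pentagonal by (rule moment_pentagonal)
  interpret T: moment y triangular by (rule moment_triangular)
  show ?thesis using P.moment_difference T.moment_difference bil_balance by simp
qed

end

section \<open>Comparison of coefficients\<close>

definition moment_coeff :: "(int \<Rightarrow> int) \<Rightarrow> nat \<Rightarrow> real" where
  "moment_coeff u n = (\<Sum>m=1..n. \<Sum>j=1..n. real m * real_of_int (chi (int m)) * (-1) ^ (j - 1)
     * real_of_int (npart (int n - u (int j) - int m * int j)))"

text \<open>Passing from \<open>m\<close> to \<open>m + 1\<close> subtracts a further
  \<open>j\<close>, and t(-j) + j = t(j): consecutive differences of counts become differences
  between the two sign versions of \<open>t\<close>.\<close>

lemma moment_coeff_diff:
  assumes t: "\<And>k. t (- k) = t k - k"
    and h: "\<And>m. m \<ge> 1 \<Longrightarrow> h m = (\<Sum>j=1..n. (-1) ^ (j - 1) * real_of_int (npart (int n - t (- int j) - int m * int j)))"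
  shows "(\<Sum>m=1..n. real m * real_of_int (chi (int m)) * (h m - h (m + 1))) = moment_coeff (\<lambda>k. t (- k)) n - moment_coeff t n"
proof -
  have "real m * real_of_int (chi (int m)) * (h m - h (m + 1)) =
      (\<Sum>j=1..n. real m * real_of_int (chi (int m)) * (-1) ^ (j - 1) * real_of_int (npart (int n - t (- int j) - int m * int j)))
    - (\<Sum>j=1..n. real m * real_of_int (chi (int m)) * (-1) ^ (j - 1) * real_of_int (npart (int n - t (int j) - int m * int j)))"
    if "m \<in> {1..n}" for m
  proof -
    have "int n - t (- int j) - int (m + 1) * int j = int n - t (int j) - int m * int j" for j
      using t[of "int j"] by (simp add: algebra_simps)
    then have "h (m + 1) = (\<Sum>j=1..n. (-1) ^ (j - 1) * real_of_int (npart (int n - t (int j) - int m * int j)))"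
      using h[of "m + 1"] by (simp only: le_add2)
    then show ?thesis
      using h[of m] that by (simp add: right_diff_distrib sum_distrib_left mult.assoc)
  qed
  then show ?thesis
    unfolding moment_coeff_def sum_subtractf[symmetric] by (rule sum.cong[OF refl])
qed

lemma NT_diff_eq_coeff:
  "real_of_int (NT 2 5 n - NT 3 5 n) = - (moment_coeff (\<lambda>k. pentagonal (- k)) n - moment_coeff pentagonal n)"
proof -
  have "(\<Sum>m=1..int n. m * chi m * (num_rank_ge m n - num_rank_ge (m + 1) n)) =
      (\<Sum>m=1..n. int m * chi (int m) * (num_rank_ge (int m) n - num_rank_ge (int m + 1) n))"
    by (rule sum.reindex_bij_witness[of _ int nat]) auto
  then have "real_of_int (NT 2 5 n - NT 3 5 n) = - (\<Sum>m=1..n. real m * real_of_int (chi (int m)) *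
      (real_of_int (num_rank_ge (int m) n) - real_of_int (num_rank_ge (int (m + 1)) n)))"
    unfolding NT_diff_eq_moment by (simp add: add.commute)
  also have "\<dots> = - (moment_coeff (\<lambda>k. pentagonal (- k)) n - moment_coeff pentagonal n)"
    by (subst moment_coeff_diff[where h = "\<lambda>m. real_of_int (num_rank_ge (int m) n)" and t = pentagonal])
       (simp_all add: pentagonal_uminus num_rank_ge_closed[of n n])
  finally show ?thesis .
qed

lemma M_omega_diff_eq_coeff:
  "real_of_int (M_omega 2 5 n - M_omega 3 5 n) = - (moment_coeff (\<lambda>k. triangular (- k)) n - moment_coeff triangular n)"
proof -
  have "(\<Sum>m=1..n. real_of_int (int m * chi (int m)) * fps_nth (crank_ge_fps m - crank_ge_fps (m + 1)) n) =
      moment_coeff (\<lambda>k. triangular (- k)) n - moment_coeff triangular n"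
    by (subst moment_coeff_diff[where h = "\<lambda>m. fps_nth (crank_ge_fps m) n" and t = triangular, symmetric])
       (auto simp: triangular_uminus crank_ge_closed[of _ n n])
  then show ?thesis unfolding M_omega_diff_eq_moment by simp
qed

lemma (in small_nome) moment_coeff_has_sum:
  assumes u: "\<And>k. u k \<ge> 0"
  shows "((\<lambda>n. moment_coeff u (5 * n + 1) * y ^ n) has_sum moment_sum (\<lambda>j. u (int (Suc j)))) UNIV"
proof -
  let ?u = "\<lambda>j. u (int (Suc j))"
  have "expo ?u p \<le> 4" for p
  proof (cases p)
    case (Pair m j)
    have "int (Suc m) * int (Suc j) \<ge> 0" by simp
    then show ?thesis using u[of "int (Suc j)"] unfolding Pair expo_def prod.case by linarith
  qed
  then have *: "((\<lambda>n. (\<Sum>\<^sub>\<infinity>p. coef p * real_of_int (npart (5 * int n + expo ?u p))) * y ^ n) has_sum moment_sum ?u) UNIV"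
    unfolding moment_sum_def by (intro interchange coef_summable u)
  have "(\<Sum>\<^sub>\<infinity>p. coef p * real_of_int (npart (5 * int n + expo ?u p))) = moment_coeff u (5 * n + 1)" for n
  proof -
    have "5 * int n = int (5 * n + 1) - 1" by simp
    then show ?thesis
      unfolding moment_coeff_def by (simp only: coef_npart_infsum[OF u order_refl]) (intro sum.cong refl, auto)
  qed
  then show ?thesis using * by simp
qed

text \<open>Only positive \<open>x\<close> are available, so the lowest nonzero coefficient is
  isolated by dividing by x^k and letting \<open>x\<close> tend to 0 from the right.\<close>

lemma powser_has_sum_0_imp_0:
  fixes a :: "nat \<Rightarrow> real"
  assumes "r > 0" and s: "\<And>x. 0 < x \<Longrightarrow> x < r \<Longrightarrow> ((\<lambda>n. a n * x ^ n) has_sum 0) UNIV"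
  shows "a n = 0"
proof (rule ccontr)
  assume "a n \<noteq> 0"
  define k where "k = (LEAST k. a k \<noteq> 0)"
  have k: "a k \<noteq> 0" unfolding k_def by (rule LeastI) fact
  have less: "a i = 0" if "i < k" for i using not_less_Least that unfolding k_def by blast
  define b where "b i = a (i + k)" for i
  have b: "(\<lambda>i. b i * x ^ i) sums 0" if x: "0 < x" "x < r" for x
  proof -
    have "(\<lambda>n. a n * x ^ n) sums 0" using s[OF x] by (rule has_sum_imp_sums)
    then have "(\<lambda>i. a (i + k) * x ^ (i + k)) sums (0 - (\<Sum>i<k. a i * x ^ i))" by (rule sums_split_initial_segment)
    then have "(\<lambda>i. x ^ k * (b i * x ^ i)) sums (x ^ k * 0)"
      using less by (simp add: b_def power_add mult_ac)
    then show ?thesis using x by (subst (asm) sums_mult_iff) auto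
  qed
  define R where "R = r / 2"
  have R: "0 < R" "R < r" using \<open>r > 0\<close> by (auto simp: R_def)
  have sm: "summable (\<lambda>i. b i * x ^ i)" if "norm x < R" for x
    using sums_summable[OF b[OF R]] by (rule powser_inside) (use that R in auto)
  have lim: "((\<lambda>x. \<Sum>i. b i * x ^ i) \<longlongrightarrow> b 0) (at 0)"
    by (rule powser_limit_0[OF R(1)]) (rule summable_sums, rule sm, simp)
  have "((\<lambda>x. \<Sum>i. b i * x ^ i) \<longlongrightarrow> b 0) (at_right 0)"
    using lim by (rule tendsto_within_subset) auto
  moreover have ev: "\<forall>\<^sub>F x in at_right 0. (\<Sum>i. b i * x ^ i) = 0"
    using eventually_at_right_less[of 0] eventually_at_right_real[OF \<open>r > 0\<close>]
    by eventually_elim (rule sums_unique[OF b, symmetric], auto)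
  ultimately have "((\<lambda>x::real. 0::real) \<longlongrightarrow> b 0) (at_right 0)"
    by (simp only: tendsto_cong[OF ev])
  then have "b 0 = 0" by (simp add: tendsto_const_iff)
  then show False using k by (simp add: b_def)
qed

theorem theorem1p4:
  fixes n :: nat
  shows "M_omega 2 5 (5 * n + 1) - M_omega 3 5 (5 * n + 1)
       = NT 2 5 (5 * n + 1) - NT 3 5 (5 * n + 1)"
proof -
  define a where "a n = (moment_coeff (\<lambda>k. pentagonal (- k)) (5 * n + 1) - moment_coeff pentagonal (5 * n + 1))
    - (moment_coeff (\<lambda>k. triangular (- k)) (5 * n + 1) - moment_coeff triangular (5 * n + 1))" for n
  have "((\<lambda>n. a n * y ^ n) has_sum 0) UNIV" if "0 < y" "y < 1 / 32" for y
  proof -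
    interpret small_nome y by unfold_locales (use that in auto)
    note pm = moment_coeff_has_sum[of "\<lambda>k. pentagonal (- k)", OF pentagonal_nonneg]
      and pp = moment_coeff_has_sum[of pentagonal, OF pentagonal_nonneg]
      and tm = moment_coeff_has_sum[of "\<lambda>k. triangular (- k)", OF triangular_nonneg]
      and tp = moment_coeff_has_sum[of triangular, OF triangular_nonneg]
    from has_sum_diff[OF has_sum_diff[OF pm pp] has_sum_diff[OF tm tp]]
    show ?thesis unfolding moment_sums_agree a_def left_diff_distrib by (simp only: diff_self)
  qed
  then have "a n = 0" by (intro powser_has_sum_0_imp_0[of "1 / 32"]) auto
  then have "real_of_int (M_omega 2 5 (5 * n + 1) - M_omega 3 5 (5 * n + 1)) = real_of_int (NT 2 5 (5 * n + 1) - NT 3 5 (5 * n + 1))"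
    unfolding a_def NT_diff_eq_coeff M_omega_diff_eq_coeff by simp
  then show ?thesis by (simp only: of_int_eq_iff)
qed

end
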